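(* Let $q(z)=(z-a_1)^{d_1}\cdots(z-a_r)^{d_r}$ with $a_1,\dots,a_r\in\mathbb{C}$ distinct and $d_1,\dots,d_r$ positive integers, let $d=d_1+\dots+d_r$, and let $L=L(x,\partial_x)=\partial_x^2-x$. Let $\ell_1,\dots,\ell_d\in\{1,\dots,r\}$ and let $f_i,g_i\in\ker(q(L)^2)$, $1\le i\le d$, be $2d$ linearly independent functions of the form $$f_i(x)=\sum_{m=0}^{2d_{\ell_i}-1}\alpha_{im}\,\mathrm{Ai}^{(m)}(x+a_{\ell_i}),\qquad g_i(x)=\sum_{n=0}^{2d_{\ell_i}-1}\alpha_{in}\,\mathrm{Bi}^{(n)}(x+a_{\ell_i}),\qquad \alpha_{im}\in\mathbb{C},$$ such that for every $k\in\{1,\dots,r\}$ and all $i,j$ with $\ell_i=\ell_j=k$, $$\sum_{\substack{0\le m,n\le 2d_k-1\\ m+n\ge 2d_k-1}}\alpha_{im}\alpha_{jn}\frac{m!\,n!}{(m+n-2d_k+1)!}\;\partial_z^{\,m+n-2d_k+1}\Big|_{z=a_k}\left(\frac{q(z)^2}{(z-a_k)^{2d_k}}\right)=0 .$$ Then the differential operator $P(x,\partial_x)$ of order $2d$ defined by the Wronskian $$P(x,\partial_x)\cdot f:=W(f_1,f_2,\dots,f_d,g_1,g_2,\dots,g_d,f)$$ has rational coefficients and satisfies $$P(x,\partial_x)^*\frac{1}{p(x)^2}P(x,\partial_x)=q(L(x,\partial_x))^2$$ for some rational function $p(x)$. Furthermore, every self-adjoint rational factorization of $q(L(x,\partial_x))^2$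 is of this form, up to replacing $(P,p)$ by $(hP,hp)$ with $h(x)$ a nonzero rational function.
   Context: $\mathrm{Ai}(x)$, $\mathrm{Bi}(x)$ are the Airy functions of the first and second kind (linearly independent solutions of $y''=xy$), and $\mathrm{Ai}^{(m)}$, $\mathrm{Bi}^{(m)}$ denote $m$-th derivatives. $W(h_1,\dots,h_n)$ is the Wronskian determinant. $P\mapsto P^*$ is the formal adjoint: $\left(\sum_j c_j(x)\partial_x^j\right)^*=\sum_j(-1)^j\partial_x^j c_j(x)$ (no complex conjugation). A self-adjoint rational factorization of $q(L)^2$ is an identity $P^*\frac{1}{p^2}P=q(L)^2$ with $P(x,\partial_x)$ a differential operator with coefficients in $\mathbb{C}(x)$ and $p(x)\in\mathbb{C}(x)$ nonzero. $\ker(q(L)^2)$ is the space of analytic solutions $y$ of $q(L)^2y=0$. *)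

theory Defs
  imports
    "HOL-Complex_Analysis.Complex_Analysis"
    "HOL-Computational_Algebra.Computational_Algebra"
    "HOL-Computational_Algebra.Field_as_Ring"
    "Jordan_Normal_Form.Determinant"
begin

section \<open>Rational functions\<close>

type_synonym ratfun = "complex poly fract"

definition ratfun_deriv :: "ratfun \<Rightarrow> ratfun" where
  "ratfun_deriv r =
     (let (a, b) = quot_of_fract r in Fract (pderiv a * b - a * pderiv b) (b * b))"

lemma ratfun_deriv_Fract:
  assumes "b \<noteq> 0"
  shows "ratfun_deriv (Fract a b) = Fract (pderiv a * b - a * pderiv b) (b * b)"
proof -
  obtain c d where cd: "quot_of_fract (Fract a b) = (c, d)" by fastforce
  have d: "d \<noteq> 0" using snd_quot_of_fract_nonzero[of "Fract a b"] cd by simp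
  have "Fract c d = Fract a b"
    using quot_to_fract_quot_of_fract[of "Fract a b"] cd by (simp add: quot_to_fract_def)
  hence eq: "a * d = c * b" using assms d by (simp add: eq_fract)
  have "pderiv (a * d) = pderiv (c * b)" by (simp only: eq)
  hence eq': "a * pderiv d + d * pderiv a = c * pderiv b + b * pderiv c"
    by (simp add: pderiv_mult)
  have "(pderiv a * b - a * pderiv b) * (d * d) - (pderiv c * d - c * pderiv d) * (b * b)
      = b * d * ((a * pderiv d + d * pderiv a) - (c * pderiv b + b * pderiv c))
        - (pderiv b * d + b * pderiv d) * (a * d - c * b)"
    by (simp add: algebra_simps)
  also have "\<dots> = 0" by (simp only: eq eq' diff_self mult_zero_right)
  finally show ?thesis
    using assms d by (simp add: ratfun_deriv_def cd eq_fract)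
qed

lemma ratfun_deriv_add: "ratfun_deriv (r + s) = ratfun_deriv r + ratfun_deriv s"
  by (cases r, cases s)
    (simp add: ratfun_deriv_Fract eq_fract pderiv_add pderiv_mult algebra_simps)

lemma ratfun_deriv_mult: "ratfun_deriv (r * s) = ratfun_deriv r * s + r * ratfun_deriv s"
  by (cases r, cases s)
    (simp add: ratfun_deriv_Fract eq_fract pderiv_mult algebra_simps)

lemma ratfun_deriv_0 [simp]: "ratfun_deriv 0 = 0"
  by (simp add: Zero_fract_def ratfun_deriv_Fract eq_fract)

lemma ratfun_deriv_1 [simp]: "ratfun_deriv 1 = 0"
  by (simp add: One_fract_def ratfun_deriv_Fract Zero_fract_def eq_fract)

definition ratfun_poles :: "ratfun \<Rightarrow> complex set" where
  "ratfun_poles r = {x. poly (snd (quot_of_fract r)) x = 0}"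

text \<open>The quotient is in lowest terms, so this is the value of the rational function at
  every point outside \<^const>\<open>ratfun_poles\<close>.\<close>

definition ratfun_eval :: "ratfun \<Rightarrow> complex \<Rightarrow> complex" where
  "ratfun_eval r x = poly (fst (quot_of_fract r)) x / poly (snd (quot_of_fract r)) x"


section \<open>Differential operators with rational coefficients\<close>

text \<open>An operator \<open>\<Sum>j. c\<^sub>j(x) \<partial>\<^sup>j\<close> is represented by the polynomial with coefficients \<open>c\<^sub>j\<close>;
  this representation is used for the additive structure only. Multiplication of operators is
  composition, i.e.\ determined by \<open>\<partial> c = c \<partial> + c'\<close>.\<close>

typedef diffop = "UNIV :: ratfun poly set"
  morphisms coeffs_of_diffop Diffop ..

setup_lifting type_definition_diffop

text \<open>Composition with \<open>\<partial>\<close> on the left: \<open>\<partial> (\<Sum>j. c\<^sub>j \<partial>\<^sup>j) = \<Sum>j. c\<^sub>j' \<partial>\<^sup>j + \<Sum>j. c\<^sub>j \<partial>\<^sup>j\<^sup>+\<^sup>1\<close>.\<close>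

definition D_left :: "ratfun poly \<Rightarrow> ratfun poly" where
  "D_left B = map_poly ratfun_deriv B + pCons 0 B"

definition diffop_comp :: "ratfun poly \<Rightarrow> ratfun poly \<Rightarrow> ratfun poly" where
  "diffop_comp A B = (\<Sum>i\<le>degree A. Polynomial.smult (coeff A i) ((D_left ^^ i) B))"

lemma D_left_add: "D_left (A + B) = D_left A + D_left B"
  by (rule poly_eqI)
    (simp add: D_left_def coeff_map_poly ratfun_deriv_add coeff_pCons split: nat.splits)

lemma D_left_0 [simp]: "D_left 0 = 0"
  by (simp add: D_left_def)

lemma D_left_smult:
  "D_left (Polynomial.smult c B) =
     Polynomial.smult (ratfun_deriv c) B + Polynomial.smult c (D_left B)"
  by (rule poly_eqI)
    (simp add: D_left_def coeff_map_poly ratfun_deriv_mult algebra_simps coeff_pCons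
      split: nat.splits)

lemma D_left_sum: "D_left (sum f I) = (\<Sum>i\<in>I. D_left (f i))"
  by (induction I rule: infinite_finite_induct) (simp_all add: D_left_add)

lemma D_left_pow_add: "(D_left ^^ n) (A + B) = (D_left ^^ n) A + (D_left ^^ n) B"
  by (induction n) (simp_all add: D_left_add)

lemma D_left_pow_0 [simp]: "(D_left ^^ n) 0 = 0"
  by (induction n) simp_all

lemma D_left_pow_1: "(D_left ^^ n) 1 = Polynomial.monom 1 n"
proof (induction n)
  case (Suc n)
  have "map_poly ratfun_deriv (Polynomial.monom 1 n) = 0"
    by (rule poly_eqI) (simp add: coeff_map_poly)
  with Suc show ?case by (simp add: D_left_def monom_Suc)
qed (simp add: monom_0 one_pCons)

lemma diffop_comp_upto:
  assumes "degree A \<le> n"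
  shows "diffop_comp A B = (\<Sum>i\<le>n. Polynomial.smult (coeff A i) ((D_left ^^ i) B))"
  unfolding diffop_comp_def
  using assms by (intro sum.mono_neutral_left) (auto simp: coeff_eq_0)

lemma diffop_comp_add_left: "diffop_comp (A + B) C = diffop_comp A C + diffop_comp B C"
proof -
  define n where "n = max (degree A) (degree B)"
  have "degree A \<le> n" "degree B \<le> n" "degree (A + B) \<le> n"
    by (auto simp: n_def intro: degree_add_le_max)
  thus ?thesis
    by (simp add: diffop_comp_upto[of _ n] smult_add_left sum.distrib)
qed

lemma diffop_comp_add_right: "diffop_comp A (B + C) = diffop_comp A B + diffop_comp A C"
  by (simp add: diffop_comp_def D_left_pow_add smult_add_right sum.distrib)

lemma diffop_comp_0_left [simp]: "diffop_comp 0 A = 0"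
  by (simp add: diffop_comp_def)

lemma diffop_comp_0_right [simp]: "diffop_comp A 0 = 0"
  by (simp add: diffop_comp_def)

lemma diffop_comp_1_left [simp]: "diffop_comp 1 A = A"
  by (simp add: diffop_comp_def)

lemma diffop_comp_1_right [simp]: "diffop_comp A 1 = A"
  by (simp add: diffop_comp_def D_left_pow_1 smult_monom poly_as_sum_of_monoms)

lemma sum_smult_right: "(\<Sum>i\<in>I. Polynomial.smult c (f i)) = Polynomial.smult c (sum f I)"
  by (induction I rule: infinite_finite_induct) (simp_all add: smult_add_right)

lemma diffop_comp_smult_left:
  "diffop_comp (Polynomial.smult c A) B = Polynomial.smult c (diffop_comp A B)"
proof -
  have "degree (Polynomial.smult c A) \<le> degree A" by simp
  thus ?thesis
    by (simp add: diffop_comp_upto[of _ "degree A"] sum_smult_right flip: smult_smult)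
qed

lemma diffop_comp_sum_left: "diffop_comp (sum f I) B = (\<Sum>i\<in>I. diffop_comp (f i) B)"
  by (induction I rule: infinite_finite_induct) (simp_all add: diffop_comp_add_left)

lemma diffop_comp_D_left: "diffop_comp (D_left A) B = D_left (diffop_comp A B)"
proof -
  let ?n = "degree A"
  have 1: "diffop_comp (map_poly ratfun_deriv A) B
      = (\<Sum>i\<le>?n. Polynomial.smult (ratfun_deriv (coeff A i)) ((D_left ^^ i) B))"
    by (subst diffop_comp_upto[of _ ?n]) (simp_all add: map_poly_degree_leq coeff_map_poly)
  have "diffop_comp (pCons 0 A) B
      = (\<Sum>i\<le>Suc ?n. Polynomial.smult (coeff (pCons 0 A) i) ((D_left ^^ i) B))"
    by (rule diffop_comp_upto) (simp add: degree_pCons_le)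
  also have "\<dots> = (\<Sum>i\<le>?n. Polynomial.smult (coeff A i) (D_left ((D_left ^^ i) B)))"
    by (subst sum.atMost_Suc_shift) simp
  finally have 2: "diffop_comp (pCons 0 A) B = \<dots>" .
  show ?thesis
    unfolding D_left_def[of A] diffop_comp_add_left 1 2
    by (simp add: diffop_comp_def D_left_sum D_left_smult sum.distrib)
qed

lemma diffop_comp_D_left_pow:
  "diffop_comp ((D_left ^^ n) A) B = (D_left ^^ n) (diffop_comp A B)"
  by (induction n) (simp_all add: diffop_comp_D_left)

lemma diffop_comp_assoc: "diffop_comp (diffop_comp A B) C = diffop_comp A (diffop_comp B C)"
  by (simp add: diffop_comp_def[of A] diffop_comp_sum_left diffop_comp_smult_left
      diffop_comp_D_left_pow)

instantiation diffop :: ring_1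
begin

lift_definition zero_diffop :: diffop is 0 .
lift_definition one_diffop :: diffop is 1 .
lift_definition plus_diffop :: "diffop \<Rightarrow> diffop \<Rightarrow> diffop" is "(+)" .
lift_definition uminus_diffop :: "diffop \<Rightarrow> diffop" is uminus .
lift_definition minus_diffop :: "diffop \<Rightarrow> diffop \<Rightarrow> diffop" is "(-)" .
lift_definition times_diffop :: "diffop \<Rightarrow> diffop \<Rightarrow> diffop" is diffop_comp .

instance
  by standard (transfer; simp add: diffop_comp_assoc diffop_comp_add_left
      diffop_comp_add_right)+

end

definition diffop_coeff :: "diffop \<Rightarrow> nat \<Rightarrow> ratfun" where
  "diffop_coeff P = coeff (coeffs_of_diffop P)"

definition diffop_order :: "diffop \<Rightarrow> nat" where
  "diffop_order P = degree (coeffs_of_diffop P)"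

definition mult_op :: "ratfun \<Rightarrow> diffop" where
  "mult_op c = Diffop [:c:]"

definition D_op :: diffop where
  "D_op = Diffop [:0, 1:]"

lemma coeffs_of_mult_op: "coeffs_of_diffop (mult_op c) = [:c:]"
  by (simp add: mult_op_def Diffop_inverse)

lemma coeffs_of_D_op: "coeffs_of_diffop D_op = [:0, 1:]"
  by (simp add: D_op_def Diffop_inverse)

lemma D_op_mult_op: "D_op * mult_op c = mult_op c * D_op + mult_op (ratfun_deriv c)"
  by (subst coeffs_of_diffop_inject[symmetric])
    (simp add: times_diffop.rep_eq plus_diffop.rep_eq coeffs_of_mult_op coeffs_of_D_op
      diffop_comp_def D_left_def map_poly_pCons)

lemma diffop_eq_sum:
  "P = (\<Sum>j\<le>diffop_order P. mult_op (diffop_coeff P j) * D_op ^ j)"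
proof -
  have D: "coeffs_of_diffop (D_op ^ j) = Polynomial.monom 1 j" for j
  proof (induction j)
    case (Suc j)
    have "map_poly ratfun_deriv (Polynomial.monom 1 j) = 0"
      by (rule poly_eqI) (simp add: coeff_map_poly)
    with Suc show ?case
      by (simp add: times_diffop.rep_eq coeffs_of_D_op diffop_comp_def D_left_def monom_Suc)
  qed (simp add: one_diffop.rep_eq monom_0 one_pCons)
  have S: "coeffs_of_diffop (sum f I) = (\<Sum>i\<in>I. coeffs_of_diffop (f i))" for f and I :: "nat set"
    by (induction I rule: infinite_finite_induct)
      (simp_all add: zero_diffop.rep_eq plus_diffop.rep_eq)
  show ?thesis
    by (subst coeffs_of_diffop_inject[symmetric])
      (simp add: S D times_diffop.rep_eq coeffs_of_mult_op diffop_comp_def smult_monom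
        diffop_order_def diffop_coeff_def poly_as_sum_of_monoms)
qed

definition formal_adjoint :: "diffop \<Rightarrow> diffop" where
  "formal_adjoint P =
     (\<Sum>j\<le>diffop_order P. (-1) ^ j * D_op ^ j * mult_op (diffop_coeff P j))"

definition poly_at_diffop :: "complex poly \<Rightarrow> diffop \<Rightarrow> diffop" where
  "poly_at_diffop q A = (\<Sum>i\<le>degree q. mult_op (to_fract [:coeff q i:]) * A ^ i)"

definition diffop_poles :: "diffop \<Rightarrow> complex set" where
  "diffop_poles P = (\<Union>j. ratfun_poles (diffop_coeff P j))"

definition diffop_apply :: "diffop \<Rightarrow> (complex \<Rightarrow> complex) \<Rightarrow> complex \<Rightarrow> complex" where
  "diffop_apply P f x =
     (\<Sum>j\<le>diffop_order P. ratfun_eval (diffop_coeff P j) x * (deriv ^^ j) f x)"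

text \<open>Entire solutions. This is the full space of analytic solutions when, as for \<open>q(L)\<^sup>2\<close>, the
  coefficients are polynomials and the leading one is constant.\<close>

definition diffop_ker :: "diffop \<Rightarrow> (complex \<Rightarrow> complex) set" where
  "diffop_ker P = {y. y holomorphic_on UNIV \<and> (\<forall>x. x \<notin> diffop_poles P \<longrightarrow> diffop_apply P y x = 0)}"

definition Airy_op :: diffop where
  "Airy_op = D_op ^ 2 - mult_op (to_fract [:0, 1:])"

definition self_adjoint_factorization :: "diffop \<Rightarrow> diffop \<Rightarrow> ratfun \<Rightarrow> bool" where
  "self_adjoint_factorization Q P p \<longleftrightarrow>
     p \<noteq> 0 \<and> formal_adjoint P * mult_op (1 / p ^ 2) * P = Q"


section \<open>Wronskians\<close>

definition wronskian :: "(complex \<Rightarrow> complex) list \<Rightarrow> complex \<Rightarrow> complex" where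
  "wronskian hs x =
     Determinant.det (mat (length hs) (length hs) (\<lambda>(i, j). (deriv ^^ i) (hs ! j) x))"

text \<open>\<open>P\<close> is the operator \<open>f \<mapsto> W(h\<^sub>1, \<dots>, h\<^sub>n, f)\<close>. Since \<open>f\<close> ranges over all germs of analytic
  functions, at most one \<open>P\<close> with rational coefficients has this property.\<close>

definition is_wronskian_op :: "(complex \<Rightarrow> complex) list \<Rightarrow> diffop \<Rightarrow> bool" where
  "is_wronskian_op hs P \<longleftrightarrow>
     (\<forall>x f. x \<notin> diffop_poles P \<longrightarrow> f analytic_on {x} \<longrightarrow>
        diffop_apply P f x = wronskian (hs @ [f]) x)"

definition lin_indep_funs :: "(complex \<Rightarrow> complex) list \<Rightarrow> bool" where
  "lin_indep_funs hs \<longleftrightarrow>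
     (\<forall>c. (\<forall>x. (\<Sum>i<length hs. c i * (hs ! i) x) = 0) \<longrightarrow> (\<forall>i<length hs. c i = 0))"


section \<open>Airy functions\<close>

text \<open>The Maclaurin series of the two solutions of \<open>y'' = x y\<close> with \<open>(y(0), y'(0))\<close> equal to
  \<open>(1, 0)\<close> and \<open>(0, 1)\<close>. The constants below are \<open>Ai(0)\<close>, \<open>-Ai'(0)\<close>, and
  \<open>Bi(0) = \<surd>3 Ai(0)\<close>, \<open>Bi'(0) = -\<surd>3 Ai'(0)\<close>.\<close>

definition airy_series0 :: "complex \<Rightarrow> complex" where
  "airy_series0 z = (\<Sum>k. 3 ^ k * pochhammer (1 / 3) k * z ^ (3 * k) / fact (3 * k))"

definition airy_series1 :: "complex \<Rightarrow> complex" where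
  "airy_series1 z = (\<Sum>k. 3 ^ k * pochhammer (2 / 3) k * z ^ (3 * k + 1) / fact (3 * k + 1))"

definition Ai :: "complex \<Rightarrow> complex" where
  "Ai z = of_real (1 / (3 powr (2 / 3) * Gamma (2 / 3))) * airy_series0 z
        - of_real (1 / (3 powr (1 / 3) * Gamma (1 / 3))) * airy_series1 z"

definition Bi :: "complex \<Rightarrow> complex" where
  "Bi z = of_real (sqrt 3 / (3 powr (2 / 3) * Gamma (2 / 3))) * airy_series0 z
        + of_real (sqrt 3 / (3 powr (1 / 3) * Gamma (1 / 3))) * airy_series1 z"


section \<open>Generalized Airy eigenfunctions\<close>

text \<open>The polynomial division by \<open>(z - a\<^sub>k)\<close> to the power \<open>2 d\<^sub>k\<close> is exact when \<open>q\<close> has a root of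
  order \<open>d\<^sub>k\<close> at \<open>a\<^sub>k\<close>; \<open>m + n + 1 - 2 d\<^sub>k\<close> is written so that the subtraction of naturals does
  not truncate.\<close>

definition bilinear_form ::
  "complex poly \<Rightarrow> complex \<Rightarrow> nat \<Rightarrow> (nat \<Rightarrow> complex) \<Rightarrow> (nat \<Rightarrow> complex) \<Rightarrow> complex" where
  "bilinear_form q ak dk u v =
     (\<Sum>(m, n) \<in> {(m, n). m \<le> 2 * dk - 1 \<and> n \<le> 2 * dk - 1 \<and> m + n \<ge> 2 * dk - 1}.
        u m * v n * (fact m * fact n / fact (m + n + 1 - 2 * dk))
        * poly ((pderiv ^^ (m + n + 1 - 2 * dk)) (q ^ 2 div [:- ak, 1:] ^ (2 * dk))) ak)"

definition fun_list :: "nat \<Rightarrow> (nat \<Rightarrow> complex \<Rightarrow> complex) \<Rightarrow> (nat \<Rightarrow> complex \<Rightarrow> complex)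
    \<Rightarrow> (complex \<Rightarrow> complex) list" where
  "fun_list d f g = map f [1..<d + 1] @ map g [1..<d + 1]"

definition airy_data ::
  "nat \<Rightarrow> (nat \<Rightarrow> complex) \<Rightarrow> (nat \<Rightarrow> nat) \<Rightarrow> nat \<Rightarrow> complex poly
    \<Rightarrow> (nat \<Rightarrow> nat) \<Rightarrow> (nat \<Rightarrow> nat \<Rightarrow> complex)
    \<Rightarrow> (nat \<Rightarrow> complex \<Rightarrow> complex) \<Rightarrow> (nat \<Rightarrow> complex \<Rightarrow> complex) \<Rightarrow> bool" where
  "airy_data r a ds d q l \<alpha> f g \<longleftrightarrow>
     (\<forall>i\<in>{1..d}. l i \<in> {1..r}) \<and>
     (\<forall>i\<in>{1..d}. f i \<in> diffop_ker (poly_at_diffop q Airy_op ^ 2) \<and>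
                 g i \<in> diffop_ker (poly_at_diffop q Airy_op ^ 2)) \<and>
     lin_indep_funs (fun_list d f g) \<and>
     (\<forall>i\<in>{1..d}. \<forall>x.
        f i x = (\<Sum>m = 0..2 * ds (l i) - 1. \<alpha> i m * (deriv ^^ m) Ai (x + a (l i))) \<and>
        g i x = (\<Sum>n = 0..2 * ds (l i) - 1. \<alpha> i n * (deriv ^^ n) Bi (x + a (l i)))) \<and>
     (\<forall>k\<in>{1..r}. \<forall>i\<in>{1..d}. \<forall>j\<in>{1..d}. l i = k \<and> l j = k \<longrightarrow>
        bilinear_form q (a k) (ds k) (\<alpha> i) (\<alpha> j) = 0)"

end

theory Submission
  imports Defs
begin

text \<open>
  Expanding at \<open>0\<close> turns everything into algebra in the differential field of Laurent series, where
  an operator of order \<open>n\<close> has at most \<open>n\<close> solutions independent over \<open>\<complex>\<close>.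

  For self-adjoint \<open>Q\<close> the bilinear concomitant \<open>C\<^sub>Q\<close> satisfies
  \<open>C\<^sub>A\<^sub>B(f, g) = C\<^sub>A(B f, g) + C\<^sub>B(f, A\<^sup>* g)\<close>. Hence the kernel of \<open>P\<close> is isotropic for \<open>C\<^sub>Q\<close> whenever
  \<open>Q = P\<^sup>* p\<^sup>-\<^sup>2 P\<close>; and conversely an isotropic space of half the order of \<open>Q\<close> yields such a
  factorization. On the kernel of \<open>Q = q(L)\<^sup>2\<close> different eigenvalues are orthogonal, and
  \<open>C\<^sub>Q(\<partial>\<^sup>m Y, \<partial>\<^sup>n Z)\<close> is the coefficient in the bilinear form of the theorem times the constant
  Wronskian of the solutions \<open>Y\<close> and \<open>Z\<close> of the shifted Airy equation. So the condition on the
  coefficients is exactly isotropy. The Wronskian operator has polynomial coefficients because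
  the matrix of derivatives is a polynomial matrix times a matrix of constant determinant.

  In the converse direction, the functions \<open>Ai(x + a\<^sub>k)\<close>, \<open>Bi(x + a\<^sub>k)\<close> and their first derivatives
  are linearly independent over \<open>\<complex>(x)\<close>. An operator with rational coefficients therefore kills a
  combination of Airy functions only if it kills each summand formally, so its kernel splits
  along the eigenvalues and treats \<open>Ai\<close> and \<open>Bi\<close> alike.
\<close>

section \<open>Rational functions as Laurent series\<close>

text \<open>Laurent series are needed, not just power series: coefficients in C(x) may have a pole
  at 0, and the independence argument divides by coefficients. Nothing is lost for entire functions,
  which are determined by their expansion at 0. The factorials of the bilinear form come from one
  fact: if L Y = a Y, then L - a sends the m-th derivative of Y to m times the (m-1)-st, just as
  d/dz acts on z^m. The derivatives of the cofactor q(z)^2 / (z - a)^(2 d_k) enter by Taylor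
  expansion at a. The function p is forced up to sign: q(L)^2 is monic and P has even order 2d, so
  p^2 is the square of the leading coefficient of P. For the Wronskian operator that coefficient is
  the Wronskian of the 2d functions. Since the Wronskian of Ai with itself vanishes, the condition
  on the coefficients is tested only by pairs of one Ai and one Bi combination. The obstacle in the
  converse is to find enough kernel. The order of an operator only bounds its solutions from above,
  and P may be singular at 0; so the dimension is obtained by counting inside the known kernel of
  q(L)^2.\<close>

definition poly_fls :: "complex poly \<Rightarrow> complex fls" where
  "poly_fls p = fps_to_fls (fps_of_poly p)"

lemma poly_fls_add: "poly_fls (p + q) = poly_fls p + poly_fls q"
  by (simp add: poly_fls_def fps_of_poly_add)

lemma poly_fls_diff: "poly_fls (p - q) = poly_fls p - poly_fls q"
  by (simp add: poly_fls_def fps_of_poly_diff)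

lemma poly_fls_mult: "poly_fls (p * q) = poly_fls p * poly_fls q"
  by (simp add: poly_fls_def fps_of_poly_mult fls_times_fps_to_fls)

lemma poly_fls_0 [simp]: "poly_fls 0 = 0"
  by (simp add: poly_fls_def)

lemma poly_fls_1 [simp]: "poly_fls 1 = 1"
  by (simp add: poly_fls_def)

lemma poly_fls_eq_iff [simp]: "poly_fls p = poly_fls q \<longleftrightarrow> p = q"
  by (simp add: poly_fls_def fps_of_poly_eq_iff)

lemma poly_fls_eq_0_iff [simp]: "poly_fls p = 0 \<longleftrightarrow> p = 0"
  using poly_fls_eq_iff[of p 0] by (simp del: poly_fls_eq_iff)

lemma poly_fls_pderiv: "poly_fls (pderiv p) = fls_deriv (poly_fls p)"
  by (simp add: poly_fls_def fps_of_poly_pderiv fls_deriv_fps_to_fls)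

lemma poly_fls_const: "poly_fls [:c:] = fls_const c"
  by (simp add: poly_fls_def fps_of_poly_const)

text \<open>Expansion at 0, with a pole at 0 becoming a principal part. The lemmas below show that
  it is an embedding of differential fields, so identities between rational functions can be checked
  on series.\<close>

definition ratfun_fls :: "ratfun \<Rightarrow> complex fls" where
  "ratfun_fls r = poly_fls (fst (quot_of_fract r)) / poly_fls (snd (quot_of_fract r))"

lemma ratfun_fls_Fract:
  assumes "b \<noteq> 0"
  shows "ratfun_fls (Fract a b) = poly_fls a / poly_fls b"
proof -
  obtain c d where cd: "quot_of_fract (Fract a b) = (c, d)" by fastforce
  have d: "d \<noteq> 0" using snd_quot_of_fract_nonzero[of "Fract a b"] cd by simp
  have "Fract c d = Fract a b" using Fract_quot_of_fract[of "Fract a b"] cd by simp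
  hence "c * b = a * d" using assms d by (simp add: eq_fract)
  hence "poly_fls c * poly_fls b = poly_fls a * poly_fls d" by (metis poly_fls_mult)
  thus ?thesis using assms d by (simp add: ratfun_fls_def cd frac_eq_eq)
qed

lemma ratfun_fls_to_fract [simp]: "ratfun_fls (to_fract p) = poly_fls p"
  by (simp add: ratfun_fls_def)

lemma ratfun_fls_0 [simp]: "ratfun_fls 0 = 0"
  using ratfun_fls_to_fract[of 0] by (simp del: ratfun_fls_to_fract)

lemma ratfun_fls_1 [simp]: "ratfun_fls 1 = 1"
  using ratfun_fls_to_fract[of 1] by (simp del: ratfun_fls_to_fract)

lemma ratfun_fls_add: "ratfun_fls (r + s) = ratfun_fls r + ratfun_fls s"
  by (cases r, cases s)
    (simp add: ratfun_fls_Fract poly_fls_add poly_fls_mult add_frac_eq)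

lemma ratfun_fls_mult: "ratfun_fls (r * s) = ratfun_fls r * ratfun_fls s"
  by (cases r, cases s) (simp add: ratfun_fls_Fract poly_fls_mult)

lemma ratfun_fls_eq_0_iff [simp]: "ratfun_fls r = 0 \<longleftrightarrow> r = 0"
  by (simp add: ratfun_fls_def)

lemma ratfun_fls_uminus: "ratfun_fls (- r) = - ratfun_fls r"
  using ratfun_fls_add[of r "- r"] by (simp add: eq_neg_iff_add_eq_0 add.commute)

lemma ratfun_fls_diff: "ratfun_fls (r - s) = ratfun_fls r - ratfun_fls s"
  using ratfun_fls_add[of r "- s"] by (simp add: ratfun_fls_uminus)

lemma ratfun_fls_eq_iff [simp]: "ratfun_fls r = ratfun_fls s \<longleftrightarrow> r = s"
  using ratfun_fls_eq_0_iff[of "r - s"] by (simp add: ratfun_fls_diff del: ratfun_fls_eq_0_iff)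

lemma ratfun_fls_deriv: "ratfun_fls (ratfun_deriv r) = fls_deriv (ratfun_fls r)"
proof (cases r)
  case (Fract a b)
  let ?a = "poly_fls a" and ?b = "poly_fls b"
  have b: "?b \<noteq> 0" using Fract by simp
  define u where "u = ?a / ?b"
  have "u * ?b = ?a" using b by (simp add: u_def)
  hence "fls_deriv (u * ?b) = fls_deriv ?a" by simp
  hence "u * fls_deriv ?b + fls_deriv u * ?b = fls_deriv ?a" by simp
  hence "fls_deriv u = (fls_deriv ?a - u * fls_deriv ?b) / ?b"
    using b by (simp add: eq_divide_eq) (metis add_diff_cancel_left')
  also have "\<dots> = (fls_deriv ?a * ?b - ?a * fls_deriv ?b) / (?b * ?b)"
    using b by (simp add: u_def field_simps)
  finally show ?thesis
    using Fract by (simp add: ratfun_deriv_Fract ratfun_fls_Fract u_def poly_fls_diff poly_fls_mult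
        poly_fls_pderiv)
qed

text \<open>Series with zero derivative are constants, and the embedding into Laurent series is
  injective.\<close>

lemma ratfun_deriv_eq_0_iff: "ratfun_deriv r = 0 \<longleftrightarrow> (\<exists>c. r = to_fract [:c:])"
proof
  assume "ratfun_deriv r = 0"
  hence "fls_deriv (ratfun_fls r) = 0" by (simp flip: ratfun_fls_deriv)
  then obtain c where "ratfun_fls r = fls_const c" by (auto simp: fls_deriv_eq_0_iff)
  hence "ratfun_fls r = ratfun_fls (to_fract [:c:])" by (simp add: poly_fls_const)
  thus "\<exists>c. r = to_fract [:c:]" by (auto simp only: ratfun_fls_eq_iff)
next
  assume "\<exists>c. r = to_fract [:c:]"
  then obtain c where "r = to_fract [:c:]" by blast
  hence "ratfun_fls (ratfun_deriv r) = 0" by (simp add: ratfun_fls_deriv poly_fls_const)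
  thus "ratfun_deriv r = 0" by simp
qed


section \<open>The action of differential operators on Laurent series\<close>

definition raw_act :: "ratfun poly \<Rightarrow> complex fls \<Rightarrow> complex fls" where
  "raw_act A f = (\<Sum>j\<le>degree A. ratfun_fls (coeff A j) * (fls_deriv ^^ j) f)"

lemma raw_act_upto:
  "degree A \<le> n \<Longrightarrow> raw_act A f = (\<Sum>j\<le>n. ratfun_fls (coeff A j) * (fls_deriv ^^ j) f)"
  unfolding raw_act_def by (intro sum.mono_neutral_left) (auto simp: coeff_eq_0)

lemma raw_act_add: "raw_act (A + B) f = raw_act A f + raw_act B f"
proof -
  define n where "n = max (degree A) (degree B)"
  have "degree A \<le> n" "degree B \<le> n" "degree (A + B) \<le> n"
    by (auto simp: n_def intro: degree_add_le_max)
  thus ?thesis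
    by (simp add: raw_act_upto[of _ n] ratfun_fls_add ring_distribs sum.distrib)
qed

lemma raw_act_0 [simp]: "raw_act 0 f = 0"
  by (simp add: raw_act_def)

lemma raw_act_sum: "raw_act (sum A I) f = (\<Sum>i\<in>I. raw_act (A i) f)"
  by (induction I rule: infinite_finite_induct) (simp_all add: raw_act_add)

lemma raw_act_smult: "raw_act (Polynomial.smult c A) f = ratfun_fls c * raw_act A f"
  by (subst raw_act_upto[of _ "degree A"])
    (simp_all add: raw_act_def ratfun_fls_mult sum_distrib_left mult.assoc)

lemma fls_deriv_pow_add: "(fls_deriv ^^ n) (f + g) = (fls_deriv ^^ n) f + (fls_deriv ^^ n) g"
  by (induction n) simp_all

lemma fls_deriv_pow_0 [simp]: "(fls_deriv ^^ n) 0 = 0"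
  by (induction n) simp_all

lemma fls_deriv_pow_const:
  "(fls_deriv ^^ n) (fls_const c * f) = fls_const c * (fls_deriv ^^ n) (f :: complex fls)"
  by (induction n) simp_all

lemma raw_act_D_left: "raw_act (D_left A) f = fls_deriv (raw_act A f)"
proof -
  let ?n = "degree A"
  have 1: "raw_act (map_poly ratfun_deriv A) f
      = (\<Sum>i\<le>?n. fls_deriv (ratfun_fls (coeff A i)) * (fls_deriv ^^ i) f)"
    by (subst raw_act_upto[of _ ?n])
      (simp_all add: map_poly_degree_leq coeff_map_poly ratfun_fls_deriv)
  have "raw_act (pCons 0 A) f
      = (\<Sum>i\<le>Suc ?n. ratfun_fls (coeff (pCons 0 A) i) * (fls_deriv ^^ i) f)"
    by (rule raw_act_upto) (simp add: degree_pCons_le)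
  also have "\<dots> = (\<Sum>i\<le>?n. ratfun_fls (coeff A i) * fls_deriv ((fls_deriv ^^ i) f))"
    by (subst sum.atMost_Suc_shift) simp
  finally have 2: "raw_act (pCons 0 A) f = \<dots>" .
  show ?thesis
    unfolding D_left_def[of A] raw_act_add 1 2
    by (simp add: raw_act_def fls_deriv_sum sum.distrib add.commute)
qed

lemma raw_act_D_left_pow: "raw_act ((D_left ^^ n) A) f = (fls_deriv ^^ n) (raw_act A f)"
  by (induction n) (simp_all add: raw_act_D_left)

lemma raw_act_comp: "raw_act (diffop_comp A B) f = raw_act A (raw_act B f)"
  by (simp add: diffop_comp_def raw_act_sum raw_act_smult raw_act_D_left_pow raw_act_def[of A])

definition op_act :: "diffop \<Rightarrow> complex fls \<Rightarrow> complex fls" where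
  "op_act P = raw_act (coeffs_of_diffop P)"

lemma op_act_eq:
  "op_act P f = (\<Sum>j\<le>diffop_order P. ratfun_fls (diffop_coeff P j) * (fls_deriv ^^ j) f)"
  by (simp add: op_act_def raw_act_def diffop_order_def diffop_coeff_def)

lemma op_act_mult [simp]: "op_act (P * Q) f = op_act P (op_act Q f)"
  by (simp add: op_act_def times_diffop.rep_eq raw_act_comp)

lemma op_act_add [simp]: "op_act (P + Q) f = op_act P f + op_act Q f"
  by (simp add: op_act_def plus_diffop.rep_eq raw_act_add)

lemma op_act_op_0 [simp]: "op_act 0 f = 0"
  by (simp add: op_act_def zero_diffop.rep_eq)

lemma op_act_uminus [simp]: "op_act (- P) f = - op_act P f"
  using op_act_add[of P "- P" f] by (simp add: eq_neg_iff_add_eq_0 add.commute)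

lemma op_act_diff [simp]: "op_act (P - Q) f = op_act P f - op_act Q f"
  using op_act_add[of P "- Q" f] by simp

lemma op_act_op_1 [simp]: "op_act 1 f = f"
  by (simp add: op_act_def one_diffop.rep_eq raw_act_def)

lemma op_act_mult_op [simp]: "op_act (mult_op c) f = ratfun_fls c * f"
  by (simp add: op_act_def coeffs_of_mult_op raw_act_def)

lemma op_act_D_op [simp]: "op_act D_op f = fls_deriv f"
  by (simp add: op_act_def coeffs_of_D_op raw_act_def)

lemma op_act_D_op_pow [simp]: "op_act (D_op ^ n) f = (fls_deriv ^^ n) f"
  by (induction n) simp_all

lemma op_act_plus: "op_act P (f + g) = op_act P f + op_act P g"
  by (simp add: op_act_eq fls_deriv_pow_add ring_distribs sum.distrib)

lemma op_act_0 [simp]: "op_act P 0 = 0"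
  by (simp add: op_act_eq)

lemma op_act_fsum: "op_act P (sum f I) = (\<Sum>i\<in>I. op_act P (f i))"
  by (induction I rule: infinite_finite_induct) (simp_all add: op_act_plus)

lemma op_act_const: "op_act P (fls_const c * f) = fls_const c * op_act P f"
  by (simp only: op_act_eq fls_deriv_pow_const sum_distrib_left mult.left_commute)


section \<open>Order and leading coefficient\<close>

definition op_lead :: "diffop \<Rightarrow> ratfun" where
  "op_lead P = diffop_coeff P (diffop_order P)"

lemma coeff_D_left:
  "coeff (D_left B) n = ratfun_deriv (coeff B n) + (case n of 0 \<Rightarrow> 0 | Suc m \<Rightarrow> coeff B m)"
  by (simp add: D_left_def coeff_map_poly coeff_pCons)

text \<open>Differentiating coefficients only affects terms that are not leading, so each
  composition with D raises the order by one and keeps the leading coefficient.\<close>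

lemma coeff_D_left_pow:
  "(\<forall>m>degree B + n. coeff ((D_left ^^ n) B) m = 0) \<and>
   coeff ((D_left ^^ n) B) (degree B + n) = lead_coeff B"
proof (induction n)
  case (Suc n)
  have "coeff ((D_left ^^ Suc n) B) m = 0" if "m > degree B + Suc n" for m
    using that Suc by (cases m) (auto simp: coeff_D_left)
  thus ?case using Suc by (auto simp: coeff_D_left)
qed (auto simp: coeff_eq_0)

lemma coeff_diffop_comp_high:
  assumes "m > degree A + degree B"
  shows "coeff (diffop_comp A B) m = 0"
proof -
  have "coeff ((D_left ^^ i) B) m = 0" if "i \<le> degree A" for i
    using that assms coeff_D_left_pow[of B i] by auto
  thus ?thesis by (simp add: diffop_comp_def coeff_sum)
qed

lemma coeff_diffop_comp_lead:
  "coeff (diffop_comp A B) (degree A + degree B) = lead_coeff A * lead_coeff B"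
proof -
  let ?n = "degree A + degree B"
  have z: "coeff A i * coeff ((D_left ^^ i) B) ?n = 0" if "i \<in> {..degree A} - {degree A}" for i
    using that coeff_D_left_pow[of B i] by auto
  have "coeff (diffop_comp A B) ?n = (\<Sum>i\<le>degree A. coeff A i * coeff ((D_left ^^ i) B) ?n)"
    by (simp add: diffop_comp_def coeff_sum)
  also have "\<dots> = (\<Sum>i\<in>{degree A}. coeff A i * coeff ((D_left ^^ i) B) ?n)"
    using z by (intro sum.mono_neutral_right) auto
  also have "\<dots> = lead_coeff A * lead_coeff B"
    using coeff_D_left_pow[of B "degree A"] by (simp add: add.commute)
  finally show ?thesis .
qed

lemma degree_diffop_comp:
  assumes "A \<noteq> 0" "B \<noteq> 0"
  shows "degree (diffop_comp A B) = degree A + degree B"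
proof (rule antisym)
  show "degree (diffop_comp A B) \<le> degree A + degree B"
    using coeff_diffop_comp_high by (intro degree_le) auto
  show "degree A + degree B \<le> degree (diffop_comp A B)"
    using assms by (intro le_degree) (simp add: coeff_diffop_comp_lead)
qed

lemma coeffs_of_diffop_eq_0_iff [simp]: "coeffs_of_diffop P = 0 \<longleftrightarrow> P = 0"
  by (metis coeffs_of_diffop_inject zero_diffop.rep_eq)

lemma op_lead_eq_0_iff [simp]: "op_lead P = 0 \<longleftrightarrow> P = 0"
  by (simp add: op_lead_def diffop_coeff_def diffop_order_def)

lemma order_mult: "P \<noteq> 0 \<Longrightarrow> Q \<noteq> 0 \<Longrightarrow> diffop_order (P * Q) = diffop_order P + diffop_order Q"
  by (simp add: diffop_order_def times_diffop.rep_eq degree_diffop_comp)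

lemma op_lead_mult: "op_lead (P * Q) = op_lead P * op_lead Q"
proof (cases "P = 0 \<or> Q = 0")
  case True
  thus ?thesis by (auto simp: op_lead_def diffop_coeff_def zero_diffop.rep_eq)
next
  case False
  hence "diffop_order (P * Q) = diffop_order P + diffop_order Q" by (simp add: order_mult)
  thus ?thesis
    by (simp add: op_lead_def diffop_coeff_def diffop_order_def times_diffop.rep_eq
        coeff_diffop_comp_lead)
qed

text \<open>Leading coefficients multiply as in a commutative polynomial ring over a field, despite
  the lower-order commutator terms.\<close>

instance diffop :: ring_1_no_zero_divisors
proof
  fix a b :: diffop
  assume "a \<noteq> 0" "b \<noteq> 0"
  hence "op_lead (a * b) \<noteq> 0" unfolding op_lead_mult by simp
  thus "a * b \<noteq> 0" by simp
qed

lemma order_mult_op [simp]: "diffop_order (mult_op c) = 0"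
  by (simp add: diffop_order_def coeffs_of_mult_op)

lemma op_lead_mult_op [simp]: "op_lead (mult_op c) = c"
  by (simp add: op_lead_def diffop_coeff_def coeffs_of_mult_op)

lemma mult_op_eq_0_iff [simp]: "mult_op c = 0 \<longleftrightarrow> c = 0"
  by (simp flip: coeffs_of_diffop_eq_0_iff add: coeffs_of_mult_op)

lemma mult_op_mult: "mult_op (c * e) = mult_op c * mult_op e"
  by (subst coeffs_of_diffop_inject[symmetric])
    (simp add: times_diffop.rep_eq coeffs_of_mult_op diffop_comp_def)

lemma mult_op_add: "mult_op (c + e) = mult_op c + mult_op e"
  by (subst coeffs_of_diffop_inject[symmetric]) (simp add: plus_diffop.rep_eq coeffs_of_mult_op)

lemma mult_op_1 [simp]: "mult_op 1 = 1"
  by (subst coeffs_of_diffop_inject[symmetric]) (simp add: one_diffop.rep_eq coeffs_of_mult_op one_pCons)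

lemma mult_op_0 [simp]: "mult_op 0 = 0"
  by simp

lemma coeffs_of_D_op_pow: "coeffs_of_diffop (D_op ^ n) = Polynomial.monom 1 n"
proof (induction n)
  case (Suc n)
  have "map_poly ratfun_deriv (Polynomial.monom 1 n) = 0"
    by (rule poly_eqI) (simp add: coeff_map_poly)
  with Suc show ?case
    by (simp add: times_diffop.rep_eq coeffs_of_D_op diffop_comp_def D_left_def monom_Suc)
qed (simp add: one_diffop.rep_eq monom_0 one_pCons)

lemma order_D_op_pow [simp]: "diffop_order (D_op ^ n) = n"
  by (simp add: diffop_order_def coeffs_of_D_op_pow degree_monom_eq)

lemma op_lead_D_op_pow [simp]: "op_lead (D_op ^ n) = 1"
  by (simp add: op_lead_def diffop_coeff_def coeffs_of_D_op_pow)

lemma D_op_nonzero [simp]: "D_op \<noteq> 0"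
  using op_lead_D_op_pow[of 1] op_lead_eq_0_iff[of D_op] by auto

lemma order_less_by_lead:
  assumes "P \<noteq> Q" "diffop_order P \<le> n" "diffop_order Q \<le> n"
    "diffop_coeff P n = diffop_coeff Q n"
  shows "diffop_order (P - Q) < n \<or> P = Q"
proof -
  have "degree (coeffs_of_diffop P - coeffs_of_diffop Q) \<le> n"
    using assms unfolding diffop_order_def by (intro degree_diff_le)
  moreover have "coeff (coeffs_of_diffop P - coeffs_of_diffop Q) n = 0"
    using assms by (simp add: diffop_coeff_def)
  moreover have "coeffs_of_diffop P - coeffs_of_diffop Q \<noteq> 0"
    using assms by (simp add: coeffs_of_diffop_inject)
  ultimately have "degree (coeffs_of_diffop P - coeffs_of_diffop Q) < n"
    by (metis eq_zero_or_degree_less)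
  thus ?thesis by (simp add: diffop_order_def minus_diffop.rep_eq)
qed

text \<open>Euclidean division works because the leading coefficient of \<open>P\<close> is
  invertible in C(x).\<close>

lemma right_division:
  assumes "P \<noteq> 0"
  shows "\<exists>R S. Q = R * P + S \<and> (S = 0 \<or> diffop_order S < diffop_order P)"
proof (induction "diffop_order Q" arbitrary: Q rule: less_induct)
  case less
  show ?case
  proof (cases "Q = 0 \<or> diffop_order Q < diffop_order P")
    case True
    thus ?thesis by (metis add_0 mult_zero_left)
  next
    case False
    define T where "T = mult_op (op_lead Q / op_lead P) * D_op ^ (diffop_order Q - diffop_order P)"
    have nz: "T \<noteq> 0" using False assms by (simp add: T_def)
    have oT: "diffop_order T = diffop_order Q - diffop_order P"
      using nz by (simp add: T_def order_mult)
    have lT: "op_lead T = op_lead Q / op_lead P"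
      by (simp add: T_def op_lead_mult)
    have o: "diffop_order (T * P) = diffop_order Q"
      using nz assms oT False by (simp add: order_mult)
    have "op_lead (T * P) = op_lead Q"
      unfolding op_lead_mult lT using assms by simp
    hence "diffop_coeff Q (diffop_order Q) = diffop_coeff (T * P) (diffop_order Q)"
      by (simp add: op_lead_def o)
    hence "diffop_order (Q - T * P) < diffop_order Q \<or> Q = T * P"
      using order_less_by_lead[of Q "T * P" "diffop_order Q"] o by auto
    thus ?thesis
    proof
      assume "diffop_order (Q - T * P) < diffop_order Q"
      then obtain R S where "Q - T * P = R * P + S" "S = 0 \<or> diffop_order S < diffop_order P"
        using less by blast
      hence "Q = (R + T) * P + S" "S = 0 \<or> diffop_order S < diffop_order P"
        by (simp_all add: algebra_simps)
      thus ?thesis by blast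
    next
      assume "Q = T * P"
      thus ?thesis by (metis add.right_neutral)
    qed
  qed
qed

section \<open>Formal adjoints and bilinear concomitants\<close>

lemma diffop_coeff_add: "diffop_coeff (P + Q) n = diffop_coeff P n + diffop_coeff Q n"
  by (simp add: diffop_coeff_def plus_diffop.rep_eq)

lemma diffop_coeff_0 [simp]: "diffop_coeff 0 n = 0"
  by (simp add: diffop_coeff_def zero_diffop.rep_eq)

lemma diffop_coeff_sum: "diffop_coeff (sum P I) n = (\<Sum>i\<in>I. diffop_coeff (P i) n)"
  by (induction I rule: infinite_finite_induct) (simp_all add: diffop_coeff_add)

lemma diffop_coeff_high: "diffop_order P < n \<Longrightarrow> diffop_coeff P n = 0"
  by (simp add: diffop_coeff_def diffop_order_def coeff_eq_0)

lemma diffop_coeff_monom: "diffop_coeff (mult_op c * D_op ^ j) n = (if n = j then c else 0)"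
  by (simp add: diffop_coeff_def times_diffop.rep_eq coeffs_of_mult_op diffop_comp_def
      coeffs_of_D_op_pow)

lemma diffop_order_le: "(\<And>m. n < m \<Longrightarrow> diffop_coeff P m = 0) \<Longrightarrow> diffop_order P \<le> n"
  by (auto simp: diffop_coeff_def diffop_order_def intro: degree_le)

lemma diffop_add_induct [case_names monom add]:
  assumes monom: "\<And>c n. S (mult_op c * D_op ^ n)"
    and add: "\<And>A B. S A \<Longrightarrow> S B \<Longrightarrow> S (A + B)"
  shows "S P"
proof -
  have "S (\<Sum>j\<le>n. mult_op (c j) * D_op ^ j)" for c and n :: nat
    by (induction n) (simp, use monom[of _ 0] in simp, simp only: sum.atMost_Suc add monom)
  from this[of "diffop_coeff P" "diffop_order P"] show ?thesis
    by (simp flip: diffop_eq_sum)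
qed

text \<open>Functions and D generate the ring, so rules for products, such as those of the adjoint
  and the concomitant, reduce to these generators.\<close>

lemma diffop_induct [case_names mult_op D_op add mult]:
  assumes c: "\<And>c. S (mult_op c)" and D: "S D_op"
    and add: "\<And>A B. S A \<Longrightarrow> S B \<Longrightarrow> S (A + B)"
    and mult: "\<And>A B. S A \<Longrightarrow> S B \<Longrightarrow> S (A * B)"
  shows "S P"
proof (induction P rule: diffop_add_induct)
  case (monom c n)
  have "S (D_op ^ n)" by (induction n) (use assms(1)[of 1] in simp, simp add: mult D)
  thus ?case by (intro mult c)
qed (rule add)

lemma formal_adjoint_upto:
  assumes "diffop_order P \<le> n"
  shows "formal_adjoint P = (\<Sum>j\<le>n. (-1) ^ j * D_op ^ j * mult_op (diffop_coeff P j))"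
  unfolding formal_adjoint_def
  using assms by (intro sum.mono_neutral_left) (auto simp: diffop_coeff_high)

lemma formal_adjoint_add: "formal_adjoint (P + Q) = formal_adjoint P + formal_adjoint Q"
proof -
  define n where "n = max (diffop_order P) (diffop_order Q)"
  have "diffop_order P \<le> n" "diffop_order Q \<le> n" "diffop_order (P + Q) \<le> n"
    unfolding n_def diffop_order_def plus_diffop.rep_eq
    by (auto intro: degree_add_le_max)
  thus ?thesis
    by (simp add: formal_adjoint_upto[of _ n] diffop_coeff_add mult_op_add ring_distribs sum.distrib)
qed

lemma formal_adjoint_0 [simp]: "formal_adjoint 0 = 0"
  by (simp add: formal_adjoint_def)

lemma formal_adjoint_uminus: "formal_adjoint (- P) = - formal_adjoint P"
  using formal_adjoint_add[of P "- P"] by (simp add: eq_neg_iff_add_eq_0 add.commute)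

lemma formal_adjoint_diff: "formal_adjoint (P - Q) = formal_adjoint P - formal_adjoint Q"
  using formal_adjoint_add[of P "- Q"] by (simp add: formal_adjoint_uminus)

lemma formal_adjoint_monom:
  "formal_adjoint (mult_op c * D_op ^ j) = (-1) ^ j * D_op ^ j * mult_op c"
proof -
  have "diffop_order (mult_op c * D_op ^ j) \<le> j"
    by (rule diffop_order_le) (simp add: diffop_coeff_monom)
  hence "formal_adjoint (mult_op c * D_op ^ j)
      = (\<Sum>i\<le>j. (-1) ^ i * D_op ^ i * mult_op (if i = j then c else 0))"
    by (simp add: formal_adjoint_upto diffop_coeff_monom)
  also have "\<dots> = (\<Sum>i\<in>{j}. (-1) ^ i * D_op ^ i * mult_op (if i = j then c else 0))"
    by (intro sum.mono_neutral_right) auto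
  finally show ?thesis by simp
qed

lemma formal_adjoint_mult_op [simp]: "formal_adjoint (mult_op c) = mult_op c"
  using formal_adjoint_monom[of c 0] by simp

lemma formal_adjoint_1 [simp]: "formal_adjoint 1 = 1"
  using formal_adjoint_mult_op[of 1] by simp

lemma formal_adjoint_D_op [simp]: "formal_adjoint D_op = - D_op"
  using formal_adjoint_monom[of 1 1] by simp

text \<open>Induction over generators in the left factor. The only real computation is for D, where
  the two terms with \<open>ratfun_deriv e\<close> that arise from D e = e D + e' cancel.\<close>

lemma formal_adjoint_mult: "formal_adjoint (P * Q) = formal_adjoint Q * formal_adjoint P"
proof (induction P arbitrary: Q rule: diffop_induct)
  case (mult_op c)
  show ?case
  proof (induction Q rule: diffop_add_induct)
    case (monom e n)
    have eq: "mult_op c * (mult_op e * D_op ^ n) = mult_op (e * c) * D_op ^ n"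
      by (simp add: mult.assoc mult.commute[of e c] mult_op_mult)
    show ?case
      unfolding eq formal_adjoint_monom by (simp only: mult_op_mult mult.assoc formal_adjoint_mult_op)
  qed (simp add: formal_adjoint_add ring_distribs)
next
  case D_op
  show ?case
  proof (induction Q rule: diffop_add_induct)
    case (monom e n)
    have "D_op * (mult_op e * D_op ^ n)
        = mult_op e * D_op ^ Suc n + mult_op (ratfun_deriv e) * D_op ^ n"
      by (simp add: D_op_mult_op ring_distribs mult.assoc flip: mult.assoc[of D_op "mult_op e"])
    moreover have "D_op ^ Suc n * mult_op e
        = D_op ^ n * (mult_op e * D_op + mult_op (ratfun_deriv e))"
      by (simp only: power_Suc2 mult.assoc D_op_mult_op)
    ultimately have "formal_adjoint (D_op * (mult_op e * D_op ^ n))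
        = (-1) ^ n * (D_op ^ n * mult_op (ratfun_deriv e)
            - D_op ^ n * (mult_op e * D_op + mult_op (ratfun_deriv e)))"
      by (simp only: formal_adjoint_add formal_adjoint_monom power_Suc[of "-1"] mult_minus_left
          mult_1_left mult.assoc right_diff_distrib) simp
    thus ?case by (simp add: formal_adjoint_monom ring_distribs mult.assoc)
  qed (simp add: formal_adjoint_add ring_distribs)
next
  case (add A B)
  thus ?case by (simp add: formal_adjoint_add ring_distribs)
next
  case (mult A B)
  have "formal_adjoint (A * B * Q) = formal_adjoint (A * (B * Q))" by (simp only: mult.assoc)
  also have "\<dots> = formal_adjoint Q * formal_adjoint B * formal_adjoint A" by (simp only: mult)
  also have "\<dots> = formal_adjoint Q * formal_adjoint (A * B)" by (simp only: mult mult.assoc)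
  finally show ?case .
qed

lemma formal_adjoint_involution [simp]: "formal_adjoint (formal_adjoint P) = P"
  by (induction P rule: diffop_induct)
    (simp_all add: formal_adjoint_add formal_adjoint_mult formal_adjoint_uminus)

lemma formal_adjoint_power: "formal_adjoint (P ^ n) = formal_adjoint P ^ n"
  by (induction n) (simp_all add: formal_adjoint_mult power_commutes)

text \<open>The j-th summand of the adjoint has order at most j and leading coefficient (-1)^j c_j,
  so only j = n reaches degree n.\<close>

lemma diffop_coeff_adjoint_lead:
  assumes "diffop_order P \<le> n"
  shows "diffop_order (formal_adjoint P) \<le> n"
    and "diffop_coeff (formal_adjoint P) n = (-1) ^ n * diffop_coeff P n"
proof -
  let ?t = "\<lambda>j. (-1) ^ j * D_op ^ j * mult_op (diffop_coeff P j)"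
  \<comment> \<open>The sign is an operator here; written as a \<open>mult_op\<close> it is covered
    by the rules for orders and leading coefficients.\<close>
  have sgn: "((-1) ^ j :: diffop) = mult_op ((-1) ^ j)" for j
  proof (induction j)
    case (Suc j)
    have "mult_op (-1) = -1"
      using mult_op_add[of 1 "-1"] by (simp add: eq_neg_iff_add_eq_0 add.commute)
    thus ?case by (simp only: power_Suc mult_op_mult Suc)
  qed simp
  have o: "diffop_order (?t j) \<le> j" for j
  proof (cases "?t j = 0")
    case True
    thus ?thesis by (simp add: diffop_order_def zero_diffop.rep_eq)
  next
    case False
    hence "mult_op (diffop_coeff P j) \<noteq> 0" "(-1 :: diffop) ^ j \<noteq> 0" by auto
    thus ?thesis by (simp add: sgn order_mult)
  qed
  have l: "diffop_coeff (?t j) j = (-1) ^ j * diffop_coeff P j" for j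
  proof (cases "diffop_coeff P j = 0")
    case False
    have "op_lead (?t j) = (-1) ^ j * diffop_coeff P j" by (simp add: op_lead_mult sgn)
    moreover have "diffop_order (?t j) = j" using False by (simp add: sgn order_mult)
    ultimately show ?thesis by (simp add: op_lead_def)
  qed simp
  have coeff: "diffop_coeff (formal_adjoint P) m = (\<Sum>j\<le>n. diffop_coeff (?t j) m)" for m
    using assms by (simp add: formal_adjoint_upto diffop_coeff_sum)
  have z: "diffop_coeff (?t j) m = 0" if "j < m" for j m
    using o[of j] that by (intro diffop_coeff_high) linarith
  show "diffop_order (formal_adjoint P) \<le> n"
    by (rule diffop_order_le) (use z in \<open>auto simp: coeff intro!: sum.neutral\<close>)
  have "diffop_coeff (formal_adjoint P) n = (\<Sum>j\<in>{n}. diffop_coeff (?t j) n)"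
    unfolding coeff using z by (intro sum.mono_neutral_right) auto
  thus "diffop_coeff (formal_adjoint P) n = (-1) ^ n * diffop_coeff P n" by (simp add: l)
qed

lemma order_formal_adjoint [simp]: "diffop_order (formal_adjoint P) = diffop_order P"
  using diffop_coeff_adjoint_lead(1)[of P "diffop_order P"]
    diffop_coeff_adjoint_lead(1)[of "formal_adjoint P" "diffop_order (formal_adjoint P)"] by simp

lemma op_lead_formal_adjoint: "op_lead (formal_adjoint P) = (-1) ^ diffop_order P * op_lead P"
  using diffop_coeff_adjoint_lead(2)[of P "diffop_order P"] by (simp add: op_lead_def)

text \<open>\<open>conc_pow j f g\<close> is the Lagrange concomitant of \<open>\<partial>\<^sup>j\<close>: its derivative is
  \<open>f\<^sup>(\<^sup>j\<^sup>) g - (-1)\<^sup>j f g\<^sup>(\<^sup>j\<^sup>)\<close>.\<close>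

primrec conc_pow :: "nat \<Rightarrow> complex fls \<Rightarrow> complex fls \<Rightarrow> complex fls" where
  "conc_pow 0 f g = 0"
| "conc_pow (Suc j) f g = (fls_deriv ^^ j) f * g - conc_pow j f (fls_deriv g)"

lemma conc_pow_add_right: "conc_pow j f (g + h) = conc_pow j f g + conc_pow j f h"
  by (induction j arbitrary: g h) (simp_all add: algebra_simps)

lemma conc_pow_const_right: "conc_pow j f (fls_const c * g) = fls_const c * conc_pow j f g"
proof (induction j arbitrary: g)
  case (Suc j)
  have "fls_deriv (fls_const c * g) = fls_const c * fls_deriv g" by simp
  thus ?case by (simp only: conc_pow.simps Suc right_diff_distrib mult.left_commute)
qed simp

lemma conc_pow_add_left: "conc_pow j (f + h) g = conc_pow j f g + conc_pow j h g"
  by (induction j arbitrary: g) (simp_all add: algebra_simps fls_deriv_pow_add)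

lemma conc_pow_const_left: "conc_pow j (fls_const c * f) g = fls_const c * conc_pow j f g"
  by (induction j arbitrary: g) (simp_all add: right_diff_distrib mult.assoc fls_deriv_pow_const)

lemma conc_pow_0_right [simp]: "conc_pow j f 0 = 0"
  by (induction j) simp_all

text \<open>Lagrange's bilinear concomitant: by the formula for \<open>conc_pow\<close>, its
  derivative is (P f) g - f (P^* g). Attaching the coefficients to \<open>g\<close> is what produces
  the formal adjoint.\<close>

definition concomitant :: "diffop \<Rightarrow> complex fls \<Rightarrow> complex fls \<Rightarrow> complex fls" where
  "concomitant P f g = (\<Sum>j\<le>diffop_order P. conc_pow j f (ratfun_fls (diffop_coeff P j) * g))"

lemma concomitant_upto:
  "diffop_order P \<le> n \<Longrightarrow>
     concomitant P f g = (\<Sum>j\<le>n. conc_pow j f (ratfun_fls (diffop_coeff P j) * g))"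
  unfolding concomitant_def
  by (intro sum.mono_neutral_left) (auto simp: diffop_coeff_high)

lemma concomitant_add_op: "concomitant (P + Q) f g = concomitant P f g + concomitant Q f g"
proof -
  define n where "n = max (diffop_order P) (diffop_order Q)"
  have "diffop_order P \<le> n" "diffop_order Q \<le> n" "diffop_order (P + Q) \<le> n"
    unfolding n_def diffop_order_def plus_diffop.rep_eq
    by (auto intro: degree_add_le_max)
  thus ?thesis
    by (simp add: concomitant_upto[of _ n] diffop_coeff_add ratfun_fls_add ring_distribs
        sum.distrib conc_pow_add_right)
qed

lemma concomitant_add_right: "concomitant P f (g + h) = concomitant P f g + concomitant P f h"
  by (simp add: concomitant_def ring_distribs conc_pow_add_right sum.distrib)

lemma concomitant_0_right [simp]: "concomitant P f 0 = 0"
  by (simp add: concomitant_def)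

lemma concomitant_sum_right: "concomitant P f (sum g I) = (\<Sum>i\<in>I. concomitant P f (g i))"
  by (induction I rule: infinite_finite_induct) (simp_all add: concomitant_add_right)

lemma concomitant_const_right: "concomitant P f (fls_const c * g) = fls_const c * concomitant P f g"
  by (simp only: concomitant_def mult.left_commute[of _ "fls_const c"] conc_pow_const_right
      sum_distrib_left)

lemma concomitant_uminus_right: "concomitant P f (- g) = - concomitant P f g"
  using concomitant_add_right[of P f g "- g"] by (simp add: eq_neg_iff_add_eq_0 add.commute)

lemma concomitant_add_left: "concomitant P (f + h) g = concomitant P f g + concomitant P h g"
  by (simp add: concomitant_def conc_pow_add_left sum.distrib)

lemma concomitant_const_left: "concomitant P (fls_const c * f) g = fls_const c * concomitant P f g"
  by (simp only: concomitant_def conc_pow_const_left sum_distrib_left)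

lemma concomitant_0_left [simp]: "concomitant P 0 g = 0"
  using concomitant_const_left[of P 0 0 g] by simp

lemma concomitant_sum_left: "concomitant P (sum f I) g = (\<Sum>i\<in>I. concomitant P (f i) g)"
  by (induction I rule: infinite_finite_induct) (simp_all add: concomitant_add_left)

lemma concomitant_monom:
  "concomitant (mult_op c * D_op ^ j) f g = conc_pow j f (ratfun_fls c * g)"
proof -
  have "diffop_order (mult_op c * D_op ^ j) \<le> j"
    by (rule diffop_order_le) (simp add: diffop_coeff_monom)
  hence "concomitant (mult_op c * D_op ^ j) f g
      = (\<Sum>i\<le>j. conc_pow i f (ratfun_fls (if i = j then c else 0) * g))"
    by (simp add: concomitant_upto diffop_coeff_monom)
  also have "\<dots> = (\<Sum>i\<in>{j}. conc_pow i f (ratfun_fls (if i = j then c else 0) * g))"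
    by (intro sum.mono_neutral_right) auto
  finally show ?thesis by simp
qed

lemma concomitant_mult_op [simp]: "concomitant (mult_op c) f g = 0"
  using concomitant_monom[of c 0] by simp

lemma concomitant_D_op [simp]: "concomitant D_op f g = f * g"
  using concomitant_monom[of 1 1] by simp

text \<open>Integration by parts can be done one factor at a time: first \<open>A\<close> is moved
  to the other side, then \<open>B\<close>. On generators, a function contributes no boundary term
  and D contributes the product (B f) g.\<close>

lemma concomitant_mult:
  "concomitant (A * B) f g = concomitant A (op_act B f) g + concomitant B f (op_act (formal_adjoint A) g)"
proof (induction A arbitrary: B f g rule: diffop_induct)
  case (mult_op c)
  show ?case
  proof (induction B rule: diffop_add_induct)
    case (monom e n)
    have "mult_op c * (mult_op e * D_op ^ n) = mult_op (c * e) * D_op ^ n"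
      by (simp add: mult.assoc mult_op_mult)
    thus ?case
      by (simp add: concomitant_monom ratfun_fls_mult mult_ac)
  qed (simp add: concomitant_add_op ring_distribs)
next
  case D_op
  show ?case
  proof (induction B rule: diffop_add_induct)
    case (monom e n)
    have "D_op * (mult_op e * D_op ^ n)
        = mult_op e * D_op ^ Suc n + mult_op (ratfun_deriv e) * D_op ^ n"
      by (simp add: D_op_mult_op ring_distribs mult.assoc flip: mult.assoc[of D_op "mult_op e"])
    thus ?case
      by (simp add: concomitant_add_op concomitant_monom concomitant_uminus_right ratfun_fls_deriv
          conc_pow_add_right del: power_Suc)
  qed (simp add: concomitant_add_op ring_distribs)
next
  case (add A A')
  thus ?case by (simp add: concomitant_add_op formal_adjoint_add concomitant_add_right ring_distribs)
next
  case (mult A A')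
  have "concomitant (A * A' * B) f g = concomitant (A * (A' * B)) f g"
    by (simp only: mult.assoc)
  also have "\<dots> = concomitant (A * A') (op_act B f) g
      + concomitant B f (op_act (formal_adjoint (A * A')) g)"
    by (simp only: mult formal_adjoint_mult op_act_mult add.assoc)
  finally show ?case .
qed

text \<open>As an expression in \<open>f\<close> the concomitant has order n - 1 with top
  coefficient \<open>g\<close>; this is the source of nondegeneracy.\<close>

lemma conc_pow_as_sum:
  "\<exists>w. (\<forall>f. conc_pow n f g = (\<Sum>i<n. w i * (fls_deriv ^^ i) f)) \<and> (0 < n \<longrightarrow> w (n - 1) = g)"
proof (induction n arbitrary: g)
  case (Suc n)
  obtain w where w: "\<And>f. conc_pow n f (fls_deriv g) = (\<Sum>i<n. w i * (fls_deriv ^^ i) f)"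
    using Suc[of "fls_deriv g"] by blast
  define w' where "w' = (\<lambda>i. if i = n then g else - w i)"
  have "conc_pow (Suc n) f g = (\<Sum>i<Suc n. w' i * (fls_deriv ^^ i) f)" for f
    by (simp add: w w'_def sum_negf mult.commute)
  moreover have "w' (Suc n - 1) = g" by (simp add: w'_def)
  ultimately show ?case by blast
qed simp

lemma concomitant_as_sum:
  "\<exists>w. (\<forall>f. concomitant P f g = (\<Sum>i<diffop_order P. w i * (fls_deriv ^^ i) f)) \<and>
     (0 < diffop_order P \<longrightarrow> w (diffop_order P - 1) = ratfun_fls (op_lead P) * g)"
proof -
  have "\<exists>w. (\<forall>f. (\<Sum>j\<le>n. conc_pow j f (G j)) = (\<Sum>i<n. w i * (fls_deriv ^^ i) f)) \<and>
     (0 < n \<longrightarrow> w (n - 1) = G n)" for n and G :: "nat \<Rightarrow> complex fls"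
  proof (induction n)
    case (Suc n)
    obtain w where w: "\<And>f. (\<Sum>j\<le>n. conc_pow j f (G j)) = (\<Sum>i<n. w i * (fls_deriv ^^ i) f)"
      using Suc by blast
    obtain v where v: "\<And>f. conc_pow (Suc n) f (G (Suc n)) = (\<Sum>i<Suc n. v i * (fls_deriv ^^ i) f)"
      "v n = G (Suc n)"
      using conc_pow_as_sum[of "Suc n" "G (Suc n)"] by auto
    define w' where "w' = (\<lambda>i. v i + (if i < n then w i else 0))"
    have "(\<Sum>j\<le>Suc n. conc_pow j f (G j)) = (\<Sum>i<Suc n. w' i * (fls_deriv ^^ i) f)" for f
      by (simp add: w v w'_def ring_distribs sum.distrib del: conc_pow.simps)
    moreover have "w' (Suc n - 1) = G (Suc n)" by (simp add: w'_def v)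
    ultimately show ?case by blast
  qed simp
  from this[where n = "diffop_order P" and G = "\<lambda>j. ratfun_fls (diffop_coeff P j) * g"] show ?thesis
    by (simp add: concomitant_def op_lead_def)
qed

section \<open>Linear independence over the constants\<close>

definition fls_indep :: "nat \<Rightarrow> (nat \<Rightarrow> complex fls) \<Rightarrow> bool" where
  "fls_indep m f \<longleftrightarrow> (\<forall>c. (\<Sum>i<m. fls_const (c i) * f i) = 0 \<longrightarrow> (\<forall>i<m. c i = 0))"

lemma fls_indepD: "fls_indep m f \<Longrightarrow> (\<Sum>i<m. fls_const (c i) * f i) = 0 \<Longrightarrow> i < m \<Longrightarrow> c i = 0"
  by (auto simp: fls_indep_def)

lemma fls_indep_mono:
  assumes "fls_indep m f" "k \<le> m"
  shows "fls_indep k f"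
  unfolding fls_indep_def
proof (intro allI impI)
  fix c i assume c: "(\<Sum>i<k. fls_const (c i) * f i) = 0" and i: "i < k"
  define c' where "c' = (\<lambda>i. if i < k then c i else 0)"
  have "(\<Sum>i<m. fls_const (c' i) * f i) = (\<Sum>i<k. fls_const (c' i) * f i)"
    using assms(2) by (intro sum.mono_neutral_right) (auto simp: c'_def)
  also have "\<dots> = 0" using c by (simp add: c'_def)
  finally have "c' i = 0" using fls_indepD[OF assms(1)] i assms(2) by (metis less_le_trans)
  thus "c i = 0" using i by (simp add: c'_def)
qed

text \<open>Dividing a relation by its last coefficient and differentiating it gives a relation among
  fewer functions, with one derivative less; so all quotients of the coefficients are constant.\<close>

lemma fls_indep_jets:
  assumes "fls_indep m f" "\<forall>j<m. (\<Sum>i<m. v i * (fls_deriv ^^ j) (f i)) = 0" "i < m"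
  shows "v i = 0"
  using assms
proof (induction m arbitrary: v i)
  case (Suc m)
  have ind: "fls_indep m f" using Suc.prems(1) by (rule fls_indep_mono) simp
  have rel: "(\<Sum>i<m. v i * (fls_deriv ^^ j) (f i)) + v m * (fls_deriv ^^ j) (f m) = 0" if "j \<le> m" for j
    using Suc.prems(2) that by simp
  have vm: "v m = 0"
  proof (rule ccontr)
    assume vm: "v m \<noteq> 0"
    define u where "u = (\<lambda>i. v i / v m)"
    have urel: "(\<Sum>i<m. u i * (fls_deriv ^^ j) (f i)) + (fls_deriv ^^ j) (f m) = 0" if "j \<le> m" for j
    proof -
      have "(\<Sum>i<m. u i * (fls_deriv ^^ j) (f i)) + (fls_deriv ^^ j) (f m)
          = ((\<Sum>i<m. v i * (fls_deriv ^^ j) (f i)) + v m * (fls_deriv ^^ j) (f m)) / v m"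
        using vm by (simp add: u_def add_divide_distrib sum_divide_distrib)
      thus ?thesis using rel[OF that] by simp
    qed
    have "(\<Sum>i<m. fls_deriv (u i) * (fls_deriv ^^ j) (f i)) = 0" if "j < m" for j
    proof -
      have "fls_deriv ((\<Sum>i<m. u i * (fls_deriv ^^ j) (f i)) + (fls_deriv ^^ j) (f m)) = 0"
        using urel[of j] that by (simp del: fls_deriv_add)
      hence "(\<Sum>i<m. fls_deriv (u i) * (fls_deriv ^^ j) (f i))
          + ((\<Sum>i<m. u i * (fls_deriv ^^ Suc j) (f i)) + (fls_deriv ^^ Suc j) (f m)) = 0"
        by (simp add: fls_deriv_sum sum.distrib add_ac)
      thus ?thesis using urel[of "Suc j"] that by (simp del: funpow.simps)
    qed
    hence "fls_deriv (u i) = 0" if "i < m" for i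
      using Suc.IH[OF ind, of "\<lambda>i. fls_deriv (u i)"] that by blast
    hence "\<exists>c. \<forall>i<m. u i = fls_const (c i)"
      by (intro exI[of _ "\<lambda>i. fls_nth (u i) 0"]) (simp add: fls_deriv_eq_0_iff)
    then obtain c where c: "\<And>i. i < m \<Longrightarrow> u i = fls_const (c i)" by blast
    define c' where "c' = (\<lambda>i. if i < m then c i else 1)"
    have "(\<Sum>i<Suc m. fls_const (c' i) * f i) = 0"
      using urel[of 0] c by (simp add: c'_def)
    from fls_indepD[OF Suc.prems(1) this, of m] show False by (simp add: c'_def)
  qed
  hence "v i = 0" if "i < m" for i
    using Suc.IH[OF ind, of v i] rel that by simp
  thus ?case using vm Suc.prems(3) by (cases "i = m") auto
qed simp

text \<open>A kernel vector of the Wronskian matrix is a relation among all jets, which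
  \<open>fls_indep_jets\<close> excludes.\<close>

lemma fls_indep_imp_wronskian:
  assumes "fls_indep m f"
  shows "Determinant.det (mat m m (\<lambda>(i, j). (fls_deriv ^^ i) (f j))) \<noteq> 0"
proof
  let ?A = "mat m m (\<lambda>(i, j). (fls_deriv ^^ i) (f j))"
  assume "Determinant.det ?A = 0"
  then obtain v where v: "v \<in> carrier_vec m" "v \<noteq> 0\<^sub>v m" "?A *\<^sub>v v = 0\<^sub>v m"
    using det_0_iff_vec_prod_zero_field[of ?A m] by auto
  have "(\<Sum>i<m. vec_index v i * (fls_deriv ^^ j) (f i)) = 0" if "j < m" for j
  proof -
    have "vec_index (?A *\<^sub>v v) j = 0" using v that by simp
    thus ?thesis using v(1) that by (simp add: scalar_prod_def mult.commute atLeast0LessThan)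
  qed
  hence "vec_index v i = 0" if "i < m" for i using fls_indep_jets[OF assms] that by blast
  thus False using v by auto
qed

text \<open>The nonzero determinant turns independence of the columns of jets into independence of
  the rows.\<close>

lemma fls_indep_rows:
  assumes "fls_indep m f" "\<forall>k<m. (\<Sum>i<m. w i * (fls_deriv ^^ i) (f k)) = 0" "i < m"
  shows "w i = 0"
proof -
  let ?A = "mat m m (\<lambda>(i, j). (fls_deriv ^^ i) (f j))"
  have "Determinant.det ?A\<^sup>T \<noteq> 0"
    using fls_indep_imp_wronskian[OF assms(1)] by (subst det_transpose[of _ m]) auto
  moreover have "?A\<^sup>T *\<^sub>v Matrix.vec m w = 0\<^sub>v m"
    using assms(2) by (intro eq_vecI) (auto simp: scalar_prod_def mult.commute atLeast0LessThan)
  ultimately have "Matrix.vec m w = 0\<^sub>v m"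
    using det_0_iff_vec_prod_zero_field[of "?A\<^sup>T" m] by (metis mat_carrier transpose_carrier_mat vec_carrier)
  thus ?thesis using assms(3) by (metis index_vec index_zero_vec(1))
qed

text \<open>With more solutions than the order, the coefficients of \<open>P\<close> would be a row
  relation of the Wronskian matrix, and the leading one is nonzero.\<close>

lemma kernel_dim_le_order:
  assumes "P \<noteq> 0" "fls_indep m f" "\<forall>i<m. op_act P (f i) = 0"
  shows "m \<le> diffop_order P"
proof (rule ccontr)
  assume "\<not> m \<le> diffop_order P"
  hence lt: "diffop_order P < m" by simp
  define w where "w = (\<lambda>i. ratfun_fls (diffop_coeff P i))"
  have "op_act P g = (\<Sum>i<m. w i * (fls_deriv ^^ i) g)" for g
    unfolding op_act_eq w_def
    using lt by (intro sum.mono_neutral_left) (auto simp: diffop_coeff_high)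
  hence "w (diffop_order P) = 0"
    using fls_indep_rows[OF assms(2), of w] assms(3) lt by simp
  thus False using assms(1) by (simp add: w_def flip: op_lead_def)
qed

lemma op_eq_0_if_kills:
  assumes "fls_indep m f" "\<forall>i<m. op_act P (f i) = 0" "diffop_order P < m"
  shows "P = 0"
  using kernel_dim_le_order[OF _ assms(1,2)] assms(3) by force

text \<open>The row relation given by the concomitant has top entry \<open>op_lead P\<close> times
  \<open>h\<close>.\<close>

lemma concomitant_nondegenerate:
  assumes "fls_indep (diffop_order P) f" "\<forall>k<diffop_order P. concomitant P (f k) h = 0"
    and "0 < diffop_order P"
  shows "h = 0"
proof -
  let ?n = "diffop_order P"
  obtain w where w: "\<And>f. concomitant P f h = (\<Sum>i<?n. w i * (fls_deriv ^^ i) f)"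
    "w (?n - 1) = ratfun_fls (op_lead P) * h"
    using concomitant_as_sum[of P h] assms(3) by blast
  have "w (?n - 1) = 0"
    using fls_indep_rows[OF assms(1), of w "?n - 1"] assms(2,3) w(1) by simp
  moreover have "P \<noteq> 0" using assms(3) by (auto simp: diffop_order_def zero_diffop.rep_eq)
  ultimately show ?thesis using w(2) by simp
qed

section \<open>Factorizations from isotropic spaces\<close>

text \<open>\<open>Q = R P\<close> by division, and isotropy makes \<open>R\<^sup>* g\<close> orthogonal, under the concomitant of
  \<open>P\<close>, to the whole kernel of \<open>P\<close>. As that pairing is nondegenerate, \<open>R\<^sup>*\<close> has the same kernel
  as \<open>P\<close>.\<close>

lemma factorization_if_isotropic:
  assumes f: "fls_indep n f" and P: "\<forall>i<n. op_act P (f i) = 0" "diffop_order P = n"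
    and n: "0 < n" "even n"
    and Q: "formal_adjoint Q = Q" "diffop_order Q = 2 * n" "op_lead Q = 1"
      "\<forall>i<n. op_act Q (f i) = 0"
    and iso: "\<forall>i<n. \<forall>j<n. concomitant Q (f i) (f j) = 0"
  shows "self_adjoint_factorization Q P (op_lead P)"
proof -
  have Pnz: "P \<noteq> 0" using P(2) n by (auto simp: diffop_order_def zero_diffop.rep_eq)
  define w where "w = op_lead P"
  have w: "w \<noteq> 0" using Pnz by (simp add: w_def)
  define M where "M = mult_op (1 / w) * P"
  have Mnz: "M \<noteq> 0" using Pnz w by (simp add: M_def)
  have oM: "diffop_order M = n" using Pnz w P(2) by (simp add: M_def order_mult)
  have lM: "op_lead M = 1" using w by (simp add: M_def op_lead_mult flip: w_def)
  have Mf: "op_act M (f i) = 0" if "i < n" for i using P(1) that by (simp add: M_def)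
  obtain R S where RS: "Q = R * M + S" "S = 0 \<or> diffop_order S < diffop_order M"
    using right_division[OF Mnz] by blast
  have "S = 0"
  proof (rule ccontr)
    assume "S \<noteq> 0"
    moreover have "op_act S (f i) = 0" if "i < n" for i
    proof -
      have "op_act Q (f i) = 0" using Q(4) that by blast
      thus ?thesis using Mf[OF that] by (simp add: RS)
    qed
    ultimately show False using op_eq_0_if_kills[OF f, of S] RS(2) oM by auto
  qed
  hence QRM: "Q = R * M" using RS by simp
  have Rnz: "R \<noteq> 0" using Q(3) QRM by (auto simp: op_lead_def)
  have oR: "diffop_order R = n" using Q(2) QRM Rnz Mnz oM by (simp add: order_mult)
  have lR: "op_lead R = 1" using Q(3) QRM lM by (simp add: op_lead_mult)
  have "op_act (formal_adjoint R) (f j) = 0" if j: "j < n" for j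
  proof (rule concomitant_nondegenerate[of M f])
    show "\<forall>k<diffop_order M. concomitant M (f k) (op_act (formal_adjoint R) (f j)) = 0"
    proof (intro allI impI)
      fix k assume "k < diffop_order M"
      hence k: "k < n" by (simp add: oM)
      have "concomitant Q (f k) (f j) = 0" using iso j k by blast
      thus "concomitant M (f k) (op_act (formal_adjoint R) (f j)) = 0"
        by (simp add: QRM concomitant_mult Mf[OF k])
    qed
  qed (use f oM n in auto)
  \<comment> \<open>Here n must be even: the adjoint of the monic \<open>R\<close> has leading
    coefficient (-1)^n, so it is monic like \<open>M\<close> and the leading terms cancel.\<close>
  moreover have "diffop_order (formal_adjoint R - M) < n \<or> formal_adjoint R = M"
    by (cases "formal_adjoint R = M", simp, rule order_less_by_lead)
      (use oR oM lR lM n(2) op_lead_formal_adjoint[of R] in \<open>auto simp: op_lead_def\<close>)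
  ultimately have "formal_adjoint R = M"
    using op_eq_0_if_kills[OF f, of "formal_adjoint R - M"] Mf by auto
  hence "R = formal_adjoint M" by (metis formal_adjoint_involution)
  hence "Q = formal_adjoint P * (mult_op (1 / w) * mult_op (1 / w)) * P"
    by (simp add: QRM M_def formal_adjoint_mult mult.assoc)
  thus ?thesis
    using w by (simp add: self_adjoint_factorization_def power2_eq_square w_def flip: mult_op_mult)
qed

section \<open>Degree of a rational function at infinity\<close>

definition rdeg :: "ratfun \<Rightarrow> int" where
  "rdeg r = int (degree (fst (quot_of_fract r))) - int (degree (snd (quot_of_fract r)))"

lemma rdeg_Fract:
  assumes "a \<noteq> 0" "b \<noteq> 0"
  shows "rdeg (Fract a b) = int (degree a) - int (degree b)"
proof -
  obtain c d where cd: "quot_of_fract (Fract a b) = (c, d)" by fastforce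
  have d: "d \<noteq> 0" using snd_quot_of_fract_nonzero[of "Fract a b"] cd by simp
  have "Fract a b \<noteq> 0" using assms by (simp add: Zero_fract_def eq_fract)
  hence c: "c \<noteq> 0" using fst_quot_of_fract_eq_0_iff[of "Fract a b"] cd by simp
  have "Fract c d = Fract a b" using Fract_quot_of_fract[of "Fract a b"] cd by simp
  hence "c * b = a * d" using assms d by (simp add: eq_fract)
  hence "degree (c * b) = degree (a * d)" by simp
  hence "degree c + degree b = degree a + degree d" using assms c d by (simp add: degree_mult_eq)
  thus ?thesis by (simp add: rdeg_def cd)
qed

lemma nonzero_Fract_cases:
  assumes "(r :: ratfun) \<noteq> 0"
  obtains a b where "r = Fract a b" "a \<noteq> 0" "b \<noteq> 0"
  using assms by (cases r rule: Fract_cases_nonzero) auto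

lemma rdeg_mult: "r \<noteq> 0 \<Longrightarrow> s \<noteq> 0 \<Longrightarrow> rdeg (r * s) = rdeg r + rdeg s"
  by (elim nonzero_Fract_cases) (simp add: rdeg_Fract degree_mult_eq)

text \<open>\<open>rdeg 0\<close> evaluates to 0 instead of minus infinity, so zero is put below
  every bound by hand.\<close>

definition rdeg_le :: "ratfun \<Rightarrow> int \<Rightarrow> bool" where
  "rdeg_le r n \<longleftrightarrow> r = 0 \<or> rdeg r \<le> n"

lemma rdeg_le_Fract:
  "b \<noteq> 0 \<Longrightarrow> rdeg_le (Fract a b) n \<longleftrightarrow> a = 0 \<or> int (degree a) \<le> int (degree b) + n"
proof -
  assume b: "b \<noteq> 0"
  have "Fract a b = 0 \<longleftrightarrow> a = 0" using b by (simp add: Zero_fract_def eq_fract)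
  thus ?thesis using b by (cases "a = 0") (auto simp: rdeg_le_def rdeg_Fract)
qed

lemma rdeg_le_0 [simp]: "rdeg_le 0 n"
  by (simp add: rdeg_le_def)

lemma rdeg_le_refl [simp]: "rdeg_le r (rdeg r)"
  by (simp add: rdeg_le_def)

lemma rdeg_le_mono: "rdeg_le r m \<Longrightarrow> m \<le> n \<Longrightarrow> rdeg_le r n"
  by (auto simp: rdeg_le_def)

lemma rdeg_le_add:
  assumes "rdeg_le r n" "rdeg_le s n"
  shows "rdeg_le (r + s) n"
proof (cases "r = 0 \<or> s = 0")
  case False
  then obtain a b c d where r: "r = Fract a b" "a \<noteq> 0" "b \<noteq> 0" and s: "s = Fract c d" "c \<noteq> 0" "d \<noteq> 0"
    by (metis nonzero_Fract_cases)
  have 1: "int (degree a) \<le> int (degree b) + n" "int (degree c) \<le> int (degree d) + n"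
    using assms r s by (simp_all add: rdeg_le_Fract)
  have "degree (a * d + c * b) \<le> max (degree (a * d)) (degree (c * b))"
    by (rule degree_add_le_max)
  hence "int (degree (a * d + c * b)) \<le> int (degree (b * d)) + n"
    using 1 r s by (simp add: degree_mult_eq)
  thus ?thesis using r s by (simp add: rdeg_le_Fract)
qed (use assms in auto)

lemma rdeg_le_mult: "rdeg_le r m \<Longrightarrow> rdeg_le s n \<Longrightarrow> rdeg_le (r * s) (m + n)"
  by (cases "r = 0 \<or> s = 0") (auto simp: rdeg_le_def rdeg_mult)

lemma rdeg_le_const [simp]: "rdeg_le (to_fract [:c:]) 0"
  by (simp add: to_fract_def rdeg_le_Fract)

lemma rdeg_le_linear [simp]: "rdeg_le (to_fract [:c, 1:]) 1"
  by (simp add: to_fract_def rdeg_le_Fract)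

lemma rdeg_linear: "rdeg (to_fract [:c, 1:]) = 1"
  by (simp add: to_fract_def rdeg_Fract)

lemma rdeg_le_uminus: "rdeg_le r n \<Longrightarrow> rdeg_le (- r) n"
proof -
  assume r: "rdeg_le r n"
  have "[:-1:] = - (1 :: complex poly)" by (simp add: one_pCons)
  hence "to_fract [:-1:] * r = - r" by (simp only: to_fract_uminus to_fract_1 mult_minus1)
  moreover have "rdeg_le (to_fract [:-1:] * r) (0 + n)" using r by (intro rdeg_le_mult rdeg_le_const)
  ultimately show ?thesis by simp
qed

lemma rdeg_le_diff: "rdeg_le r n \<Longrightarrow> rdeg_le s n \<Longrightarrow> rdeg_le (r - s) n"
  using rdeg_le_add[of r n "- s"] rdeg_le_uminus[of s n] by simp

text \<open>The numerator a' b - a b' has degree below deg a + deg b. Only a bound is possible,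
  since in degree 0 the drop can be larger.\<close>

lemma rdeg_le_deriv:
  assumes "rdeg_le r n"
  shows "rdeg_le (ratfun_deriv r) (n - 1)"
proof (cases "r = 0")
  case False
  then obtain a b where r: "r = Fract a b" "a \<noteq> 0" "b \<noteq> 0" by (metis nonzero_Fract_cases)
  have 1: "int (degree a) \<le> int (degree b) + n" using assms r by (simp add: rdeg_le_Fract)
  have "pderiv a * b - a * pderiv b = 0 \<or> degree (pderiv a * b - a * pderiv b) < degree a + degree b"
  proof (cases "degree a + degree b = 0")
    case True
    hence "pderiv a = 0" "pderiv b = 0" by (simp_all add: pderiv_eq_0_iff)
    thus ?thesis by simp
  next
    case False
    have "degree (pderiv a * b) < degree a + degree b"
    proof (cases "pderiv a = 0")
      case False
      hence "degree a > 0" by (simp add: pderiv_eq_0_iff)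
      moreover have "degree (pderiv a * b) \<le> degree a - 1 + degree b"
        using degree_mult_le[of "pderiv a" b] by (simp add: degree_pderiv)
      ultimately show ?thesis by linarith
    qed (use False in simp)
    moreover have "degree (a * pderiv b) < degree a + degree b"
    proof (cases "pderiv b = 0")
      case False
      hence "degree b > 0" by (simp add: pderiv_eq_0_iff)
      moreover have "degree (a * pderiv b) \<le> degree a + (degree b - 1)"
        using degree_mult_le[of a "pderiv b"] by (simp add: degree_pderiv)
      ultimately show ?thesis by linarith
    qed (use False in simp)
    ultimately show ?thesis using degree_diff_less by blast
  qed
  thus ?thesis using r 1
    by (simp add: ratfun_deriv_Fract rdeg_le_Fract degree_mult_eq) linarith
qed simp


section \<open>Airy equations over the rational functions\<close>

lemma ratfun_two: "(2 :: ratfun) = to_fract [:2:]"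
proof -
  have "[:2:] = (1 + 1 :: complex poly)" by (simp add: one_pCons)
  hence "to_fract [:2:] = (1 + 1 :: ratfun)" by (simp only: to_fract_add to_fract_1)
  thus ?thesis by simp
qed

lemma ratfun_four: "(4 :: ratfun) = to_fract [:4:]"
proof -
  have "[:4:] = (1 + 1 + 1 + 1 :: complex poly)" by (simp add: one_pCons)
  hence "to_fract [:4:] = (1 + 1 + 1 + 1 :: ratfun)" by (simp only: to_fract_add to_fract_1)
  thus ?thesis by simp
qed

text \<open>The square of a rational function has even degree.\<close>

lemma no_rational_riccati:
  assumes "u * u - ratfun_deriv u = to_fract [:a, 1:]"
  shows False
proof (cases "rdeg_le u 0")
  case True
  have "rdeg_le (u * u) 0" using rdeg_le_mult[OF True True] by simp
  moreover have "rdeg_le (ratfun_deriv u) 0"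
    using rdeg_le_deriv[OF True] by (rule rdeg_le_mono) simp
  ultimately have "rdeg_le (to_fract [:a, 1:]) 0" unfolding assms[symmetric] by (rule rdeg_le_diff)
  thus False by (simp add: rdeg_le_def rdeg_linear)
next
  case False
  hence u: "u \<noteq> 0" "rdeg u \<ge> 1" by (auto simp: rdeg_le_def)
  have eq: "u * u = ratfun_deriv u + to_fract [:a, 1:]" unfolding assms[symmetric] by simp
  have "rdeg_le (ratfun_deriv u) (rdeg u)"
    using rdeg_le_deriv[OF rdeg_le_refl] by (rule rdeg_le_mono) simp
  moreover have "rdeg_le (to_fract [:a, 1:]) (rdeg u)"
    using rdeg_le_linear by (rule rdeg_le_mono) (use u in simp)
  ultimately have "rdeg_le (u * u) (rdeg u)" unfolding eq by (rule rdeg_le_add)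
  \<comment> \<open>The left side of \<open>eq\<close> has twice the degree of \<open>u\<close>, the
    right side at most that degree, which is at least 1.\<close>
  thus False using u by (simp add: rdeg_le_def rdeg_mult)
qed

text \<open>The expression is the determinant of z = R Y + S Y' and z' in the basis Y, Y'. If it
  vanishes with S nonzero, dividing by S^2 gives a rational solution u = R / S of the Riccati
  equation.\<close>

lemma airy_irreducible:
  assumes "R * (R + ratfun_deriv S) - S * (ratfun_deriv R + S * to_fract [:a, 1:]) = 0"
  shows "R = 0 \<and> S = 0"
proof (cases "S = 0")
  case False
  define u where "u = R / S"
  have R: "R = u * S" using False by (simp add: u_def)
  have "R * (R + ratfun_deriv S) - S * (ratfun_deriv R + S * to_fract [:a, 1:])
      = S * S * (u * u - ratfun_deriv u - to_fract [:a, 1:])"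
    unfolding R ratfun_deriv_mult by (simp add: algebra_simps)
  hence "u * u - ratfun_deriv u = to_fract [:a, 1:]" using assms False by simp
  thus ?thesis using no_rational_riccati by blast
qed (use assms in simp)

text \<open>The two equations say that r Y + s Y' solves the Airy equation shifted by
  \<open>a\<close> whenever Y solves the one shifted by \<open>b\<close>. Since a - b is invertible,
  they lower any common degree bound of \<open>r\<close> and \<open>s\<close>, again and
  again.\<close>

lemma airy_no_intertwiner:
  assumes "a \<noteq> b"
    and 1: "ratfun_deriv (ratfun_deriv r) + 2 * ratfun_deriv s * to_fract [:b, 1:] + s
      = to_fract [:a - b:] * r"
    and 2: "ratfun_deriv (ratfun_deriv s) + 2 * ratfun_deriv r = to_fract [:a - b:] * s"
  shows "r = 0 \<and> s = 0"
proof -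
  have c: "rdeg_le t n" if "rdeg_le (to_fract [:a - b:] * t) n" for t n
  proof -
    have "[:1 / (a - b):] * [:a - b:] = 1" using assms(1) by (simp add: one_pCons)
    hence "to_fract [:1 / (a - b):] * to_fract [:a - b:] = 1" by (simp only: to_fract_1 flip: to_fract_mult)
    hence eq: "to_fract [:1 / (a - b):] * (to_fract [:a - b:] * t) = t"
      unfolding mult.assoc[symmetric] by (simp only: mult_1_left)
    from rdeg_le_mult[OF rdeg_le_const[of "1 / (a - b)"] that] show ?thesis unfolding eq by simp
  qed
  have d: "rdeg_le (2 * ratfun_deriv t) (n - 1)" if "rdeg_le t n" for t n
    using rdeg_le_mult[OF rdeg_le_const rdeg_le_deriv[OF that], of 2] by (simp add: ratfun_two)
  have dd: "rdeg_le (ratfun_deriv (ratfun_deriv t)) (n - 1)" if "rdeg_le t n" for t n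
    using rdeg_le_deriv[OF rdeg_le_deriv[OF that]] by (rule rdeg_le_mono) simp
  have step: "rdeg_le r (n - 1) \<and> rdeg_le s (n - 1)" if "rdeg_le r n \<and> rdeg_le s n" for n
  proof -
    \<comment> \<open>The bound for \<open>s\<close> must come first: the factor x + b in the
      equation for \<open>r\<close> raises the degree by one, and only the improved bound for s'
      compensates it.\<close>
    have s: "rdeg_le s (n - 1)"
      by (rule c, unfold 2[symmetric]) (use that in \<open>intro rdeg_le_add d dd; simp\<close>)
    have "rdeg_le (2 * ratfun_deriv s * to_fract [:b, 1:]) (n - 1)"
      using rdeg_le_mult[OF d[OF s] rdeg_le_linear] by simp
    moreover have "rdeg_le (ratfun_deriv (ratfun_deriv r)) (n - 1)" using that by (blast intro: dd)
    ultimately have "rdeg_le r (n - 1)"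
      using s by - (rule c, unfold 1[symmetric], intro rdeg_le_add; simp)
    thus ?thesis using s by blast
  qed
  define n where "n = max (rdeg r) (rdeg s)"
  have "rdeg_le r (n - int k) \<and> rdeg_le s (n - int k)" for k
  proof (induction k)
    case 0
    show ?case by (auto simp: n_def rdeg_le_def)
  next
    case (Suc k)
    moreover have "n - int (Suc k) = n - int k - 1" by simp
    ultimately show ?case using step[of "n - int k"] by metis
  qed
  hence le: "rdeg_le r (n - int k)" "rdeg_le s (n - int k)" for k by blast+
  have "t = 0" if "\<And>k. rdeg_le t (n - int k)" "rdeg t \<le> n" for t
  proof (rule ccontr)
    assume "t \<noteq> 0"
    hence "rdeg t \<le> n - int (nat (n - rdeg t + 1))" using that(1) unfolding rdeg_le_def by blast
    thus False using that(2) by linarith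
  qed
  thus ?thesis using le unfolding n_def by (meson max.cobounded1 max.cobounded2)
qed

text \<open>Multiplying the equation for \<open>s\<close> by \<open>s\<close> and integrating gives an identity in which
  \<open>(x + a) s\<^sup>2\<close>, of odd degree, has no partner.\<close>

lemma airy_endomorphism:
  assumes 1: "ratfun_deriv (ratfun_deriv r) + 2 * ratfun_deriv s * to_fract [:a, 1:] + s = 0"
    and 2: "ratfun_deriv (ratfun_deriv s) + 2 * ratfun_deriv r = 0"
  shows "s = 0 \<and> (\<exists>c. r = to_fract [:c:])"
proof -
  let ?D = ratfun_deriv and ?x = "to_fract [:a, 1:]"
  note two = ratfun_two and four = ratfun_four
  have D2 [simp]: "?D 2 = 0" "?D 4 = 0"
    unfolding two four by (subst ratfun_deriv_eq_0_iff, blast)+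
  have Dx: "?D ?x = 1"
    by (simp add: to_fract_def ratfun_deriv_Fract One_fract_def eq_fract pderiv_pCons)
  have Duminus: "?D (- t) = - ?D t" for t
    using ratfun_deriv_add[of t "- t"] by (simp add: eq_neg_iff_add_eq_0 add.commute)
  have Ddiff: "?D (t - u) = ?D t - ?D u" for t u
    using ratfun_deriv_add[of t "- u"] by (simp add: Duminus)
  \<comment> \<open>Eliminating \<open>r\<close> from the two equations leaves s''' = 4 (x + a) s' +
    2 s, the equation satisfied by products of two Airy solutions.\<close>
  have "?D (?D (?D s)) + 2 * ?D (?D r) = 0"
    using arg_cong[OF 2, of ?D] by (simp add: ratfun_deriv_add ratfun_deriv_mult)
  moreover have "?D (?D (?D s)) - (4 * ?D s * ?x + 2 * s)
      = (?D (?D (?D s)) + 2 * ?D (?D r)) - 2 * (?D (?D r) + 2 * ?D s * ?x + s)"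
    by (simp add: algebra_simps)
  ultimately have eq: "?D (?D (?D s)) = 4 * ?D s * ?x + 2 * s" by (simp add: 1)
  \<comment> \<open>The first integral of this third-order equation, found by multiplying it by 2 s:
    the left side 2 s s''' is the derivative of 2 s s'' - s'^2, the right side that of 4 (x + a)
    s^2.\<close>
  define t where "t = 4 * ?x * (s * s) - (2 * (s * ?D (?D s)) - ?D s * ?D s)"
  have "?D t = 4 * (s * s) + 8 * ?x * s * ?D s - 2 * s * ?D (?D (?D s))"
    unfolding t_def Ddiff ratfun_deriv_mult ratfun_deriv_add Dx D2 by (simp add: algebra_simps)
  also have "\<dots> = 0" unfolding eq by (simp add: algebra_simps)
  finally obtain c where c: "t = to_fract [:c:]" by (auto simp: ratfun_deriv_eq_0_iff)
  have s: "s = 0"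
  proof (rule ccontr)
    assume s: "s \<noteq> 0"
    define n where "n = rdeg s"
    have le: "rdeg_le s n" by (simp add: n_def)
    have lead: "to_fract [:4:] * ?x * (s * s) = to_fract [:c:] + (2 * (s * ?D (?D s)) - ?D s * ?D s)"
      using c by (simp add: t_def four algebra_simps)
    have rl: "rdeg (to_fract [:4:] * ?x * (s * s)) = 2 * n + 1"
      using s by (simp add: rdeg_mult rdeg_linear n_def) (simp add: to_fract_def rdeg_Fract)
    have nz: "to_fract [:4:] * ?x * (s * s) \<noteq> 0" using s by simp
    have low: "rdeg_le (2 * (s * ?D (?D s)) - ?D s * ?D s) (2 * n - 2)"
    proof (rule rdeg_le_diff)
      show "rdeg_le (2 * (s * ?D (?D s))) (2 * n - 2)"
        using rdeg_le_mult[OF rdeg_le_const rdeg_le_mult[OF le rdeg_le_deriv[OF rdeg_le_deriv[OF le]]], of 2]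
        by (simp add: two algebra_simps)
      show "rdeg_le (?D s * ?D s) (2 * n - 2)"
        using rdeg_le_mult[OF rdeg_le_deriv[OF le] rdeg_le_deriv[OF le]] by (simp add: algebra_simps)
    qed
    show False
    \<comment> \<open>The terms have degree 2n + 1, at most 2n - 2, and 0 for a nonzero constant.
      For n at least 0, or c = 0, the first has no partner; for negative n and nonzero c the
      constant has none.\<close>
    proof (cases "c = 0 \<or> n \<ge> 0")
      case True
      have "rdeg_le (to_fract [:c:]) (2 * n)"
        by (cases "c = 0") (use True in \<open>auto intro: rdeg_le_mono[OF rdeg_le_const]\<close>)
      hence "rdeg_le (to_fract [:4:] * ?x * (s * s)) (2 * n)"
        unfolding lead using low by (intro rdeg_le_add) (auto elim: rdeg_le_mono)
      thus False using rl nz by (simp add: rdeg_le_def)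
    next
      case False
      have eq: "to_fract [:c:] = to_fract [:4:] * ?x * (s * s) - (2 * (s * ?D (?D s)) - ?D s * ?D s)"
        using lead by (simp add: algebra_simps)
      have "rdeg_le (to_fract [:4:] * ?x * (s * s)) (-1)"
        using rl False by (simp add: rdeg_le_def)
      moreover have "rdeg_le (2 * (s * ?D (?D s)) - ?D s * ?D s) (-1)"
        using low by (rule rdeg_le_mono) (use False in simp)
      ultimately have "rdeg_le (to_fract [:c:]) (-1)" unfolding eq by (rule rdeg_le_diff)
      thus False using False by (simp add: to_fract_def rdeg_le_Fract)
    qed
  qed
  have "2 * ?D r = 0" using 2 s by simp
  moreover have "(2 :: ratfun) \<noteq> 0" by (simp add: two)
  ultimately have "?D r = 0" by simp
  thus ?thesis using s by (simp add: ratfun_deriv_eq_0_iff)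
qed

section \<open>Linear relations over C(x) among Airy solutions and their first derivatives\<close>

definition jet_comb ::
  "('i \<Rightarrow> complex fls) \<Rightarrow> 'i set \<Rightarrow> ('i \<Rightarrow> ratfun) \<Rightarrow> ('i \<Rightarrow> ratfun) \<Rightarrow> complex fls" where
  "jet_comb y I R S = (\<Sum>i\<in>I. ratfun_fls (R i) * y i + ratfun_fls (S i) * fls_deriv (y i))"

lemma jet_comb_add:
  "jet_comb y I R S + jet_comb y I R' S' = jet_comb y I (\<lambda>i. R i + R' i) (\<lambda>i. S i + S' i)"
  by (simp add: jet_comb_def ratfun_fls_add ring_distribs sum.distrib add_ac)

lemma jet_comb_mult:
  "ratfun_fls c * jet_comb y I R S = jet_comb y I (\<lambda>i. c * R i) (\<lambda>i. c * S i)"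
  by (simp add: jet_comb_def ratfun_fls_mult ring_distribs sum_distrib_left mult.assoc)

lemma jet_comb_deriv:
  assumes "\<forall>i\<in>I. fls_deriv (fls_deriv (y i)) = poly_fls [:a i, 1:] * y i"
  shows "fls_deriv (jet_comb y I R S) = jet_comb y I
    (\<lambda>i. ratfun_deriv (R i) + S i * to_fract [:a i, 1:]) (\<lambda>i. R i + ratfun_deriv (S i))"
  unfolding jet_comb_def fls_deriv_sum using assms
  by (intro sum.cong) (simp_all add: ratfun_fls_add ratfun_fls_mult ratfun_fls_deriv algebra_simps)

text \<open>The modules \<open>\<complex>(x) y\<^sub>i + \<complex>(x) y\<^sub>i'\<close> are irreducible, two of them have no nonzero homomorphism
  unless the \<open>a\<^sub>i\<close> agree, and then only the scalars. So a relation among them would come from a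
  relation with constant coefficients.\<close>

lemma airy_jets_independent:
  assumes "finite I"
    and "\<forall>i\<in>I. fls_deriv (fls_deriv (y i)) = poly_fls [:a i, 1:] * y i"
    and "\<And>b c. (\<Sum>i\<in>{i\<in>I. a i = b}. fls_const (c i) * y i) = 0 \<Longrightarrow> \<forall>i\<in>I. a i = b \<longrightarrow> c i = 0"
    and "jet_comb y I R S = 0"
  shows "\<forall>i\<in>I. R i = 0 \<and> S i = 0"
  using assms
proof (induction I arbitrary: R S rule: finite_induct)
  case (insert k F)
  let ?x = "\<lambda>i. to_fract [:a i, 1:]"
  have odeF: "\<forall>i\<in>F. fls_deriv (fls_deriv (y i)) = poly_fls [:a i, 1:] * y i"
    and odek: "fls_deriv (fls_deriv (y k)) = poly_fls [:a k, 1:] * y k"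
    using insert.prems(1) by auto
  have indF: "\<forall>i\<in>F. a i = b \<longrightarrow> c i = 0"
    if "(\<Sum>i\<in>{i\<in>F. a i = b}. fls_const (c i) * y i) = 0" for b c
  proof -
    define c' where "c' = c(k := 0)"
    have "(\<Sum>i\<in>{i\<in>insert k F. a i = b}. fls_const (c' i) * y i)
        = (\<Sum>i\<in>{i\<in>F. a i = b}. fls_const (c' i) * y i)"
      using insert.hyps by (intro sum.mono_neutral_right) (auto simp: c'_def)
    also have "\<dots> = (\<Sum>i\<in>{i\<in>F. a i = b}. fls_const (c i) * y i)"
      using insert.hyps by (intro sum.cong) (auto simp: c'_def)
    finally have "\<forall>i\<in>insert k F. a i = b \<longrightarrow> c' i = 0" using insert.prems(2)[where b = b and c = c'] that by simp
    thus ?thesis using insert.hyps by (auto simp: c'_def split: if_splits)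
  qed
  have IH: "\<forall>i\<in>F. R i = 0 \<and> S i = 0" if "jet_comb y F R S = 0" for R S
    by (rule insert.IH[OF odeF _ that]) (rule indF)
  define z where "z = jet_comb y {k} R S"
  have z: "z + jet_comb y F R S = 0"
    using insert.prems(3) insert.hyps by (simp add: z_def jet_comb_def)
  have Rk: "R k = 0 \<and> S k = 0"
  proof (rule ccontr)
    assume nz: "\<not> (R k = 0 \<and> S k = 0)"
    define P where "P = ratfun_deriv (R k) + S k * ?x k"
    define Q where "Q = R k + ratfun_deriv (S k)"
    \<comment> \<open>The determinant of (z, z') with respect to the jets of \<open>y k\<close>; it
      is nonzero by irreducibility.\<close>
    define E where "E = R k * Q - S k * P"
    have E: "E \<noteq> 0" using airy_irreducible[of "R k" "S k" "a k"] nz by (auto simp: E_def P_def Q_def)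
    have z1: "z = ratfun_fls (R k) * y k + ratfun_fls (S k) * fls_deriv (y k)"
      by (simp add: z_def jet_comb_def)
    have z2: "fls_deriv z = ratfun_fls P * y k + ratfun_fls Q * fls_deriv (y k)"
      unfolding z_def by (subst jet_comb_deriv[where a = a])
        (use odek in \<open>auto simp: jet_comb_def P_def Q_def\<close>)
    have zF: "z = jet_comb y F (\<lambda>i. (-1) * R i) (\<lambda>i. (-1) * S i)"
    proof -
      have "ratfun_fls (-1) * jet_comb y F R S = z"
        using z by (simp add: ratfun_fls_uminus add_eq_0_iff)
      thus ?thesis unfolding jet_comb_mult by simp
    qed
    \<comment> \<open>Cramer's rule recovers \<open>y k\<close> from z and z'. As z is also a
      combination over \<open>F\<close>, so is \<open>y k\<close>.\<close>
    have "ratfun_fls (1 / E) * (ratfun_fls Q * z + ratfun_fls (- S k) * fls_deriv z)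
        = ratfun_fls (1 / E) * ratfun_fls E * y k"
      unfolding z2 unfolding z1 E_def ratfun_fls_diff ratfun_fls_mult ratfun_fls_uminus by (simp add: algebra_simps)
    also have "ratfun_fls (1 / E) * ratfun_fls E = 1"
      using E by (simp flip: ratfun_fls_mult)
    finally have yk: "y k = ratfun_fls (1 / E) * (ratfun_fls Q * z + ratfun_fls (- S k) * fls_deriv z)"
      by simp
    have "\<exists>R' S'. y k = jet_comb y F R' S'"
      unfolding yk zF jet_comb_deriv[OF odeF] jet_comb_mult jet_comb_add by blast
    then obtain r s where rs: "y k = jet_comb y F r s" by blast
    \<comment> \<open>The Airy equation of \<open>y k\<close> becomes a relation over
      \<open>F\<close>, whose coefficients vanish by induction; these are the intertwiner equations
      for each pair (r i, s i).\<close>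
    have "0 = fls_deriv (fls_deriv (y k)) + ratfun_fls (- ?x k) * y k"
      by (simp add: odek ratfun_fls_uminus)
    also have "\<dots> = jet_comb y F
        (\<lambda>i. ratfun_deriv (ratfun_deriv (r i) + s i * ?x i) + (r i + ratfun_deriv (s i)) * ?x i
            + (- ?x k) * r i)
        (\<lambda>i. ratfun_deriv (r i) + s i * ?x i + ratfun_deriv (r i + ratfun_deriv (s i)) + (- ?x k) * s i)"
      unfolding rs jet_comb_deriv[OF odeF] jet_comb_mult jet_comb_add ..
    finally have "0 = \<dots>" .
    note rel = this[symmetric]
    have eqs: "\<forall>i\<in>F.
        ratfun_deriv (ratfun_deriv (r i) + s i * ?x i) + (r i + ratfun_deriv (s i)) * ?x i
            + (- ?x k) * r i = 0 \<and>
        ratfun_deriv (r i) + s i * ?x i + ratfun_deriv (r i + ratfun_deriv (s i)) + (- ?x k) * s i = 0"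
      using IH[OF rel] .
    have Dx: "ratfun_deriv (?x i) = 1" for i
      by (simp add: to_fract_def ratfun_deriv_Fract One_fract_def eq_fract pderiv_pCons)
    have e1: "ratfun_deriv (ratfun_deriv (r i)) + 2 * ratfun_deriv (s i) * ?x i + s i
          = (?x k - ?x i) * r i" if "i \<in> F" for i
    proof -
      have "ratfun_deriv (ratfun_deriv (r i)) + 2 * ratfun_deriv (s i) * ?x i + s i - (?x k - ?x i) * r i
        = ratfun_deriv (ratfun_deriv (r i) + s i * ?x i) + (r i + ratfun_deriv (s i)) * ?x i
            + (- ?x k) * r i"
        unfolding ratfun_deriv_add ratfun_deriv_mult Dx by (simp add: algebra_simps)
      thus ?thesis using bspec[OF eqs that] by simp
    qed
    have e2: "ratfun_deriv (ratfun_deriv (s i)) + 2 * ratfun_deriv (r i) = (?x k - ?x i) * s i"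
      if "i \<in> F" for i
    proof -
      have "ratfun_deriv (ratfun_deriv (s i)) + 2 * ratfun_deriv (r i) - (?x k - ?x i) * s i
        = ratfun_deriv (r i) + s i * ?x i + ratfun_deriv (r i + ratfun_deriv (s i)) + (- ?x k) * s i"
        unfolding ratfun_deriv_add by (simp add: algebra_simps)
      also have "\<dots> = 0" using bspec[OF eqs that] by (rule conjunct2)
      finally show ?thesis by (simp only: right_minus_eq)
    qed
    have xd: "?x k - ?x i = to_fract [:a k - a i:]" for i by (simp flip: to_fract_diff)
    have ne: "r i = 0 \<and> s i = 0" if "i \<in> F" "a i \<noteq> a k" for i
      using airy_no_intertwiner[of "a k" "a i" "r i" "s i"] e1[OF that(1)] e2[OF that(1)] that(2)
      by (auto simp: xd)
    have "\<exists>c. s i = 0 \<and> r i = to_fract [:c:]" if "i \<in> F" "a i = a k" for i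
      using airy_endomorphism[of "r i" "s i" "a i"] e1[OF that(1)] e2[OF that(1)] that(2) by auto
    then obtain c where c: "\<And>i. i \<in> F \<Longrightarrow> a i = a k \<Longrightarrow> s i = 0 \<and> r i = to_fract [:c i:]" by metis
    have "y k = (\<Sum>i\<in>{i\<in>F. a i = a k}. ratfun_fls (r i) * y i + ratfun_fls (s i) * fls_deriv (y i))"
      unfolding rs jet_comb_def using insert.hyps ne by (intro sum.mono_neutral_right) auto
    also have "\<dots> = (\<Sum>i\<in>{i\<in>F. a i = a k}. fls_const (c i) * y i)"
      using c by (intro sum.cong) (auto simp: poly_fls_const)
    finally have yk': "y k = \<dots>" .
    define c' where "c' = c(k := -1)"
    have "{i\<in>insert k F. a i = a k} = insert k {i\<in>F. a i = a k}" by auto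
    hence "(\<Sum>i\<in>{i\<in>insert k F. a i = a k}. fls_const (c' i) * y i)
        = - y k + (\<Sum>i\<in>{i\<in>F. a i = a k}. fls_const (c' i) * y i)"
      using insert.hyps by (simp add: c'_def)
    also have "(\<Sum>i\<in>{i\<in>F. a i = a k}. fls_const (c' i) * y i) = y k"
      unfolding yk' using insert.hyps by (intro sum.cong) (auto simp: c'_def)
    finally have "(\<Sum>i\<in>{i\<in>insert k F. a i = a k}. fls_const (c' i) * y i) = 0" by simp
    from insert.prems(2)[OF this] have "c' k = 0" by blast
    thus False by (simp add: c'_def)
  qed
  hence "z = 0" by (simp add: z_def jet_comb_def)
  hence "\<forall>i\<in>F. R i = 0 \<and> S i = 0" using IH[of R S] z by simp
  thus ?case using Rk by simp
qed simp

section \<open>Polynomials in the Airy operator\<close>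

abbreviation const_op :: "complex \<Rightarrow> diffop" where
  "const_op c \<equiv> mult_op (to_fract [:c:])"

lemma const_op_commute: "const_op c * P = P * const_op c"
proof (induction P rule: diffop_induct)
  case D_op
  have "ratfun_deriv (to_fract [:c:]) = 0" by (subst ratfun_deriv_eq_0_iff) blast
  thus ?case by (simp add: D_op_mult_op)
next
  case (mult A B)
  thus ?case by (metis mult.assoc)
qed (simp_all add: ring_distribs mult.commute flip: mult_op_mult)

lemma op_act_const_op: "op_act (const_op c) f = fls_const c * f"
  by (simp add: poly_fls_const)

lemma poly_at_diffop_upto:
  assumes "degree p \<le> n"
  shows "poly_at_diffop p A = (\<Sum>i\<le>n. const_op (coeff p i) * A ^ i)"
  unfolding poly_at_diffop_def
  using assms by (intro sum.mono_neutral_left) (auto simp: coeff_eq_0)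

lemma poly_at_diffop_0 [simp]: "poly_at_diffop 0 A = 0"
  by (simp add: poly_at_diffop_def)

lemma const_op_add: "const_op (c + e) = const_op c + const_op e"
  by (simp flip: mult_op_add to_fract_add)

lemma const_op_mult: "const_op (c * e) = const_op c * const_op e"
proof -
  have "[:c * e:] = [:c:] * [:e:]" by simp
  thus ?thesis by (simp only: to_fract_mult mult_op_mult)
qed

lemma poly_at_diffop_add: "poly_at_diffop (p + q) A = poly_at_diffop p A + poly_at_diffop q A"
proof -
  define n where "n = max (degree p) (degree q)"
  have "degree p \<le> n" "degree q \<le> n" "degree (p + q) \<le> n"
    by (auto simp: n_def intro: degree_add_le_max)
  thus ?thesis
    by (simp add: poly_at_diffop_upto[of _ n] const_op_add ring_distribs sum.distrib)
qed

lemma poly_at_diffop_pCons: "poly_at_diffop (pCons c p) A = const_op c + A * poly_at_diffop p A"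
proof -
  have "poly_at_diffop (pCons c p) A = (\<Sum>i\<le>Suc (degree p). const_op (coeff (pCons c p) i) * A ^ i)"
    by (rule poly_at_diffop_upto) (rule degree_pCons_le)
  also have "\<dots> = const_op c + (\<Sum>i\<le>degree p. const_op (coeff p i) * (A * A ^ i))"
    by (subst sum.atMost_Suc_shift) simp
  also have "(\<Sum>i\<le>degree p. const_op (coeff p i) * (A * A ^ i)) = A * poly_at_diffop p A"
    by (simp add: poly_at_diffop_def sum_distrib_left const_op_commute[of _ A] flip: mult.assoc)
  finally show ?thesis .
qed

lemma poly_at_diffop_smult: "poly_at_diffop (Polynomial.smult c p) A = const_op c * poly_at_diffop p A"
proof (induction p)
  case (pCons e p)
  thus ?case
    by (simp add: poly_at_diffop_pCons const_op_mult ring_distribs const_op_commute[of c A]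
        flip: mult.assoc)
qed simp

lemma poly_at_diffop_mult: "poly_at_diffop (p * q) A = poly_at_diffop p A * poly_at_diffop q A"
  by (induction p) (simp_all add: poly_at_diffop_pCons poly_at_diffop_add poly_at_diffop_smult
      ring_distribs mult.assoc)

lemma poly_at_diffop_1 [simp]: "poly_at_diffop 1 A = 1"
  by (simp add: one_pCons poly_at_diffop_pCons) (simp flip: one_pCons)

lemma poly_at_diffop_power: "poly_at_diffop (p ^ n) A = poly_at_diffop p A ^ n"
  by (induction n) (simp_all add: poly_at_diffop_mult)

lemma poly_at_diffop_linear: "poly_at_diffop [:- a, 1:] A = A - const_op a"
  using const_op_add[of a "- a"]
  by (simp add: poly_at_diffop_pCons) (simp add: eq_neg_iff_add_eq_0 add.commute flip: one_pCons)

text \<open>The adjoint reverses products, but powers of \<open>A\<close> commute and constants are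
  unchanged because there is no conjugation.\<close>

lemma formal_adjoint_poly_at:
  assumes "formal_adjoint A = A"
  shows "formal_adjoint (poly_at_diffop p A) = poly_at_diffop p A"
proof (induction p)
  case (pCons c p)
  have "poly_at_diffop p A * A = A * poly_at_diffop p A"
    using poly_at_diffop_mult[of p "[:0, 1:]" A] poly_at_diffop_mult[of "[:0, 1:]" p A]
      poly_at_diffop_linear[of 0 A] by (simp add: mult.commute)
  thus ?case
    using pCons assms by (simp add: poly_at_diffop_pCons formal_adjoint_add formal_adjoint_mult)
qed simp

lemma formal_adjoint_Airy_op: "formal_adjoint Airy_op = Airy_op"
  by (simp add: Airy_op_def formal_adjoint_diff formal_adjoint_power)

lemma op_lead_Airy_linear:
  "op_lead (poly_at_diffop [:- a, 1:] Airy_op) = 1"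
  "diffop_order (poly_at_diffop [:- a, 1:] Airy_op) = 2"
proof -
  have c: "coeffs_of_diffop (poly_at_diffop [:- a, 1:] Airy_op) = [:- to_fract [:0, 1:] - to_fract [:a:], 0, 1:]"
    by (simp add: poly_at_diffop_linear Airy_op_def minus_diffop.rep_eq coeffs_of_D_op_pow coeffs_of_mult_op)
      (simp add: numeral_2_eq_2 monom_Suc monom_0 one_pCons)
  show "diffop_order (poly_at_diffop [:- a, 1:] Airy_op) = 2" by (simp add: diffop_order_def c)
  thus "op_lead (poly_at_diffop [:- a, 1:] Airy_op) = 1"
    by (simp add: op_lead_def diffop_coeff_def c numeral_2_eq_2)
qed

lemma op_lead_power: "op_lead (P ^ n) = op_lead P ^ n"
  by (induction n) (use op_lead_mult_op[of 1] in \<open>simp_all add: op_lead_mult\<close>)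

lemma order_power: "P \<noteq> 0 \<Longrightarrow> diffop_order (P ^ n) = n * diffop_order P"
  by (induction n) (use order_mult_op[of 1] in \<open>simp_all add: order_mult\<close>)

lemma op_Airy_monic:
  assumes "finite K"
  shows "op_lead (poly_at_diffop (\<Prod>k\<in>K. [:- a k, 1:] ^ e k) Airy_op) = 1 \<and>
    diffop_order (poly_at_diffop (\<Prod>k\<in>K. [:- a k, 1:] ^ e k) Airy_op) = 2 * (\<Sum>k\<in>K. e k)"
  using assms
proof (induction K rule: finite_induct)
  case empty
  show ?case using op_lead_mult_op[of 1] order_mult_op[of 1] by simp
next
  case (insert k K)
  let ?A = "poly_at_diffop [:- a k, 1:] Airy_op"
    and ?B = "poly_at_diffop (\<Prod>k\<in>K. [:- a k, 1:] ^ e k) Airy_op"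
  have nz: "?A \<noteq> 0" "?B \<noteq> 0"
    using op_lead_Airy_linear(1)[of "a k"] insert.IH op_lead_eq_0_iff by (metis zero_neq_one)+
  have "poly_at_diffop (\<Prod>k\<in>insert k K. [:- a k, 1:] ^ e k) Airy_op = ?A ^ e k * ?B"
    using insert.hyps by (simp add: poly_at_diffop_mult poly_at_diffop_power)
  thus ?case using nz insert op_lead_Airy_linear[of "a k"]
    by (simp add: op_lead_mult op_lead_power order_mult order_power)
qed

section \<open>Generalized eigenfunctions of the Airy operator\<close>

text \<open>Equivalently, \<open>Y\<close> is an eigenfunction of \<open>Airy_op\<close> with
  eigenvalue \<open>a\<close>.\<close>

definition airy_ode :: "complex \<Rightarrow> complex fls \<Rightarrow> bool" where
  "airy_ode a Y \<longleftrightarrow> fls_deriv (fls_deriv Y) = poly_fls [:a, 1:] * Y"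

text \<open>The negative of the usual Wronskian; with this sign it is the concomitant of
  D^2.\<close>

definition wr :: "complex fls \<Rightarrow> complex fls \<Rightarrow> complex fls" where
  "wr f g = fls_deriv f * g - f * fls_deriv g"

text \<open>Differentiating Y'' = (x + a) Y produces one extra term, from the derivative 1 of x + a.
  At m = 0 the truncated \<open>m - 1\<close> is harmless, because its weight is 0.\<close>

lemma airy_ode_pow:
  assumes "airy_ode a Y"
  shows "(fls_deriv ^^ (m + 2)) Y
    = poly_fls [:a, 1:] * (fls_deriv ^^ m) Y + of_nat m * (fls_deriv ^^ (m - 1)) Y"
proof (induction m)
  case 0
  show ?case using assms by (simp add: airy_ode_def numeral_2_eq_2)
next
  case (Suc m)
  have "fls_deriv (poly_fls [:a, 1:]) = 1" by (simp add: pderiv_pCons flip: poly_fls_pderiv one_pCons)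
  moreover have "of_nat m * fls_deriv ((fls_deriv ^^ (m - 1)) Y) = of_nat m * (fls_deriv ^^ m) Y"
    by (cases m) simp_all
  ultimately show ?case using arg_cong[OF Suc, of fls_deriv] by (simp add: algebra_simps)
qed

text \<open>L - a is a lowering operator on derivatives of \<open>Y\<close>, acting as d/dz does on
  monomials. The derivatives thus form the Jordan chains of the eigenvalue.\<close>

lemma op_act_Airy_linear:
  assumes "airy_ode a Y"
  shows "op_act (poly_at_diffop [:- a, 1:] Airy_op) ((fls_deriv ^^ m) Y)
    = of_nat m * (fls_deriv ^^ (m - 1)) Y"
proof -
  have "poly_fls [:a, 1:] = poly_fls [:0, 1:] + fls_const a"
    by (simp flip: poly_fls_add poly_fls_const)
  thus ?thesis using airy_ode_pow[OF assms, of m]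
    by (simp add: poly_at_diffop_linear Airy_op_def op_act_const_op algebra_simps funpow_add
        del: op_act_mult_op) (simp add: numeral_2_eq_2)
qed

lemma op_act_Airy_linear_pow:
  assumes "airy_ode a Y"
  shows "op_act (poly_at_diffop [:- a, 1:] Airy_op ^ i) ((fls_deriv ^^ m) Y)
    = (if i \<le> m then fls_const (fact m / fact (m - i)) * (fls_deriv ^^ (m - i)) Y else 0)"
proof (induction i)
  case (Suc i)
  let ?A = "poly_at_diffop [:- a, 1:] Airy_op"
  have "op_act (?A ^ Suc i) ((fls_deriv ^^ m) Y) = op_act ?A (op_act (?A ^ i) ((fls_deriv ^^ m) Y))"
    by simp
  also have "\<dots> = (if Suc i \<le> m then fls_const (fact m / fact (m - Suc i)) *
      (fls_deriv ^^ (m - Suc i)) Y else 0)"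
  proof (cases "Suc i \<le> m")
    case True
    then obtain j where j: "m - i = Suc j" "m - Suc i = j" by (metis Suc_diff_Suc Suc_le_lessD)
    have "of_nat (Suc j) = fls_const (of_nat (Suc j) :: complex)" by (rule fls_of_nat)
    hence "op_act ?A (op_act (?A ^ i) ((fls_deriv ^^ m) Y))
        = fls_const (fact m / fact (Suc j)) * (fls_const (of_nat (Suc j)) * (fls_deriv ^^ j) Y)"
      using True j Suc op_act_Airy_linear[OF assms, of "Suc j"] by (simp add: op_act_const)
    also have "\<dots> = fls_const (fact m / fact (Suc j) * of_nat (Suc j)) * (fls_deriv ^^ j) Y"
      by (simp only: fls_const_mult_const mult.assoc[symmetric])
    also have "fact m / fact (Suc j) * of_nat (Suc j) = (fact m / fact j :: complex)"
      by (simp only: fact_Suc) (simp add: field_simps del: of_nat_Suc)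
    finally show ?thesis using True j by simp
  next
    case False
    thus ?thesis using Suc op_act_Airy_linear[OF assms, of 0] by (auto simp: op_act_const)
  qed
  finally show ?case .
qed simp

lemma concomitant_Airy_linear:
  "concomitant (poly_at_diffop [:- a, 1:] Airy_op) f g = wr f g"
proof -
  have u: "concomitant (P - Q) f g = concomitant P f g - concomitant Q f g" for P Q
    using concomitant_add_op[of "P - Q" Q f g] by simp
  have "concomitant (D_op ^ 2) f g = wr f g"
    using concomitant_monom[of 1 2 f g] by (simp add: numeral_2_eq_2 wr_def)
  thus ?thesis by (simp add: poly_at_diffop_linear Airy_op_def u)
qed

text \<open>The composition rule peels off one self-adjoint factor at a time, and a single factor L
  - a contributes \<open>wr\<close>.\<close>

lemma concomitant_Airy_pow:
  defines "A a \<equiv> poly_at_diffop [:- a, 1:] Airy_op"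
  shows "concomitant (A a ^ n) f g = (\<Sum>i<n. wr (op_act (A a ^ i) f) (op_act (A a ^ (n - 1 - i)) g))"
proof (induction n arbitrary: f)
  case 0
  show ?case using concomitant_mult_op[of 1 f g] by simp
next
  case (Suc n)
  have adj: "formal_adjoint (A a ^ n) = A a ^ n"
    unfolding A_def formal_adjoint_power by (simp add: formal_adjoint_poly_at formal_adjoint_Airy_op)
  have "concomitant (A a ^ Suc n) f g
      = concomitant (A a ^ n) (op_act (A a) f) g + wr f (op_act (A a ^ n) g)"
    unfolding power_Suc2 concomitant_mult adj by (simp add: A_def concomitant_Airy_linear)
  also have "concomitant (A a ^ n) (op_act (A a) f) g
      = (\<Sum>i<n. wr (op_act (A a ^ Suc i) f) (op_act (A a ^ (n - 1 - i)) g))"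
    unfolding Suc power_Suc2 by simp
  finally show ?case by (subst sum.lessThan_Suc_shift) (simp add: add.commute)
qed

text \<open>Only the product rule of the double sequence is used, so the formula applies to
  \<open>wr\<close> of i-th and j-th derivatives.\<close>

lemma leibniz_deriv_pow:
  fixes B :: "nat \<Rightarrow> nat \<Rightarrow> complex fls"
  assumes "\<And>i j. fls_deriv (B i j) = B (Suc i) j + B i (Suc j)"
  shows "(fls_deriv ^^ K) (B 0 0) = (\<Sum>i\<le>K. of_nat (K choose i) * B i (K - i))"
proof (induction K)
  case (Suc K)
  have "(fls_deriv ^^ Suc K) (B 0 0)
      = (\<Sum>i\<le>K. of_nat (K choose i) * B (Suc i) (K - i)) + (\<Sum>i\<le>K. of_nat (K choose i) * B i (Suc K - i))"
    by (simp add: Suc fls_deriv_sum assms ring_distribs sum.distrib Suc_diff_le cong: sum.cong_simp)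
  also have "(\<Sum>i\<le>K. of_nat (K choose i) * B i (Suc K - i)) = (\<Sum>i\<le>Suc K. of_nat (K choose i) * B i (Suc K - i))"
    by simp
  also have "\<dots> = B 0 (Suc K) + (\<Sum>i\<le>K. of_nat (K choose Suc i) * B (Suc i) (K - i))"
    by (subst sum.atMost_Suc_shift) simp
  also have "(\<Sum>i\<le>K. of_nat (K choose i) * B (Suc i) (K - i)) + \<dots>
      = B 0 (Suc K) + (\<Sum>i\<le>K. of_nat (Suc K choose Suc i) * B (Suc i) (K - i))"
    by (simp add: ring_distribs sum.distrib add_ac)
  also have "\<dots> = (\<Sum>i\<le>Suc K. of_nat (Suc K choose i) * B i (Suc K - i))"
    by (subst sum.atMost_Suc_shift) simp
  finally show ?case .
qed simp

lemma fls_deriv_wr: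
  assumes "airy_ode a Y" "airy_ode a Z"
  shows "fls_deriv (wr Y Z) = 0"
  using assms by (simp add: wr_def airy_ode_def)

lemma wr_const_left: "wr (fls_const c * f) g = fls_const c * wr f g"
  and wr_const_right: "wr f (fls_const c * g) = fls_const c * wr f g"
  by (simp_all add: wr_def algebra_simps)

text \<open>Only the values with \<open>m + n = N - 1\<close> survive, because the other sums are higher
  derivatives of the constant Wronskian.\<close>

lemma concomitant_Airy_pow_eigen:
  assumes "airy_ode a Y" "airy_ode a Z" "m < N" "n < N"
  shows "concomitant (poly_at_diffop [:- a, 1:] Airy_op ^ N) ((fls_deriv ^^ m) Y) ((fls_deriv ^^ n) Z)
    = (if m + n = N - 1 then fls_const (fact m * fact n) * wr Y Z else 0)"
proof -
  let ?A = "poly_at_diffop [:- a, 1:] Airy_op"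
  let ?Y = "\<lambda>m. (fls_deriv ^^ m) Y" and ?Z = "\<lambda>n. (fls_deriv ^^ n) Z"
  define t where "t = (\<lambda>i. wr (op_act (?A ^ i) (?Y m)) (op_act (?A ^ (N - 1 - i)) (?Z n)))"
  have sum: "concomitant (?A ^ N) (?Y m) (?Z n) = (\<Sum>i<N. t i)"
    by (simp add: concomitant_Airy_pow t_def)
  show ?thesis
  proof (cases "m + n < N - 1")
    case True
    have "t i = 0" if "i < N" for i
    proof (cases "i \<le> m")
      case True': True
      hence "\<not> N - 1 - i \<le> n" using True by linarith
      thus ?thesis by (simp add: t_def op_act_Airy_linear_pow assms wr_def)
    qed (simp add: t_def op_act_Airy_linear_pow assms wr_def)
    thus ?thesis using True by (simp add: sum)
  next
    case False
    \<comment> \<open>The summand i is nonzero only if i is at most m and N - 1 - i at most n, that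
      is, for i from m - K to m. Writing i = m - j turns its factorials into binomial
      weights.\<close>
    define K where "K = m + n - (N - 1)"
    have K: "K \<le> m" "K \<le> n" using assms(3,4) by (simp_all add: K_def)
    have tK: "t (m - j) = fls_const (fact m * fact n / fact K) * (of_nat (K choose j) * wr (?Y j) (?Z (K - j)))"
      if "j \<le> K" for j
    proof -
      have e: "N - 1 - (m - j) \<le> n" "n - (N - 1 - (m - j)) = K - j" "m - (m - j) = j"
        using False K that assms(3,4) by (auto simp: K_def)
      have "t (m - j) = fls_const (fact m / fact j) * (fls_const (fact n / fact (K - j)) * wr (?Y j) (?Z (K - j)))"
        using e that by (simp add: t_def op_act_Airy_linear_pow assms wr_const_left wr_const_right)
      also have "\<dots> = fls_const (fact m / fact j * (fact n / fact (K - j))) * wr (?Y j) (?Z (K - j))"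
        by (simp only: fls_const_mult_const mult.assoc[symmetric])
      also have "fact m / fact j * (fact n / fact (K - j))
          = (fact m * fact n / fact K * of_nat (K choose j) :: complex)"
        using that by (simp add: binomial_fact field_simps)
      finally show ?thesis by (simp only: fls_of_nat fls_const_mult_const mult.assoc[symmetric])
    qed
    have "(\<Sum>i<N. t i) = (\<Sum>i\<in>{m-K..m}. t i)"
    proof (rule sum.mono_neutral_right)
      show "{m-K..m} \<subseteq> {..<N}" using assms(3) by auto
      show "\<forall>i\<in>{..<N} - {m-K..m}. t i = 0"
      proof
        fix i assume "i \<in> {..<N} - {m-K..m}"
        hence "\<not> i \<le> m \<or> \<not> N - 1 - i \<le> n" using False K assms(3,4) by (auto simp: K_def)
        thus "t i = 0" by (auto simp: t_def op_act_Airy_linear_pow assms wr_def)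
      qed
    qed simp
    also have "\<dots> = (\<Sum>j\<le>K. t (m - j))"
      by (rule sum.reindex_bij_witness[of _ "\<lambda>j. m - j" "\<lambda>i. m - i"]) (use K in auto)
    \<comment> \<open>The weighted sum is the Leibniz expansion of the K-th derivative of the
      constant \<open>wr Y Z\<close>, so it survives only for K = 0.\<close>
    also have "\<dots> = fls_const (fact m * fact n / fact K) * (fls_deriv ^^ K) (wr Y Z)"
    proof -
      have "fls_deriv (wr (?Y i) (?Z j)) = wr (?Y (Suc i)) (?Z j) + wr (?Y i) (?Z (Suc j))" for i j
        by (simp add: wr_def)
      from leibniz_deriv_pow[of "\<lambda>i j. wr (?Y i) (?Z j)", OF this]
      have "(fls_deriv ^^ K) (wr Y Z) = (\<Sum>j\<le>K. of_nat (K choose j) * wr (?Y j) (?Z (K - j)))" by simp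
      thus ?thesis using tK by (simp add: sum_distrib_left)
    qed
    also have "\<dots> = (if m + n = N - 1 then fls_const (fact m * fact n) * wr Y Z else 0)"
    proof (cases K)
      case 0
      thus ?thesis using False by (auto simp: K_def)
    next
      case (Suc K')
      have "(fls_deriv ^^ Suc k) (wr Y Z) = 0" for k
        using fls_deriv_wr[OF assms(1,2)] by (simp del: funpow.simps add: funpow_Suc_right)
      thus ?thesis using Suc by (auto simp: K_def)
    qed
    finally show ?thesis by (simp add: sum)
  qed
qed

text \<open>Leibniz' rule for z p(z) at z = a. It is the same recursion as for L = a + (L - a)
  acting on derivatives of an eigenfunction, which lets \<open>op_act_Airy_poly\<close> be proved by
  induction on the polynomial.\<close>

lemma pderiv_pow_pCons:
  "poly ((pderiv ^^ t) (pCons c p)) a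
   = (if t = 0 then c else 0) + a * poly ((pderiv ^^ t) p) a + of_nat t * poly ((pderiv ^^ (t - 1)) p) a"
proof -
  have "(pderiv ^^ t) (pCons 0 p) = pCons 0 ((pderiv ^^ t) p) + of_nat t * (pderiv ^^ (t - 1)) p"
  proof (induction t)
    case (Suc t)
    have "of_nat t * pderiv ((pderiv ^^ (t - 1)) p) = of_nat t * (pderiv ^^ t) p"
      by (cases t) simp_all
    thus ?case using Suc by (simp add: pderiv_add pderiv_pCons pderiv_mult algebra_simps)
  qed simp
  moreover have "pCons c p = [:c:] + pCons 0 p" by simp
  moreover have "(pderiv ^^ t) ([:c:] + q) = (if t = 0 then [:c:] else 0) + (pderiv ^^ t) q" for q
    by (induction t) (simp_all add: pderiv_add pderiv_pCons)
  ultimately show ?thesis by (simp del: add_pCons)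
qed

text \<open>Taylor expansion of T at a: (L - a)^t / t! sends the n-th derivative of Y to (n choose
  t) times the (n-t)-th.\<close>

lemma op_act_Airy_poly:
  assumes "airy_ode a Y"
  shows "op_act (poly_at_diffop T Airy_op) ((fls_deriv ^^ n) Y)
    = (\<Sum>t\<le>n. fls_const (of_nat (n choose t) * poly ((pderiv ^^ t) T) a) * (fls_deriv ^^ (n - t)) Y)"
proof (induction T)
  case 0
  have "(pderiv ^^ t) 0 = (0 :: complex poly)" for t by (induction t) simp_all
  thus ?case by simp
next
  case (pCons c T)
  let ?Y = "\<lambda>m. (fls_deriv ^^ m) Y"
  define d where "d = (\<lambda>t. poly ((pderiv ^^ t) T) a)"
  have L: "op_act Airy_op (?Y m) = fls_const a * ?Y m + fls_const (of_nat m) * ?Y (m - 1)" for m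
    using op_act_Airy_linear[OF assms, of m]
    by (simp add: poly_at_diffop_linear op_act_const_op fls_of_nat algebra_simps del: op_act_mult_op)
  have "op_act (poly_at_diffop (pCons c T) Airy_op) (?Y n)
      = fls_const c * ?Y n + (\<Sum>t\<le>n. fls_const (of_nat (n choose t) * d t) * op_act Airy_op (?Y (n - t)))"
    by (simp add: poly_at_diffop_pCons op_act_const_op pCons op_act_fsum op_act_const d_def
        del: op_act_mult_op)
  also have "\<dots> = fls_const c * ?Y n + ((\<Sum>t\<le>n. fls_const (of_nat (n choose t) * d t * a) * ?Y (n - t))
      + (\<Sum>t\<le>n. fls_const (of_nat (n choose t) * d t * of_nat (n - t)) * ?Y (n - t - 1)))"
    by (simp only: L distrib_left sum.distrib fls_const_mult_const[symmetric] mult.assoc)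
  also have "fls_const c * ?Y n = (\<Sum>t\<in>{0}. fls_const (of_nat (n choose t) * (if t = 0 then c else 0)) * ?Y (n - t))"
    by simp
  also have "\<dots> = (\<Sum>t\<le>n. fls_const (of_nat (n choose t) * (if t = 0 then c else 0)) * ?Y (n - t))"
    by (rule sum.mono_neutral_left) auto
  \<comment> \<open>Shifting t by one uses (n choose t) (n - t) = (n choose t+1) (t+1). The added
    summand t = n + 1 vanishes with its binomial coefficient.\<close>
  also have "(\<Sum>t\<le>n. fls_const (of_nat (n choose t) * d t * of_nat (n - t)) * ?Y (n - t - 1))
      = (\<Sum>t\<le>Suc n. fls_const (of_nat (n choose t) * (of_nat t * d (t - 1))) * ?Y (n - t))"
  proof -
    have "of_nat (n choose t) * d t * of_nat (n - t) = (of_nat (n choose Suc t) * (of_nat (Suc t) * d t) :: complex)" for t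
    proof -
      have "(n choose t) * (n - t) = (n choose Suc t) * Suc t"
        using binomial_absorb_comp[of n t] binomial_absorption[of t n] by (metis mult.commute)
      hence "of_nat (n choose t) * of_nat (n - t) = (of_nat (n choose Suc t) * of_nat (Suc t) :: complex)"
        by (metis of_nat_mult)
      thus ?thesis by (metis mult.assoc mult.commute)
    qed
    hence eq: "fls_const (of_nat (n choose t) * d t * of_nat (n - t)) * ?Y (n - t - 1)
        = fls_const (of_nat (n choose Suc t) * (of_nat (Suc t) * d t)) * ?Y (n - Suc t)" for t
      by (simp only: diff_diff_left add_Suc_right add_0_right One_nat_def)
    show ?thesis unfolding eq by (subst sum.atMost_Suc_shift) (simp del: of_nat_Suc)
  qed
  also have "\<dots> = (\<Sum>t\<le>n. fls_const (of_nat (n choose t) * (of_nat t * d (t - 1))) * ?Y (n - t))"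
    by simp
  also have "(\<Sum>t\<le>n. fls_const (of_nat (n choose t) * (if t = 0 then c else 0)) * ?Y (n - t))
      + ((\<Sum>t\<le>n. fls_const (of_nat (n choose t) * d t * a) * ?Y (n - t)) + \<dots>)
      = (\<Sum>t\<le>n. fls_const (of_nat (n choose t) * poly ((pderiv ^^ t) (pCons c T)) a) * ?Y (n - t))"
    unfolding sum.distrib[symmetric] pderiv_pow_pCons d_def
    by (intro sum.cong refl) (simp only: fls_plus_const[symmetric] ring_distribs mult_ac add_ac)
  finally show ?case .
qed

definition airy_comb :: "(nat \<Rightarrow> complex) \<Rightarrow> nat \<Rightarrow> complex fls \<Rightarrow> complex fls" where
  "airy_comb u N Y = (\<Sum>m<N. fls_const (u m) * (fls_deriv ^^ m) Y)"

lemma formal_adjoint_Airy_poly: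
  "formal_adjoint (poly_at_diffop p Airy_op) = poly_at_diffop p Airy_op"
  by (rule formal_adjoint_poly_at[OF formal_adjoint_Airy_op])

lemma Airy_poly_kills_deriv_pow:
  assumes "airy_ode a Y" "[:- a, 1:] ^ N dvd S" "m < N"
  shows "op_act (poly_at_diffop S Airy_op) ((fls_deriv ^^ m) Y) = 0"
proof -
  obtain T where "S = T * [:- a, 1:] ^ N" using assms(2) by (metis dvd_def mult.commute)
  thus ?thesis using assms(3)
    by (simp add: poly_at_diffop_mult poly_at_diffop_power op_act_Airy_linear_pow[OF assms(1)])
qed

lemma Airy_poly_kills_comb:
  assumes "airy_ode a Y" "[:- a, 1:] ^ N dvd S"
  shows "op_act (poly_at_diffop S Airy_op) (airy_comb u N Y) = 0"
  by (simp add: airy_comb_def op_act_fsum op_act_const Airy_poly_kills_deriv_pow[OF assms])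

text \<open>By coprimality S splits so that (L - a)^N kills the first argument, while the remaining
  factor, self-adjoint and divisible by (L - b)^M, kills the second. Both terms of the composition
  rule vanish.\<close>

lemma concomitant_Airy_orthogonal:
  assumes "a \<noteq> b" "airy_ode a Y" "airy_ode b Z"
    and "[:- a, 1:] ^ N dvd S" "[:- b, 1:] ^ M dvd S"
  shows "concomitant (poly_at_diffop S Airy_op) (airy_comb u N Y) (airy_comb v M Z) = 0"
proof -
  have "coprime [:- a, 1:] [:- b, 1:]"
  proof (rule coprimeI)
    fix p assume "p dvd [:- a, 1:]" "p dvd [:- b, 1:]"
    hence "p dvd [:- a, 1:] - [:- b, 1:]" by (rule dvd_diff)
    moreover have "[:- a, 1:] - [:- b, 1:] = [:b - a:]" by simp
    moreover have "is_unit [:b - a:]" using assms(1) by (simp add: is_unit_const_poly_iff dvd_field_iff)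
    ultimately show "is_unit p" using dvd_trans by metis
  qed
  hence "coprime ([:- a, 1:] ^ N) ([:- b, 1:] ^ M)" by simp
  hence "[:- a, 1:] ^ N * [:- b, 1:] ^ M dvd S" using assms(4,5) by (intro divides_mult)
  then obtain A where "S = ([:- a, 1:] ^ N * [:- b, 1:] ^ M) * A" by (elim dvdE)
  hence "S = ([:- b, 1:] ^ M * A) * [:- a, 1:] ^ N" by (simp only: mult_ac)
  thus ?thesis using assms(2,3)
    by (simp add: poly_at_diffop_mult[of "[:- b, 1:] ^ M * A"] concomitant_mult
        formal_adjoint_Airy_poly Airy_poly_kills_comb del: op_act_mult)
qed

text \<open>As (L - a)^N kills the first argument, T(L) may be moved to the second one. Its Taylor
  expansion there meets \<open>concomitant_Airy_pow_eigen\<close>, which selects a single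
  term.\<close>

lemma concomitant_Airy_poly_eigen:
  assumes "airy_ode a Y" "airy_ode a Z" "m < N" "n < N"
  shows "concomitant (poly_at_diffop (T * [:- a, 1:] ^ N) Airy_op) ((fls_deriv ^^ m) Y) ((fls_deriv ^^ n) Z)
    = (if m + n \<ge> N - 1 then fls_const (fact m * fact n / fact (m + n + 1 - N)
        * poly ((pderiv ^^ (m + n + 1 - N)) T) a) * wr Y Z else 0)"
proof -
  let ?Y = "\<lambda>m. (fls_deriv ^^ m) Y" and ?Z = "\<lambda>n. (fls_deriv ^^ n) Z"
  define d where "d = (\<lambda>t. poly ((pderiv ^^ t) T) a)"
  define s where "s = (\<lambda>t. fls_const (of_nat (n choose t) * d t) *
      (if m + (n - t) = N - 1 then fls_const (fact m * fact (n - t)) * wr Y Z else 0))"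
  have "op_act (poly_at_diffop ([:- a, 1:] ^ N) Airy_op) (?Y m) = 0"
    by (rule Airy_poly_kills_deriv_pow[OF assms(1) dvd_refl assms(3)])
  hence "concomitant (poly_at_diffop (T * [:- a, 1:] ^ N) Airy_op) (?Y m) (?Z n)
      = concomitant (poly_at_diffop [:- a, 1:] Airy_op ^ N) (?Y m)
          (op_act (poly_at_diffop T Airy_op) (?Z n))"
    by (simp add: poly_at_diffop_mult concomitant_mult formal_adjoint_Airy_poly poly_at_diffop_power)
  also have "\<dots> = (\<Sum>t\<le>n. s t)"
    unfolding op_act_Airy_poly[OF assms(2)] concomitant_sum_right concomitant_const_right s_def d_def
    using assms by (intro sum.cong refl arg_cong2[of _ _ _ _ "(*)"] concomitant_Airy_pow_eigen) auto
  also have "\<dots> = (if m + n \<ge> N - 1 then fls_const (fact m * fact n / fact (m + n + 1 - N)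
        * d (m + n + 1 - N)) * wr Y Z else 0)"
  proof (cases "m + n \<ge> N - 1")
    case True
    \<comment> \<open>The only t with m + (n - t) = N - 1. Its binomial coefficient turns (n - k)!
      into n! / k!, the factor in the bilinear form.\<close>
    define k where "k = m + n + 1 - N"
    have k: "k \<le> n" "m + (n - k) = N - 1" using True assms(3,4) by (auto simp: k_def)
    have "s t = 0" if "t \<in> {..n} - {k}" for t using that True assms(3,4) by (auto simp: s_def k_def)
    hence "(\<Sum>t\<le>n. s t) = (\<Sum>t\<in>{k}. s t)" using k by (intro sum.mono_neutral_right) auto
    also have "\<dots> = fls_const (of_nat (n choose k) * d k * (fact m * fact (n - k))) * wr Y Z"
      using k by (simp add: s_def flip: mult.assoc)
    also have "of_nat (n choose k) * d k * (fact m * fact (n - k)) = fact m * fact n / fact k * d k"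
      using k by (simp add: binomial_fact field_simps)
    finally show ?thesis using True by (simp add: k_def)
  next
    case False
    hence "s t = 0" if "t \<le> n" for t using that by (auto simp: s_def)
    thus ?thesis using False by simp
  qed
  finally show ?thesis by (simp add: d_def)
qed

lemma concomitant_Airy_bilinear_form:
  assumes "airy_ode a Y" "airy_ode a Z" "0 < e" "[:- a, 1:] ^ (2 * e) dvd q ^ 2"
  shows "concomitant (poly_at_diffop (q ^ 2) Airy_op) (airy_comb u (2 * e) Y) (airy_comb v (2 * e) Z)
    = fls_const (bilinear_form q a e u v) * wr Y Z"
proof -
  let ?N = "2 * e"
  define T where "T = q ^ 2 div [:- a, 1:] ^ ?N"
  have q: "q ^ 2 = T * [:- a, 1:] ^ ?N" using assms(4) by (simp add: T_def)
  define c where "c = (\<lambda>(m, n). u m * v n * (fact m * fact n / fact (m + n + 1 - ?N))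
        * poly ((pderiv ^^ (m + n + 1 - ?N)) T) a)"
  have "concomitant (poly_at_diffop (q ^ 2) Airy_op) (airy_comb u ?N Y) (airy_comb v ?N Z)
      = (\<Sum>m<?N. \<Sum>n<?N. fls_const (u m) * (fls_const (v n) *
          concomitant (poly_at_diffop (q ^ 2) Airy_op) ((fls_deriv ^^ m) Y) ((fls_deriv ^^ n) Z)))"
    unfolding airy_comb_def concomitant_sum_left concomitant_const_left concomitant_sum_right
      concomitant_const_right sum_distrib_left
    by (subst sum.swap) (simp only: mult.left_commute)
  also have "\<dots> = (\<Sum>m<?N. \<Sum>n<?N. if m + n \<ge> ?N - 1 then fls_const (c (m, n)) * wr Y Z else 0)"
    by (intro sum.cong refl)
      (simp add: q concomitant_Airy_poly_eigen[OF assms(1,2)] c_def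
        mult.assoc[symmetric])
  also have "\<dots> = (\<Sum>x\<in>{..<?N} \<times> {..<?N}. if fst x + snd x \<ge> ?N - 1 then fls_const (c x) * wr Y Z else 0)"
    by (simp add: sum.cartesian_product case_prod_unfold cong: if_cong)
  also have "\<dots> = (\<Sum>x\<in>{x\<in>{..<?N} \<times> {..<?N}. fst x + snd x \<ge> ?N - 1}. fls_const (c x) * wr Y Z)"
    by (intro sum.inter_filter[symmetric]) simp
  also have "{x\<in>{..<?N} \<times> {..<?N}. fst x + snd x \<ge> ?N - 1}
      = {(m, n). m \<le> ?N - 1 \<and> n \<le> ?N - 1 \<and> m + n \<ge> ?N - 1}"
    using assms(3) by auto
  also have "(\<Sum>x\<in>\<dots>. fls_const (c x) * wr Y Z) = (\<Sum>x\<in>\<dots>. fls_const (c x)) * wr Y Z"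
    by (simp only: sum_distrib_right)
  also have "(\<Sum>x\<in>{(m, n). m \<le> ?N - 1 \<and> n \<le> ?N - 1 \<and> m + n \<ge> ?N - 1}. fls_const (c x))
      = fls_const (bilinear_form q a e u v)"
  proof -
    have "(\<Sum>x\<in>A. fls_const (c x)) = fls_const (sum c A)" for A
      by (induction A rule: infinite_finite_induct) (simp_all flip: fls_plus_const)
    thus ?thesis unfolding bilinear_form_def c_def T_def[symmetric] by simp
  qed
  finally show ?thesis .
qed

section \<open>The Airy functions\<close>

definition airy_entire :: "(complex \<Rightarrow> complex) \<Rightarrow> bool" where
  "airy_entire h \<longleftrightarrow> h holomorphic_on UNIV \<and> (\<forall>z. (deriv ^^ 2) h z = z * h z)"

lemma entire_differentiable: "h holomorphic_on UNIV \<Longrightarrow> h field_differentiable at z"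
  by (simp add: holomorphic_on_open field_differentiable_def)

lemma entire_DERIV: "h holomorphic_on UNIV \<Longrightarrow> (h has_field_derivative deriv h z) (at z)"
  by (simp add: entire_differentiable DERIV_deriv_iff_field_differentiable)

lemma entire_deriv_pow: "h holomorphic_on UNIV \<Longrightarrow> (deriv ^^ n) h holomorphic_on UNIV"
  by (intro holomorphic_higher_deriv) auto

lemma entire_deriv_pow_DERIV:
  "h holomorphic_on UNIV \<Longrightarrow> ((deriv ^^ n) h has_field_derivative (deriv ^^ Suc n) h z) (at z)"
  using entire_DERIV[OF entire_deriv_pow] by simp

lemma deriv_pow_combination:
  assumes "h holomorphic_on UNIV" "k holomorphic_on UNIV"
  shows "(deriv ^^ n) (\<lambda>z. c * h z + e * k z) = (\<lambda>z. c * (deriv ^^ n) h z + e * (deriv ^^ n) k z)"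
proof (induction n)
  case (Suc n)
  have "((\<lambda>z. c * (deriv ^^ n) h z + e * (deriv ^^ n) k z) has_field_derivative
      c * (deriv ^^ Suc n) h z + e * (deriv ^^ Suc n) k z) (at z)" for z
    by (intro DERIV_add DERIV_cmult entire_deriv_pow_DERIV assms)
  thus ?case using Suc by (auto intro!: DERIV_imp_deriv)
qed simp

lemma airy_entire_combination:
  assumes "airy_entire h" "airy_entire k"
  shows "airy_entire (\<lambda>z. c * h z + e * k z)"
  using assms unfolding airy_entire_def
  by (auto simp: deriv_pow_combination algebra_simps intro!: holomorphic_intros)

text \<open>One formula for both Maclaurin series: exponents are congruent to \<open>s\<close>
  modulo 3, and (s + 1) / 3 is the parameter 1/3 or 2/3 of the two solutions.\<close>

definition airy_coeff :: "nat \<Rightarrow> nat \<Rightarrow> complex" where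
  "airy_coeff s n = (if n mod 3 = s
     then 3 ^ (n div 3) * pochhammer (of_nat (Suc s) / 3) (n div 3) / fact n else 0)"

lemma airy_coeff_rec:
  assumes "s < 2"
  shows "airy_coeff s (n + 3) * (of_nat (n + 3) * of_nat (n + 2)) = airy_coeff s n"
proof (cases "n mod 3 = s")
  case True
  define k where "k = n div 3"
  have n: "n = 3 * k + s" using True div_mult_mod_eq[of n 3] by (simp add: k_def)
  have nz: "of_nat (n + 1) \<noteq> (0::complex)" "of_nat (n + 2) \<noteq> (0::complex)" "of_nat (n + 3) \<noteq> (0::complex)"
    by (metis of_nat_eq_0_iff add_is_0 numeral_neq_zero one_neq_zero)+
  have f: "fact (n + 3) = (of_nat (n + 3) * of_nat (n + 2) * of_nat (n + 1) * fact n :: complex)"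
    by (simp add: numeral_3_eq_3 algebra_simps)
  \<comment> \<open>Three times the new factor of the Pochhammer symbol is n + 1, which cancels the
    corresponding factor of (n + 3)!.\<close>
  have l: "3 * (of_nat (Suc s) / 3 + of_nat k) = (of_nat (n + 1) :: complex)" by (simp add: n)
  have "airy_coeff s (n + 3) = 3 ^ k * pochhammer (of_nat (Suc s) / 3) k *
      (3 * (of_nat (Suc s) / 3 + of_nat k)) / fact (n + 3)"
    using True by (simp add: airy_coeff_def k_def pochhammer_rec' mult_ac)
  hence "airy_coeff s (n + 3) = 3 ^ k * pochhammer (of_nat (Suc s) / 3) k * of_nat (n + 1) /
      (of_nat (n + 3) * of_nat (n + 2) * of_nat (n + 1) * fact n)" unfolding f l .
  hence "airy_coeff s (n + 3) * (of_nat (n + 3) * of_nat (n + 2)) =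
      3 ^ k * pochhammer (of_nat (Suc s) / 3) k * of_nat (n + 1) /
      (of_nat (n + 3) * of_nat (n + 2) * of_nat (n + 1) * fact n) * (of_nat (n + 3) * of_nat (n + 2))"
    by (rule arg_cong)
  also have "\<dots> = 3 ^ k * pochhammer (of_nat (Suc s) / 3) k / fact n"
  proof -
    have r: "X * b / (c * e * b * f) * (c * e) = X / f"
      if "b \<noteq> 0" "c \<noteq> 0" "e \<noteq> 0" "f \<noteq> 0" for X b c e f :: complex
      using that by (simp add: field_simps)
    show ?thesis by (rule r) (use nz in simp_all)
  qed
  also have "\<dots> = airy_coeff s n" using True by (simp add: airy_coeff_def k_def)
  finally show ?thesis .
qed (simp add: airy_coeff_def)

lemma airy_coeff_small:
  "airy_coeff s 0 = (if s = 0 then 1 else 0)" "airy_coeff s 1 = (if s = 1 then 1 else 0)"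
  "s < 2 \<Longrightarrow> airy_coeff s 2 = 0"
  by (auto simp: airy_coeff_def)

lemma summable_airy_subseries:
  assumes s: "s < 2"
  shows "summable (\<lambda>k. airy_coeff s (3 * k + s) * z ^ (3 * k + s))"
proof (rule summable_ratio_test)
  \<comment> \<open>Consecutive terms have ratio |z|^3 / w with w at least 2 k, hence at most 1/2
    once k is at least |z|^3.\<close>
  define N where "N = nat \<lceil>norm z ^ 3\<rceil>"
  show "(1/2 :: real) < 1" by simp
  fix k assume k: "k \<ge> N"
  let ?n = "3 * k + s"
  define w :: real where "w = of_nat (?n + 3) * of_nat (?n + 2)"
  have w: "w > 0" by (simp add: w_def)
  have "norm z ^ 3 \<le> real k" using k by (simp add: N_def)
  also have "2 * real k \<le> of_nat (?n + 3) * 1" by simp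
  also have "\<dots> \<le> w" unfolding w_def by (intro mult_left_mono) auto
  finally have le: "norm z ^ 3 \<le> w / 2" by simp
  have "norm (airy_coeff s (?n + 3)) * w = norm (airy_coeff s ?n)"
    using arg_cong[OF airy_coeff_rec[OF s, of ?n], of norm]
    unfolding norm_mult norm_of_nat w_def .
  hence "norm (airy_coeff s (?n + 3)) = norm (airy_coeff s ?n) / w"
    using w by (simp add: field_simps)
  moreover have "3 * Suc k + s = ?n + 3" by simp
  ultimately have "norm (airy_coeff s (3 * Suc k + s) * z ^ (3 * Suc k + s))
      = norm (airy_coeff s ?n) * norm z ^ ?n * (norm z ^ 3 / w)"
    by (simp only: norm_mult norm_power power_add) simp
  also have "\<dots> \<le> norm (airy_coeff s ?n) * norm z ^ ?n * (1 / 2)"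
    using le w by (intro mult_left_mono) (simp_all add: field_simps)
  finally show "norm (airy_coeff s (3 * Suc k + s) * z ^ (3 * Suc k + s))
      \<le> 1 / 2 * norm (airy_coeff s ?n * z ^ ?n)"
    by (simp add: norm_mult norm_power)
qed

lemma airy_series_sums:
  assumes s: "s < 2"
  shows "(\<lambda>n. airy_coeff s n * z ^ n) sums (\<Sum>k. airy_coeff s (3 * k + s) * z ^ (3 * k + s))"
proof (subst sums_mono_reindex[symmetric, of "\<lambda>k. 3 * k + s"])
  show "strict_mono (\<lambda>k. 3 * k + s)" by (simp add: strict_mono_def)
  show "airy_coeff s n * z ^ n = 0" if "n \<notin> range (\<lambda>k. 3 * k + s)" for n
  proof -
    have "n mod 3 \<noteq> s"
    proof
      assume "n mod 3 = s"
      hence "n = 3 * (n div 3) + s" using div_mult_mod_eq[of n 3] by simp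
      thus False using that by blast
    qed
    thus ?thesis by (simp add: airy_coeff_def)
  qed
  show "(\<lambda>k. airy_coeff s (3 * k + s) * z ^ (3 * k + s)) sums
      (\<Sum>k. airy_coeff s (3 * k + s) * z ^ (3 * k + s))"
    by (rule summable_sums[OF summable_airy_subseries[OF s]])
qed

definition airy_sol :: "nat \<Rightarrow> complex \<Rightarrow> complex" where
  "airy_sol s = eval_fps (Abs_fps (airy_coeff s))"

lemma airy_sol_eq:
  "s < 2 \<Longrightarrow> airy_sol s z = (\<Sum>k. airy_coeff s (3 * k + s) * z ^ (3 * k + s))"
  using airy_series_sums[of s z] by (simp add: airy_sol_def eval_fps_def sums_iff)

lemma airy_series_eq: "airy_series0 = airy_sol 0" "airy_series1 = airy_sol 1"
proof -
  show "airy_series0 = airy_sol 0"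
    by (rule ext) (simp add: airy_series0_def airy_sol_eq airy_coeff_def)
  have "(3 * k + 1) mod 3 = 1" "(3 * k + 1) div 3 = k" for k :: nat by presburger+
  thus "airy_series1 = airy_sol 1"
    by (intro ext) (simp add: airy_series1_def airy_sol_eq airy_coeff_def)
qed

text \<open>The series has infinite radius of convergence, so the coefficient recursion, read as F''
  = X F for formal series, becomes the differential equation for its sum.\<close>

lemma airy_sol_properties:
  assumes s: "s < 2"
  shows "airy_entire (airy_sol s)" "airy_sol s 0 = (if s = 0 then 1 else 0)"
    "deriv (airy_sol s) 0 = (if s = 1 then 1 else 0)"
proof -
  define F where "F = Abs_fps (airy_coeff s)"
  have "conv_radius (fps_nth F) = \<infinity>"
  proof (rule conv_radius_inftyI'[of 0])
    fix r :: real assume r: "r > 0"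
    have "summable (\<lambda>n. fps_nth F n * complex_of_real r ^ n)"
      using sums_summable[OF airy_series_sums[OF s]] by (simp add: F_def)
    thus "\<exists>z. norm z = r \<and> summable (\<lambda>n. fps_nth F n * z ^ n)"
      using r by (intro exI[of _ "of_real r"]) simp
  qed
  hence rad: "fps_conv_radius F = \<infinity>" by (simp add: fps_conv_radius_def)
  have rad': "fps_conv_radius (fps_deriv F) = \<infinity>"
    using fps_conv_radius_deriv[of F] rad by simp
  have F2: "fps_deriv (fps_deriv F) = fps_X * F"
  proof (rule fps_ext)
    fix n
    show "fps_nth (fps_deriv (fps_deriv F)) n = fps_nth (fps_X * F) n"
    proof (cases n)
      case 0
      thus ?thesis using s airy_coeff_small(3)[of s] by (simp add: F_def numeral_2_eq_2)
    next
      case (Suc m)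
      have "airy_coeff s (m + 3) * (of_nat (m + 3) * of_nat (m + 2)) = airy_coeff s m"
        by (rule airy_coeff_rec[OF s])
      moreover have "m + 3 = Suc (Suc (Suc m))" "m + 2 = Suc (Suc m)" by simp_all
      ultimately show ?thesis using Suc by (simp add: F_def mult_ac del: of_nat_Suc)
    qed
  qed
  have d1: "(airy_sol s has_field_derivative eval_fps (fps_deriv F) z) (at z)" for z
    unfolding airy_sol_def F_def[symmetric] by (rule has_field_derivative_eval_fps) (simp add: rad)
  have d2: "(eval_fps (fps_deriv F) has_field_derivative z * airy_sol s z) (at z)" for z
  proof -
    have "(eval_fps (fps_deriv F) has_field_derivative eval_fps (fps_deriv (fps_deriv F)) z) (at z)"
      by (rule has_field_derivative_eval_fps) (simp add: rad')
    moreover have "eval_fps (fps_X * F) z = z * airy_sol s z"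
      by (subst eval_fps_mult) (simp_all add: rad[unfolded F_def] airy_sol_def F_def)
    ultimately show ?thesis by (simp add: F2)
  qed
  have e1: "deriv (airy_sol s) = eval_fps (fps_deriv F)" using d1 by (intro ext DERIV_imp_deriv)
  have e2: "(deriv ^^ 2) (airy_sol s) z = z * airy_sol s z" for z
    using DERIV_imp_deriv[OF d2] by (simp add: numeral_2_eq_2 e1)
  have "airy_sol s holomorphic_on UNIV" using d1 by (subst holomorphic_on_open) auto
  thus "airy_entire (airy_sol s)" using e2 by (simp add: airy_entire_def)
  show "airy_sol s 0 = (if s = 0 then 1 else 0)"
    by (simp add: airy_sol_def eval_fps_at_0 airy_coeff_small)
  show "deriv (airy_sol s) 0 = (if s = 1 then 1 else 0)"
    using airy_coeff_small(2)[of s] by (simp add: e1 eval_fps_at_0 F_def)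
qed

lemma airy_wronskian_const:
  assumes "airy_entire h" "airy_entire k"
  shows "h z * deriv k z - k z * deriv h z = h 0 * deriv k 0 - k 0 * deriv h 0"
proof -
  have "((\<lambda>z. h z * deriv k z - k z * deriv h z) has_field_derivative 0) (at z)" for z
  proof -
    have h: "h holomorphic_on UNIV" "(deriv ^^ 2) h z = z * h z"
      and k: "k holomorphic_on UNIV" "(deriv ^^ 2) k z = z * k z"
      using assms by (simp_all add: airy_entire_def)
    have "(deriv h has_field_derivative z * h z) (at z)" "(deriv k has_field_derivative z * k z) (at z)"
      using entire_deriv_pow_DERIV[OF h(1), of 1 z] entire_deriv_pow_DERIV[OF k(1), of 1 z] h k
      by (simp_all add: numeral_2_eq_2)
    thus ?thesis
      using entire_DERIV[OF h(1), of z] entire_DERIV[OF k(1), of z]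
      by (auto intro!: derivative_eq_intros simp: algebra_simps)
  qed
  hence "\<exists>c. \<forall>z\<in>UNIV. h z * deriv k z - k z * deriv h z = c"
    by (intro has_field_derivative_zero_constant) auto
  thus ?thesis by (metis UNIV_I)
qed

text \<open>The Wronskian is constant; at 0 it equals 2 sqrt(3) c1 c2, and both constants are
  positive because Gamma is positive on positive reals.\<close>

lemma Ai_Bi_properties:
  "airy_entire Ai" "airy_entire Bi" "\<exists>w. w \<noteq> 0 \<and> (\<forall>z. Ai z * deriv Bi z - Bi z * deriv Ai z = w)"
proof -
  define c1 where "c1 = (1 / (3 powr (2 / 3) * Gamma (2 / 3)) :: real)"
  define c2 where "c2 = (1 / (3 powr (1 / 3) * Gamma (1 / 3)) :: real)"
  have c: "c1 > 0" "c2 > 0" unfolding c1_def c2_def by (auto intro!: divide_pos_pos mult_pos_pos Gamma_real_pos)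
  let ?h = "airy_sol 0" and ?k = "airy_sol 1"
  have Ai: "Ai = (\<lambda>z. of_real c1 * ?h z + (- of_real c2) * ?k z)"
    by (rule ext) (simp only: Ai_def c1_def c2_def airy_series_eq mult_minus_left diff_conv_add_uminus)
  have Bi: "Bi = (\<lambda>z. of_real (sqrt 3 * c1) * ?h z + of_real (sqrt 3 * c2) * ?k z)"
    by (rule ext) (simp only: Bi_def c1_def c2_def airy_series_eq times_divide_eq_right mult_1_right)
  have h: "airy_entire ?h" "airy_entire ?k" using airy_sol_properties(1) by auto
  show A: "airy_entire Ai" unfolding Ai by (intro airy_entire_combination h)
  show B: "airy_entire Bi" unfolding Bi by (intro airy_entire_combination h)
  have hol: "?h holomorphic_on UNIV" "?k holomorphic_on UNIV" using h by (auto simp: airy_entire_def)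
  have v: "?h 0 = 1" "?k 0 = 0" "deriv ?h 0 = 0" "deriv ?k 0 = 1"
    using airy_sol_properties(2,3)[of 0] airy_sol_properties(2,3)[of 1] by simp_all
  have dA: "deriv Ai 0 = - of_real c2"
    using fun_cong[OF deriv_pow_combination[OF hol, of 1 "of_real c1" "- of_real c2"], of 0] v
    unfolding Ai by simp
  have dB: "deriv Bi 0 = of_real (sqrt 3 * c2)"
    using fun_cong[OF deriv_pow_combination[OF hol, of 1 "of_real (sqrt 3 * c1)" "of_real (sqrt 3 * c2)"], of 0] v
    unfolding Bi by simp
  have "Ai 0 = of_real c1" "Bi 0 = of_real (sqrt 3 * c1)" unfolding Ai Bi using v by simp_all
  hence "Ai 0 * deriv Bi 0 - Bi 0 * deriv Ai 0 = of_real (2 * sqrt 3 * c1 * c2)"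
    by (simp add: dA dB)
  moreover have "2 * sqrt 3 * c1 * c2 \<noteq> 0" using c by simp
  hence "complex_of_real (2 * sqrt 3 * c1 * c2) \<noteq> 0" by (simp only: of_real_eq_0_iff not_False_eq_True)
  ultimately show "\<exists>w. w \<noteq> 0 \<and> (\<forall>z. Ai z * deriv Bi z - Bi z * deriv Ai z = w)"
    using airy_wronskian_const[OF A B] by metis
qed

section \<open>Expansions of entire functions\<close>

definition fexp :: "(complex \<Rightarrow> complex) \<Rightarrow> complex fls" where
  "fexp h = fps_to_fls (fps_expansion h 0)"

lemma fexp_eqI: "h has_fps_expansion F \<Longrightarrow> fexp h = fps_to_fls F"
  unfolding fexp_def
  by (metis fps_expansion_unique_complex analytic_at_imp_has_fps_expansion_0 has_fps_expansion_imp_analytic_0)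

lemma entire_has_fps_expansion: "h holomorphic_on UNIV \<Longrightarrow> h has_fps_expansion fps_expansion h 0"
  by (intro analytic_at_imp_has_fps_expansion_0)
    (metis analytic_on_open analytic_on_subset open_UNIV subset_UNIV)

lemma fexp_deriv: "h holomorphic_on UNIV \<Longrightarrow> fexp (deriv h) = fls_deriv (fexp h)"
  using fexp_eqI[OF has_fps_expansion_deriv[OF entire_has_fps_expansion]]
  by (simp add: fexp_def fls_deriv_fps_to_fls)

lemma fexp_deriv_pow: "h holomorphic_on UNIV \<Longrightarrow> fexp ((deriv ^^ n) h) = (fls_deriv ^^ n) (fexp h)"
  by (induction n) (simp_all add: fexp_deriv entire_deriv_pow)

lemma fexp_add:
  "h holomorphic_on UNIV \<Longrightarrow> k holomorphic_on UNIV \<Longrightarrow> fexp (\<lambda>z. h z + k z) = fexp h + fexp k"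
  using fexp_eqI[OF has_fps_expansion_add[OF entire_has_fps_expansion entire_has_fps_expansion], of h k]
  by (simp add: fexp_def)

lemma fexp_mult:
  "h holomorphic_on UNIV \<Longrightarrow> k holomorphic_on UNIV \<Longrightarrow> fexp (\<lambda>z. h z * k z) = fexp h * fexp k"
  using fexp_eqI[OF has_fps_expansion_mult[OF entire_has_fps_expansion entire_has_fps_expansion], of h k]
  by (simp add: fexp_def fls_times_fps_to_fls)

lemma fexp_const: "fexp (\<lambda>z. c) = fls_const c"
  using fexp_eqI[OF has_fps_expansion_const] by simp

lemma fexp_sum:
  assumes "finite I" "\<And>i. i \<in> I \<Longrightarrow> h i holomorphic_on UNIV"
  shows "fexp (\<lambda>z. \<Sum>i\<in>I. h i z) = (\<Sum>i\<in>I. fexp (h i))"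
  using assms
proof (induction I rule: finite_induct)
  case (insert i I)
  have "(\<lambda>z. \<Sum>i\<in>I. h i z) holomorphic_on UNIV" using insert.prems by (intro holomorphic_intros) auto
  thus ?case using insert by (simp add: fexp_add)
qed (simp add: fexp_const)

lemma fexp_prod:
  assumes "finite I" "\<And>i. i \<in> I \<Longrightarrow> h i holomorphic_on UNIV"
  shows "fexp (\<lambda>z. \<Prod>i\<in>I. h i z) = (\<Prod>i\<in>I. fexp (h i))"
  using assms
proof (induction I rule: finite_induct)
  case (insert i I)
  have "(\<lambda>z. \<Prod>i\<in>I. h i z) holomorphic_on UNIV" using insert.prems by (intro holomorphic_intros) auto
  thus ?case using insert by (simp add: fexp_mult)
qed (simp add: fexp_const)

lemma poly_entire: "poly p holomorphic_on UNIV" for p :: "complex poly"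
  by (auto simp: holomorphic_on_open intro!: exI poly_DERIV)

lemma fexp_poly: "fexp (poly p) = poly_fls p"
proof (induction p)
  case (pCons c p)
  have "fexp (\<lambda>z. z) = fls_X" using fexp_eqI[OF has_fps_expansion_fps_X] by simp
  hence m: "fexp (\<lambda>z. z * poly p z) = fls_X * poly_fls p"
    using fexp_mult[OF _ poly_entire, of "\<lambda>z. z" p] pCons by (simp add: holomorphic_on_ident)
  have "(\<lambda>z. z * poly p z) holomorphic_on UNIV" by (intro holomorphic_intros poly_entire)
  hence "fexp (\<lambda>z. c + z * poly p z) = fls_const c + fls_X * poly_fls p"
    using fexp_add[of "\<lambda>z. c" "\<lambda>z. z * poly p z"] by (simp add: fexp_const m)
  also have "fls_X = poly_fls [:0, 1:]" by (simp add: poly_fls_def)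
  also have "fls_const c + poly_fls [:0, 1:] * poly_fls p = poly_fls (pCons c p)"
    by (simp flip: poly_fls_const poly_fls_add poly_fls_mult)
  finally show ?case by simp
qed (simp add: fexp_const)

text \<open>Identity theorem: this is what allows returning from series to functions.\<close>

lemma fexp_eq_0_imp:
  assumes "h holomorphic_on UNIV" "fexp h = 0"
  shows "h z = 0"
  using has_fps_expansion_0_analytic_continuation[of h UNIV z] entire_has_fps_expansion[OF assms(1)] assms
  by (simp add: fexp_def connected_UNIV)

lemma fexp_det:
  assumes "\<And>i j. i < n \<Longrightarrow> j < n \<Longrightarrow> h i j holomorphic_on UNIV"
  shows "fexp (\<lambda>z. Determinant.det (Matrix.mat n n (\<lambda>(i, j). h i j z)))
    = Determinant.det (Matrix.mat n n (\<lambda>(i, j). fexp (h i j)))"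
proof -
  have d: "Determinant.det (Matrix.mat n n (\<lambda>(i, j). A i j))
      = (\<Sum>p | p permutes {0..<n}. signof p * (\<Prod>i = 0..<n. A i (p i)))" for A :: "nat \<Rightarrow> nat \<Rightarrow> 'b :: comm_ring_1"
    by (subst det_def'[of _ n]) (auto intro!: sum.cong prod.cong)
  have fin: "finite {p. p permutes {0..<n}}" by (rule finite_permutations) simp
  have hol: "h i (p i) holomorphic_on UNIV" if "p permutes {0..<n}" "i \<in> {0..<n}" for p i
    using assms[of i "p i"] that permutes_in_image[OF that(1), of i] by auto
  have sg: "fexp (\<lambda>z. signof p) = signof p" for p :: "nat \<Rightarrow> nat"
    by (cases p rule: sign_cases) (simp_all add: fexp_const)
  have "fexp (\<lambda>z. \<Sum>p | p permutes {0..<n}. signof p * (\<Prod>i = 0..<n. h i (p i) z))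
      = (\<Sum>p | p permutes {0..<n}. fexp (\<lambda>z. signof p * (\<Prod>i = 0..<n. h i (p i) z)))"
    using fin hol by (intro fexp_sum) (auto intro!: holomorphic_intros)
  also have "\<dots> = (\<Sum>p | p permutes {0..<n}. signof p * (\<Prod>i = 0..<n. fexp (h i (p i))))"
  proof (intro sum.cong refl)
    fix p assume "p \<in> {p. p permutes {0..<n}}"
    hence hol': "h i (p i) holomorphic_on UNIV" if "i \<in> {0..<n}" for i using hol that by blast
    have "(\<lambda>z. \<Prod>i = 0..<n. h i (p i) z) holomorphic_on UNIV" using hol' by (intro holomorphic_intros)
    hence "fexp (\<lambda>z. signof p * (\<Prod>i = 0..<n. h i (p i) z))
        = fexp (\<lambda>z. signof p) * fexp (\<lambda>z. \<Prod>i = 0..<n. h i (p i) z)"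
      by (intro fexp_mult holomorphic_on_const)
    thus "fexp (\<lambda>z. signof p * (\<Prod>i = 0..<n. h i (p i) z))
        = signof p * (\<Prod>i = 0..<n. fexp (h i (p i)))"
      using fexp_prod[of "{0..<n}" "\<lambda>i. h i (p i)"] hol' by (simp add: sg)
  qed
  finally show ?thesis by (simp only: d)
qed

section \<open>Operators with polynomial coefficients\<close>

text \<open>For such operators there are no poles, so pointwise application to an entire function is
  again entire and has an expansion at 0.\<close>

definition poly_op :: "diffop \<Rightarrow> bool" where
  "poly_op P \<longleftrightarrow> (\<forall>j. \<exists>p. diffop_coeff P j = to_fract p)"

lemma poly_op_mult_op: "poly_op (mult_op (to_fract p))"
  unfolding poly_op_def diffop_coeff_def coeffs_of_mult_op
proof
  fix j show "\<exists>q. coeff [:to_fract p:] j = to_fract q"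
    by (cases j) (auto simp: coeff_pCons intro: exI[of _ 0])
qed

lemma poly_op_D_op_pow: "poly_op (D_op ^ n)"
  unfolding poly_op_def diffop_coeff_def coeffs_of_D_op_pow
  by (auto intro: exI[of _ 0] exI[of _ 1])

lemma poly_op_add: "poly_op P \<Longrightarrow> poly_op Q \<Longrightarrow> poly_op (P + Q)"
  unfolding poly_op_def diffop_coeff_add by (metis to_fract_add)

lemma poly_op_diff: "poly_op P \<Longrightarrow> poly_op Q \<Longrightarrow> poly_op (P - Q)"
  unfolding poly_op_def diffop_coeff_def minus_diffop.rep_eq coeff_diff by (metis to_fract_diff)

lemma poly_op_0: "poly_op 0"
  by (auto simp: poly_op_def intro: exI[of _ 0])

lemma poly_op_sum: "(\<And>i. i \<in> I \<Longrightarrow> poly_op (P i)) \<Longrightarrow> poly_op (sum P I)"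
  by (induction I rule: infinite_finite_induct) (auto simp: poly_op_0 poly_op_add)

lemma ratfun_deriv_to_fract: "ratfun_deriv (to_fract p) = to_fract (pderiv p)"
  by (simp add: to_fract_def ratfun_deriv_Fract)

lemma poly_op_mult:
  assumes "poly_op P" "poly_op Q"
  shows "poly_op (P * Q)"
proof -
  let ?A = "coeffs_of_diffop P" and ?B = "coeffs_of_diffop Q"
  have A: "\<exists>p. coeff ?A j = to_fract p" for j using assms(1) by (auto simp: poly_op_def diffop_coeff_def)
  have B: "\<exists>p. coeff ((D_left ^^ i) ?B) j = to_fract p" for i j
  proof (induction i arbitrary: j)
    case 0
    show ?case using assms(2) by (auto simp: poly_op_def diffop_coeff_def)
  next
    case (Suc i)
    show ?case
      using Suc[of j] Suc[of "j - 1"]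
      by (auto simp: coeff_D_left ratfun_deriv_to_fract split: nat.splits simp flip: to_fract_add)
  qed
  obtain a where a: "\<And>j. coeff ?A j = to_fract (a j)" using A by metis
  obtain b where b: "\<And>i j. coeff ((D_left ^^ i) ?B) j = to_fract (b i j)" using B by metis
  have "coeff (diffop_comp ?A ?B) j = to_fract (\<Sum>i\<le>degree ?A. a i * b i j)" for j
    by (simp add: diffop_comp_def coeff_sum a b)
  thus ?thesis unfolding poly_op_def diffop_coeff_def times_diffop.rep_eq by blast
qed

lemma poly_op_power: "poly_op P \<Longrightarrow> poly_op (P ^ n)"
  using poly_op_D_op_pow[of 0] by (induction n) (auto simp: poly_op_mult)

lemma poly_op_Airy_poly: "poly_op (poly_at_diffop p Airy_op)"
  unfolding poly_at_diffop_def Airy_op_def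
  by (intro poly_op_sum poly_op_mult poly_op_power poly_op_diff poly_op_mult_op poly_op_D_op_pow)

lemma ratfun_eval_to_fract [simp]: "ratfun_eval (to_fract p) x = poly p x"
  by (simp add: ratfun_eval_def)

lemma ratfun_poles_to_fract [simp]: "ratfun_poles (to_fract p) = {}"
  by (simp add: ratfun_poles_def)

lemma poly_op_poles:
  assumes "poly_op P"
  shows "diffop_poles P = {}"
proof -
  have "ratfun_poles (diffop_coeff P j) = {}" for j
    using assms by (metis poly_op_def ratfun_poles_to_fract)
  thus ?thesis by (simp add: diffop_poles_def)
qed

lemma diffop_apply_poly_op:
  assumes "poly_op P" "h holomorphic_on UNIV"
  shows "diffop_apply P h holomorphic_on UNIV" "fexp (diffop_apply P h) = op_act P (fexp h)"
proof -
  obtain p where p: "\<And>j. diffop_coeff P j = to_fract (p j)" using assms(1) by (metis poly_op_def)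
  have eq: "diffop_apply P h = (\<lambda>x. \<Sum>j\<le>diffop_order P. poly (p j) x * (deriv ^^ j) h x)"
    by (rule ext) (simp add: diffop_apply_def p)
  have hol: "(\<lambda>x. poly (p j) x * (deriv ^^ j) h x) holomorphic_on UNIV" for j
    by (intro holomorphic_intros poly_entire entire_deriv_pow assms(2))
  show "diffop_apply P h holomorphic_on UNIV" unfolding eq by (intro holomorphic_intros hol)
  show "fexp (diffop_apply P h) = op_act P (fexp h)"
    unfolding eq
    by (subst fexp_sum)
      (simp_all add: hol fexp_mult poly_entire entire_deriv_pow assms(2) fexp_poly fexp_deriv_pow
        op_act_eq p)
qed

text \<open>The bridge between the analytic kernel of the statement and the formal kernel of the
  proof.\<close>

lemma diffop_ker_iff:
  assumes "poly_op P" "h holomorphic_on UNIV"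
  shows "h \<in> diffop_ker P \<longleftrightarrow> op_act P (fexp h) = 0"
proof
  assume "h \<in> diffop_ker P"
  hence "diffop_apply P h = (\<lambda>x. 0)"
    using poly_op_poles[OF assms(1)] by (auto simp: diffop_ker_def)
  thus "op_act P (fexp h) = 0" using diffop_apply_poly_op(2)[OF assms] by (simp add: fexp_const)
next
  assume "op_act P (fexp h) = 0"
  thus "h \<in> diffop_ker P"
    using fexp_eq_0_imp[OF diffop_apply_poly_op(1)[OF assms]] diffop_apply_poly_op(2)[OF assms] assms(2)
    by (simp add: diffop_ker_def)
qed


section \<open>Wronskians of combinations of Airy functions\<close>

lemma deriv_pow_shift:
  assumes "h holomorphic_on UNIV"
  shows "(deriv ^^ n) (\<lambda>x. h (x + a)) = (\<lambda>x. (deriv ^^ n) h (x + a))"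
  using higher_deriv_compose_linear'[of h UNIV UNIV _ 1 a n] assms by auto

lemma shift_entire:
  fixes h :: "complex \<Rightarrow> complex"
  assumes "h holomorphic_on UNIV"
  shows "(\<lambda>x. h (x + a)) holomorphic_on UNIV"
proof -
  have "(\<lambda>x. x + a) holomorphic_on UNIV" by (intro holomorphic_intros)
  moreover have "h holomorphic_on (\<lambda>x. x + a) ` UNIV" using assms holomorphic_on_subset by blast
  ultimately show ?thesis using holomorphic_on_compose by (fastforce simp: o_def)
qed

lemma airy_ode_shift:
  assumes "airy_entire h"
  shows "airy_ode a (fexp (\<lambda>x. h (x + a)))"
proof -
  have h: "h holomorphic_on UNIV" "\<And>z. (deriv ^^ 2) h z = z * h z"
    using assms by (auto simp: airy_entire_def)
  have "fls_deriv (fls_deriv (fexp (\<lambda>x. h (x + a)))) = fexp ((deriv ^^ 2) (\<lambda>x. h (x + a)))"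
    using fexp_deriv_pow[OF shift_entire[OF h(1)], of 2] by (simp add: numeral_2_eq_2)
  also have "(deriv ^^ 2) (\<lambda>x. h (x + a)) = (\<lambda>x. poly [:a, 1:] x * h (x + a))"
    unfolding deriv_pow_shift[OF h(1)] h(2) by (simp add: add.commute)
  also have "fexp \<dots> = poly_fls [:a, 1:] * fexp (\<lambda>x. h (x + a))"
    by (subst fexp_mult) (simp_all add: poly_entire shift_entire h(1) fexp_poly del: poly_pCons)
  finally show ?thesis by (simp add: airy_ode_def)
qed

definition comb_fun :: "(nat \<Rightarrow> complex) \<Rightarrow> nat \<Rightarrow> (complex \<Rightarrow> complex) \<Rightarrow> complex \<Rightarrow> complex \<Rightarrow> complex" where
  "comb_fun u N h a x = (\<Sum>m = 0..N - 1. u m * (deriv ^^ m) h (x + a))"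

lemma comb_fun_entire:
  assumes "h holomorphic_on UNIV"
  shows "comb_fun u N h a holomorphic_on UNIV"
  unfolding comb_fun_def[abs_def]
  by (intro holomorphic_intros shift_entire[OF entire_deriv_pow[OF assms]])

lemma fexp_comb_fun:
  assumes "h holomorphic_on UNIV" "0 < N"
  shows "fexp (comb_fun u N h a) = airy_comb u N (fexp (\<lambda>x. h (x + a)))"
proof -
  have N: "{0..N - 1} = {..<N}" using assms(2) by auto
  have "fexp (\<lambda>x. (deriv ^^ m) h (x + a)) = (fls_deriv ^^ m) (fexp (\<lambda>x. h (x + a)))" for m
    using fexp_deriv_pow[OF shift_entire[OF assms(1)], of m a] by (simp add: deriv_pow_shift[OF assms(1)])
  thus ?thesis
    unfolding comb_fun_def[abs_def] airy_comb_def N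
    by (subst fexp_sum)
      (simp_all add: fexp_mult fexp_const shift_entire entire_deriv_pow assms(1) holomorphic_intros)
qed

lemma deriv_pow_comb_fun:
  assumes "h holomorphic_on UNIV"
  shows "(deriv ^^ s) (comb_fun u N h a) = (\<lambda>x. \<Sum>m = 0..N - 1. u m * (deriv ^^ (m + s)) h (x + a))"
proof (induction s)
  case 0
  show ?case by (simp add: comb_fun_def[abs_def])
next
  case (Suc s)
  have d: "((\<lambda>x. (deriv ^^ n) h (x + a)) has_field_derivative (deriv ^^ Suc n) h (x + a)) (at x)" for n x
    using entire_deriv_pow_DERIV[OF assms, of n "x + a"] by (simp add: DERIV_shift)
  have "((\<lambda>x. \<Sum>m = 0..N - 1. u m * (deriv ^^ (m + s)) h (x + a)) has_field_derivative
      (\<Sum>m = 0..N - 1. u m * (deriv ^^ Suc (m + s)) h (x + a))) (at x)" for x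
    by (intro DERIV_sum DERIV_cmult d)
  thus ?case using Suc by (auto intro!: DERIV_imp_deriv)
qed

text \<open>The polynomials A, B with h^(s) = A h + B h' for every Airy solution h; the recursion
  differentiates this and replaces h'' by z h.\<close>

primrec airy_coeffs :: "nat \<Rightarrow> complex poly \<times> complex poly" where
  "airy_coeffs 0 = (1, 0)"
| "airy_coeffs (Suc s) = (pderiv (fst (airy_coeffs s)) + [:0, 1:] * snd (airy_coeffs s),
     fst (airy_coeffs s) + pderiv (snd (airy_coeffs s)))"

lemma deriv_pow_airy_entire:
  assumes "airy_entire h"
  shows "(deriv ^^ s) h = (\<lambda>x. poly (fst (airy_coeffs s)) x * h x + poly (snd (airy_coeffs s)) x * deriv h x)"
proof (induction s)
  case (Suc s)
  have h: "h holomorphic_on UNIV" "\<And>z. (deriv ^^ 2) h z = z * h z"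
    using assms by (auto simp: airy_entire_def)
  have "(deriv h has_field_derivative x * h x) (at x)" for x
    using entire_deriv_pow_DERIV[OF h(1), of 1 x] h(2) by (simp add: numeral_2_eq_2)
  hence "((\<lambda>x. poly (fst (airy_coeffs s)) x * h x + poly (snd (airy_coeffs s)) x * deriv h x)
      has_field_derivative poly (fst (airy_coeffs (Suc s))) x * h x
        + poly (snd (airy_coeffs (Suc s))) x * deriv h x) (at x)" for x
    using entire_DERIV[OF h(1), of x]
    by (auto intro!: derivative_eq_intros poly_DERIV simp: algebra_simps)
  thus ?case using Suc by (auto intro!: DERIV_imp_deriv)
qed simp

text \<open>With \<open>fst\<close> or \<open>snd\<close> for the selector, this is the coefficient
  of h(x + a) or h'(x + a) in the s-th derivative of \<open>comb_fun u N h a\<close>.\<close>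

definition comb_coeff :: "(complex poly \<times> complex poly \<Rightarrow> complex poly) \<Rightarrow> (nat \<Rightarrow> complex) \<Rightarrow> nat
    \<Rightarrow> complex \<Rightarrow> nat \<Rightarrow> complex poly" where
  "comb_coeff \<pi> u N a s = (\<Sum>m = 0..N - 1. Polynomial.smult (u m) (pcompose (\<pi> (airy_coeffs (m + s))) [:a, 1:]))"

lemma deriv_pow_comb_fun_airy:
  assumes "airy_entire h"
  shows "(deriv ^^ s) (comb_fun u N h a) x
    = poly (comb_coeff fst u N a s) x * h (x + a) + poly (comb_coeff snd u N a s) x * deriv h (x + a)"
proof -
  have h: "h holomorphic_on UNIV" using assms by (simp add: airy_entire_def)
  have pc: "poly (pcompose p [:a, 1:]) x = poly p (x + a)" for p
    by (simp add: poly_pcompose add.commute)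
  show ?thesis
    unfolding deriv_pow_comb_fun[OF h] deriv_pow_airy_entire[OF assms] comb_coeff_def
    by (simp add: poly_sum pc sum_distrib_right ring_distribs sum.distrib mult.assoc)
qed

text \<open>The matrix of derivatives is a matrix of polynomials times a block matrix built from the
  fundamental matrices of the shifted Airy equations, whose determinants are constant.\<close>

lemma det_airy_jets:
  fixes u :: "nat \<Rightarrow> nat \<Rightarrow> complex" and N :: "nat \<Rightarrow> nat" and b :: "nat \<Rightarrow> complex" and \<rho> :: "nat \<Rightarrow> nat" and d :: nat
  assumes "airy_entire h" "airy_entire k" "\<And>z. h z * deriv k z - k z * deriv h z = w"
  defines "F \<equiv> \<lambda>c. if c < d then comb_fun (u c) (N c) h (b c) else comb_fun (u (c - d)) (N (c - d)) k (b (c - d))"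
  defines "M \<equiv> Matrix.mat (d + d) (d + d) (\<lambda>(r, j). if j < d then comb_coeff fst (u j) (N j) (b j) (\<rho> r)
      else comb_coeff snd (u (j - d)) (N (j - d)) (b (j - d)) (\<rho> r))"
  shows "Determinant.det (Matrix.mat (d + d) (d + d) (\<lambda>(r, c). (deriv ^^ \<rho> r) (F c) x))
    = poly (Polynomial.smult (w ^ d) (Determinant.det M)) x"
proof -
  let ?n = "d + d"
  define A where "A = mat_diag d (\<lambda>j. h (x + b j))"
  define B where "B = mat_diag d (\<lambda>j. k (x + b j))"
  define C where "C = mat_diag d (\<lambda>j. deriv h (x + b j))"
  define E where "E = mat_diag d (\<lambda>j. deriv k (x + b j))"
  \<comment> \<open>The coefficients of the jets do not depend on whether \<open>h\<close> or
    \<open>k\<close> is used, because both families share the same \<open>u\<close>. So one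
    polynomial matrix serves both halves of the columns.\<close>
  define G where "G = four_block_mat A B C E"
  define Mx where "Mx = map_mat (\<lambda>p. poly p x) M"
  have car: "A \<in> carrier_mat d d" "B \<in> carrier_mat d d" "C \<in> carrier_mat d d" "E \<in> carrier_mat d d"
    by (simp_all add: A_def B_def C_def E_def)
  have G: "G \<in> carrier_mat ?n ?n" using car by (simp add: G_def)
  have Mx: "Mx \<in> carrier_mat ?n ?n" by (simp add: Mx_def M_def)
  have AE: "A * E = mat_diag d (\<lambda>j. h (x + b j) * deriv k (x + b j))"
    and BC: "B * C = mat_diag d (\<lambda>j. k (x + b j) * deriv h (x + b j))"
    by (simp_all add: A_def B_def C_def E_def)
  \<comment> \<open>The blocks are diagonal and commute, so det G is the determinant of this scalar
    matrix.\<close>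
  have "A * E - B * C = w \<cdot>\<^sub>m 1\<^sub>m d"
    unfolding AE BC using assms(3) by (intro eq_matI) (auto simp: mat_diag_def)
  hence detG: "Determinant.det G = w ^ d"
    unfolding G_def using car
    by (subst det_four_block_mat[of _ d]) (simp_all add: C_def E_def mult.commute)
  have "comm_ring_hom (\<lambda>p. poly p x)" by unfold_locales auto
  hence detM: "Determinant.det Mx = poly (Determinant.det M) x"
    unfolding Mx_def by (rule comm_ring_hom.hom_det)
  have "Matrix.mat ?n ?n (\<lambda>(r, c). (deriv ^^ \<rho> r) (F c) x) = Mx * G"
  proof (rule eq_matI)
    fix r c assume "r < dim_row (Mx * G)" "c < dim_col (Mx * G)"
    hence r: "r < ?n" and c: "c < ?n" using Mx G by auto
    have "(Mx * G) $$ (r, c) = (\<Sum>j = 0..<?n. Mx $$ (r, j) * G $$ (j, c))"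
      using Mx G r c by (simp add: scalar_prod_def)
    also have "\<dots> = (\<Sum>j = 0..<d. Mx $$ (r, j) * G $$ (j, c))
        + (\<Sum>j = d..<?n. Mx $$ (r, j) * G $$ (j, c))"
      by (rule sum.atLeastLessThan_concat[symmetric]) auto
    also have "(\<Sum>j = d..<?n. Mx $$ (r, j) * G $$ (j, c))
        = (\<Sum>j = 0..<d. Mx $$ (r, j + d) * G $$ (j + d, c))"
      using sum.shift_bounds_nat_ivl[of "\<lambda>j. Mx $$ (r, j) * G $$ (j, c)" 0 d d] by simp
    also have "(\<Sum>j = 0..<d. Mx $$ (r, j) * G $$ (j, c)) + \<dots> = (deriv ^^ \<rho> r) (F c) x"
    proof (cases "c < d")
      case True
      have "(\<Sum>j = 0..<d. Mx $$ (r, j) * G $$ (j, c)) = (\<Sum>j = 0..<d. if j = c then Mx $$ (r, c) * h (x + b c) else 0)"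
        using True car by (intro sum.cong) (auto simp: G_def A_def mat_diag_def)
      moreover have "(\<Sum>j = 0..<d. Mx $$ (r, j + d) * G $$ (j + d, c))
          = (\<Sum>j = 0..<d. if j = c then Mx $$ (r, c + d) * deriv h (x + b c) else 0)"
        using True car by (intro sum.cong) (auto simp: G_def A_def C_def mat_diag_def)
      ultimately show ?thesis
        using True r by (simp add: F_def deriv_pow_comb_fun_airy assms Mx_def M_def)
    next
      case False
      define e where "e = c - d"
      have e: "e < d" "c = e + d" using False c by (auto simp: e_def)
      have "(\<Sum>j = 0..<d. Mx $$ (r, j) * G $$ (j, c)) = (\<Sum>j = 0..<d. if j = e then Mx $$ (r, e) * k (x + b e) else 0)"
        using e car by (intro sum.cong) (auto simp: G_def A_def B_def mat_diag_def)
      moreover have "(\<Sum>j = 0..<d. Mx $$ (r, j + d) * G $$ (j + d, c))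
          = (\<Sum>j = 0..<d. if j = e then Mx $$ (r, e + d) * deriv k (x + b e) else 0)"
        using e car by (intro sum.cong) (auto simp: G_def A_def E_def mat_diag_def)
      ultimately show ?thesis
        using e r by (simp add: F_def deriv_pow_comb_fun_airy assms Mx_def M_def)
    qed
    finally show "Matrix.mat ?n ?n (\<lambda>(r, c). (deriv ^^ \<rho> r) (F c) x) $$ (r, c) = (Mx * G) $$ (r, c)"
      using r c by simp
  qed (use Mx G in auto)
  thus ?thesis using det_mult[OF Mx G] by (simp add: detG detM)
qed

text \<open>Laplace expansion along the last column: the coefficient of f^(i) is a signed minor,
  polynomial by \<open>det_airy_jets\<close>. The leading one is the Wronskian of \<open>hs\<close>,
  nonzero by independence.\<close>

lemma wronskian_op_exists:
  assumes "airy_entire h" "airy_entire k" "\<And>z. h z * deriv k z - k z * deriv h z = w"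
    and hs: "length hs = d + d"
      "\<And>c. c < d \<Longrightarrow> hs ! c = comb_fun (u c) (N c) h (b c)"
      "\<And>c. c < d \<Longrightarrow> hs ! (c + d) = comb_fun (u c) (N c) k (b c)"
    and ind: "fls_indep (d + d) (\<lambda>c. fexp (hs ! c))"
  shows "\<exists>P. is_wronskian_op hs P \<and> diffop_order P = d + d \<and> (\<forall>c<d + d. op_act P (fexp (hs ! c)) = 0)"
proof -
  let ?n = "d + d"
  have ent: "h holomorphic_on UNIV" "k holomorphic_on UNIV" using assms(1,2) by (auto simp: airy_entire_def)
  define F where "F = (\<lambda>c. if c < d then comb_fun (u c) (N c) h (b c)
      else comb_fun (u (c - d)) (N (c - d)) k (b (c - d)))"
  have hsF: "hs ! c = F c" if "c < ?n" for c
  proof (cases "c < d")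
    case False
    thus ?thesis using hs(3)[of "c - d"] that by (simp add: F_def)
  qed (simp add: F_def hs(2))
  have Fent: "F c holomorphic_on UNIV" for c
    unfolding F_def using comb_fun_entire[OF ent(1)] comb_fun_entire[OF ent(2)] by auto
  \<comment> \<open>Enumerates the derivative orders with i left out, as in the minor without row
    i.\<close>
  define skip where "skip = (\<lambda>i r :: nat. if r < i then r else Suc r)"
  define m where "m = (\<lambda>i x. Determinant.det (Matrix.mat ?n ?n (\<lambda>(r, c). (deriv ^^ skip i r) (F c) x)))"
  have "\<exists>p. \<forall>x. m i x = poly p x" for i
    unfolding m_def F_def using det_airy_jets[OF assms(1-3), of d "skip i" u N b] by blast
  then obtain p where p: "\<And>i x. m i x = poly (p i) x" by metis
  define c where "c = (\<lambda>i. if i \<le> ?n then Polynomial.smult ((-1) ^ (i + ?n)) (p i) else 0)"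
  define P where "P = (\<Sum>i\<le>?n. mult_op (to_fract (c i)) * D_op ^ i)"
  have coeff: "diffop_coeff P i = to_fract (c i)" for i
  proof -
    have "diffop_coeff P i = (\<Sum>j\<le>?n. if i = j then to_fract (c j) else 0)"
      by (simp add: P_def diffop_coeff_sum diffop_coeff_monom)
    thus ?thesis by (simp add: c_def)
  qed
  have op: "poly_op P" using coeff by (auto simp: poly_op_def)
  have ord: "diffop_order P \<le> ?n" by (rule diffop_order_le) (simp add: coeff c_def)
  have app: "diffop_apply P f x = (\<Sum>i<Suc ?n. (-1) ^ (i + ?n) * m i x * (deriv ^^ i) f x)" for f x
  proof -
    have "diffop_apply P f x = (\<Sum>i\<le>?n. poly (c i) x * (deriv ^^ i) f x)"
      unfolding diffop_apply_def
    proof (rule sum.mono_neutral_cong_left)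
      show "\<forall>i\<in>{..?n} - {..diffop_order P}. poly (c i) x * (deriv ^^ i) f x = 0"
        using coeff diffop_coeff_high[of P] by auto
    qed (use ord coeff in auto)
    also have "\<dots> = (\<Sum>i<Suc ?n. (-1) ^ (i + ?n) * m i x * (deriv ^^ i) f x)"
      by (rule sum.cong) (auto simp: c_def p)
    finally show ?thesis .
  qed
  have wron: "wronskian (hs @ [f]) x = diffop_apply P f x" for f x
  proof -
    define W where "W = Matrix.mat (Suc ?n) (Suc ?n) (\<lambda>(i, j). (deriv ^^ i) ((hs @ [f]) ! j) x)"
    have W: "W \<in> carrier_mat (Suc ?n) (Suc ?n)" by (simp add: W_def)
    have "mat_delete W i ?n = Matrix.mat ?n ?n (\<lambda>(r, c). (deriv ^^ skip i r) (F c) x)" if "i < Suc ?n" for i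
      by (rule eq_matI) (use that in \<open>auto simp: mat_delete_def W_def skip_def nth_append hs(1) hsF\<close>)
    hence "cofactor W i ?n = (-1) ^ (i + ?n) * m i x" if "i < Suc ?n" for i
      using that by (simp add: cofactor_def m_def)
    moreover have "W $$ (i, ?n) = (deriv ^^ i) f x" if "i < Suc ?n" for i
      using that by (simp add: W_def nth_append hs(1))
    ultimately have "Determinant.det W = (\<Sum>i<Suc ?n. (deriv ^^ i) f x * ((-1) ^ (i + ?n) * m i x))"
      using laplace_expansion_column[OF W, of ?n] by simp
    also have "\<dots> = diffop_apply P f x" unfolding app by (intro sum.cong) (auto simp: mult_ac)
    finally show ?thesis by (simp add: wronskian_def W_def hs(1))
  qed
  \<comment> \<open>Inserting a function already in the list repeats a column of the
    Wronskian.\<close>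
  have kill: "op_act P (fexp (hs ! j)) = 0" if j: "j < ?n" for j
  proof -
    have "diffop_apply P (hs ! j) x = 0" for x
    proof -
      let ?W = "Matrix.mat (Suc ?n) (Suc ?n) (\<lambda>(i, l). (deriv ^^ i) ((hs @ [hs ! j]) ! l) x)"
      have "col ?W j = col ?W ?n"
        using j hs(1) by (intro eq_vecI) (auto simp: nth_append)
      hence "Determinant.det ?W = 0"
        using j by (intro det_identical_columns[of ?W "Suc ?n" j ?n]) auto
      thus ?thesis by (simp add: wronskian_def hs(1) flip: wron)
    qed
    hence "diffop_apply P (hs ! j) = (\<lambda>x. 0)" by blast
    thus ?thesis
      using diffop_apply_poly_op(2)[OF op, of "hs ! j"] Fent hsF[OF j] by (simp add: fexp_const)
  qed
  \<comment> \<open>Leaving out the last row leaves exactly the full Wronskian matrix of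
    \<open>hs\<close>.\<close>
  have "c ?n \<noteq> 0"
  proof
    assume "c ?n = 0"
    hence "p ?n = 0" by (simp add: c_def)
    hence "(\<lambda>x. m ?n x) = (\<lambda>x. 0)" using p by simp
    moreover have "fexp (\<lambda>x. m ?n x) = Determinant.det (Matrix.mat ?n ?n (\<lambda>(i, j). fexp ((deriv ^^ skip ?n i) (F j))))"
      unfolding m_def by (rule fexp_det) (rule entire_deriv_pow[OF Fent])
    moreover have "Matrix.mat ?n ?n (\<lambda>(i, j). fexp ((deriv ^^ skip ?n i) (F j)))
        = Matrix.mat ?n ?n (\<lambda>(i, j). (fls_deriv ^^ i) (fexp (hs ! j)))"
      by (rule eq_matI) (auto simp: skip_def fexp_deriv_pow[OF Fent] hsF)
    ultimately show False using fls_indep_imp_wronskian[OF ind] by (simp add: fexp_const)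
  qed
  hence "?n \<le> diffop_order P" using diffop_coeff_high[of P ?n] by (auto simp: coeff not_le[symmetric])
  moreover have "is_wronskian_op hs P"
    unfolding is_wronskian_op_def using wron by simp
  ultimately show ?thesis using ord kill by (intro exI[of _ P]) auto
qed

section \<open>The eigenspaces of the Airy operator\<close>

lemma lin_indep_funs_iff:
  assumes "\<And>i. i < length hs \<Longrightarrow> (hs ! i) holomorphic_on UNIV"
  shows "lin_indep_funs hs \<longleftrightarrow> fls_indep (length hs) (\<lambda>i. fexp (hs ! i))"
proof -
  have "(\<forall>x. (\<Sum>i<length hs. c i * (hs ! i) x) = 0) \<longleftrightarrow> (\<Sum>i<length hs. fls_const (c i) * fexp (hs ! i)) = 0"
    for c
  proof -
    have hol: "(\<lambda>x. \<Sum>i<length hs. c i * (hs ! i) x) holomorphic_on UNIV"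
      using assms by (intro holomorphic_intros) auto
    have eq: "fexp (\<lambda>x. \<Sum>i<length hs. c i * (hs ! i) x) = (\<Sum>i<length hs. fls_const (c i) * fexp (hs ! i))"
      using assms by (subst fexp_sum) (auto simp: fexp_mult fexp_const intro!: holomorphic_intros)
    have "(\<forall>x. (\<Sum>i<length hs. c i * (hs ! i) x) = 0) \<longleftrightarrow> fexp (\<lambda>x. \<Sum>i<length hs. c i * (hs ! i) x) = 0"
    proof
      assume "\<forall>x. (\<Sum>i<length hs. c i * (hs ! i) x) = 0"
      thus "fexp (\<lambda>x. \<Sum>i<length hs. c i * (hs ! i) x) = 0" by (simp add: fexp_const)
    qed (use fexp_eq_0_imp[OF hol] in blast)
    thus ?thesis unfolding eq .
  qed
  thus ?thesis by (simp add: lin_indep_funs_def fls_indep_def)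
qed

lemma fun_list_nth:
  "length (fun_list d f g) = d + d"
  "c < d \<Longrightarrow> fun_list d f g ! c = f (Suc c)"
  "c < d \<Longrightarrow> fun_list d f g ! (c + d) = g (Suc c)"
  by (simp_all add: fun_list_def nth_append del: upt_Suc)

locale airy_eigenspaces =
  fixes r d :: nat and a :: "nat \<Rightarrow> complex" and ds :: "nat \<Rightarrow> nat" and q :: "complex poly"
  assumes r: "1 \<le> r"
    and inj: "inj_on a {1..r}"
    and pos: "\<forall>k\<in>{1..r}. 0 < ds k"
    and q: "q = (\<Prod>k = 1..r. [:- a k, 1:] ^ ds k)"
    and d: "d = (\<Sum>k = 1..r. ds k)"
begin

abbreviation Q :: diffop where
  "Q \<equiv> poly_at_diffop q Airy_op ^ 2"

lemma Q_eq: "Q = poly_at_diffop (q ^ 2) Airy_op"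
  by (rule poly_at_diffop_power[symmetric])

lemma eigen_dvd: "k \<in> {1..r} \<Longrightarrow> [:- a k, 1:] ^ (2 * ds k) dvd q ^ 2"
  unfolding q power_even_eq power2_eq_square
  by (intro mult_dvd_mono dvd_prodI) auto

lemma d_pos: "0 < d"
  using r pos unfolding d by (intro sum_pos) auto

lemma Q_monic: "op_lead Q = 1" "diffop_order Q = 2 * (d + d)"
proof -
  have 1: "op_lead (poly_at_diffop q Airy_op) = 1" "diffop_order (poly_at_diffop q Airy_op) = 2 * d"
    using op_Airy_monic[of "{1..r}" a ds] unfolding q d by auto
  hence "poly_at_diffop q Airy_op \<noteq> 0" by (metis op_lead_eq_0_iff zero_neq_one)
  thus "op_lead Q = 1" "diffop_order Q = 2 * (d + d)"
    using 1 by (simp_all add: op_lead_power order_power)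
qed

lemma Q_adjoint: "formal_adjoint Q = Q"
  by (simp add: Q_eq formal_adjoint_Airy_poly)

definition eigen :: "(complex \<Rightarrow> complex) \<Rightarrow> nat \<Rightarrow> (nat \<Rightarrow> complex) \<Rightarrow> complex fls" where
  "eigen h k u = airy_comb u (2 * ds k) (fexp (\<lambda>x. h (x + a k)))"

lemma fexp_comb_fun_eigen:
  "airy_entire h \<Longrightarrow> k \<in> {1..r} \<Longrightarrow> fexp (comb_fun u (2 * ds k) h (a k)) = eigen h k u"
  using pos by (simp add: eigen_def fexp_comb_fun airy_entire_def)

lemma Q_kills_eigen:
  "airy_entire h \<Longrightarrow> k \<in> {1..r} \<Longrightarrow> op_act Q (eigen h k u) = 0"
  unfolding Q_eq eigen_def by (rule Airy_poly_kills_comb[OF airy_ode_shift eigen_dvd])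

lemma concomitant_eigen:
  assumes "airy_entire h" "airy_entire h'" "k \<in> {1..r}"
  shows "concomitant Q (eigen h k u) (eigen h' k v)
    = fls_const (bilinear_form q (a k) (ds k) u v)
      * wr (fexp (\<lambda>x. h (x + a k))) (fexp (\<lambda>x. h' (x + a k)))"
  unfolding Q_eq eigen_def
  by (rule concomitant_Airy_bilinear_form[OF airy_ode_shift airy_ode_shift _ eigen_dvd])
    (use assms pos in auto)

lemma concomitant_eigen_orthogonal:
  assumes "airy_entire h" "airy_entire h'" "k \<in> {1..r}" "k' \<in> {1..r}" "k \<noteq> k'"
  shows "concomitant Q (eigen h k u) (eigen h' k' v) = 0"
proof -
  have "a k \<noteq> a k'" using inj_onD[OF inj _ assms(3,4)] assms(5) by blast
  thus ?thesis unfolding Q_eq eigen_def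
    by (rule concomitant_Airy_orthogonal[OF _ airy_ode_shift airy_ode_shift eigen_dvd eigen_dvd])
      (use assms in auto)
qed

text \<open>Isotropy of the span has two sources: for different eigenvalues the concomitant vanishes
  by coprimality, for equal ones it is the bilinear form times a Wronskian.\<close>

lemma airy_data_factorization:
  assumes "airy_data r a ds d q l \<alpha> f g"
  shows "\<exists>P. is_wronskian_op (fun_list d f g) P \<and> diffop_order P = d + d \<and>
    self_adjoint_factorization Q P (op_lead P) \<and>
    fls_indep (d + d) (\<lambda>c. fexp (fun_list d f g ! c)) \<and>
    (\<forall>c<d + d. op_act P (fexp (fun_list d f g ! c)) = 0)"
proof -
  let ?hs = "fun_list d f g"
  have l: "\<And>i. i \<in> {1..d} \<Longrightarrow> l i \<in> {1..r}" using assms by (auto simp: airy_data_def)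
  have f: "f i = comb_fun (\<alpha> i) (2 * ds (l i)) Ai (a (l i))"
    and g: "g i = comb_fun (\<alpha> i) (2 * ds (l i)) Bi (a (l i))" if "i \<in> {1..d}" for i
    using assms that unfolding airy_data_def comb_fun_def by (auto intro!: ext)
  have bil: "bilinear_form q (a (l i)) (ds (l i)) (\<alpha> i) (\<alpha> j) = 0"
    if "i \<in> {1..d}" "j \<in> {1..d}" "l i = l j" for i j
    using assms that l unfolding airy_data_def by metis
  note AB = Ai_Bi_properties
  have ent: "Ai holomorphic_on UNIV" "Bi holomorphic_on UNIV" using AB by (auto simp: airy_entire_def)
  have hs: "\<exists>h i. airy_entire h \<and> i \<in> {1..d} \<and> ?hs ! c = comb_fun (\<alpha> i) (2 * ds (l i)) h (a (l i))"
    if "c < d + d" for c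
  proof (cases "c < d")
    case True
    thus ?thesis using f[of "Suc c"] AB(1) by (intro exI[of _ Ai] exI[of _ "Suc c"]) (auto simp: fun_list_nth)
  next
    case False
    hence "?hs ! c = g (Suc (c - d))" using fun_list_nth(3)[of "c - d" d f g] that by simp
    thus ?thesis using g[of "Suc (c - d)"] AB(2) False that
      by (intro exI[of _ Bi] exI[of _ "Suc (c - d)"]) auto
  qed
  have hs_eigen: "\<exists>h i. airy_entire h \<and> i \<in> {1..d} \<and> fexp (?hs ! c) = eigen h (l i) (\<alpha> i)"
    if "c < d + d" for c
    using hs[OF that] fexp_comb_fun_eigen l by metis
  have hs_ent: "(?hs ! c) holomorphic_on UNIV" if "c < d + d" for c
    using hs[OF that] comb_fun_entire by (metis airy_entire_def)
  have ind: "fls_indep (d + d) (\<lambda>c. fexp (?hs ! c))"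
    using assms lin_indep_funs_iff[of ?hs] hs_ent by (auto simp: airy_data_def fun_list_nth)
  obtain w where w: "\<And>z. Ai z * deriv Bi z - Bi z * deriv Ai z = w" using AB(3) by blast
  obtain P where P: "is_wronskian_op ?hs P" "diffop_order P = d + d"
    "\<forall>c<d + d. op_act P (fexp (?hs ! c)) = 0"
    using wronskian_op_exists[OF AB(1,2) w fun_list_nth(1), where u = "\<lambda>c. \<alpha> (Suc c)"
        and N = "\<lambda>c. 2 * ds (l (Suc c))" and b = "\<lambda>c. a (l (Suc c))", of d f g] ind f g
    by (auto simp: fun_list_nth)
  have "self_adjoint_factorization Q P (op_lead P)"
  proof (rule factorization_if_isotropic[OF ind P(3,2)])
    show "\<forall>i<d + d. op_act Q (fexp (?hs ! i)) = 0"
      using hs_eigen Q_kills_eigen l by metis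
    show "\<forall>i<d + d. \<forall>j<d + d. concomitant Q (fexp (?hs ! i)) (fexp (?hs ! j)) = 0"
    proof (intro allI impI)
      fix i j assume "i < d + d" "j < d + d"
      then obtain h i' h' j' where *: "airy_entire h" "i' \<in> {1..d}" "fexp (?hs ! i) = eigen h (l i') (\<alpha> i')"
        "airy_entire h'" "j' \<in> {1..d}" "fexp (?hs ! j) = eigen h' (l j') (\<alpha> j')"
        using hs_eigen by metis
      show "concomitant Q (fexp (?hs ! i)) (fexp (?hs ! j)) = 0"
      proof (cases "l i' = l j'")
        case True
        have "concomitant Q (eigen h (l j') (\<alpha> i')) (eigen h' (l j') (\<alpha> j')) = 0"
          using concomitant_eigen[OF *(1,4) l[OF *(5)]] bil[OF *(2,5) True] True by simp
        thus ?thesis using * True by simp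
      next
        case False
        thus ?thesis using concomitant_eigen_orthogonal * l by simp
      qed
    qed
  qed (use d_pos Q_monic Q_adjoint in auto)
  thus ?thesis using P ind by blast
qed

end

section \<open>The kernel of a rational factor\<close>

lemma kernel_card_le_order:
  assumes "finite J" "P \<noteq> 0" "\<And>j. j \<in> J \<Longrightarrow> op_act P (\<phi> j) = 0"
    and ind: "\<And>c j. (\<Sum>j\<in>J. fls_const (c j) * \<phi> j) = 0 \<Longrightarrow> j \<in> J \<Longrightarrow> c j = 0"
  shows "card J \<le> diffop_order P"
proof -
  obtain \<beta> where \<beta>: "bij_betw \<beta> {0..<card J} J" using ex_bij_betw_nat_finite[OF assms(1)] by blast
  have img: "\<beta> i \<in> J" if "i < card J" for i using bij_betwE[OF \<beta>] that by auto
  have "fls_indep (card J) (\<lambda>i. \<phi> (\<beta> i))"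
    unfolding fls_indep_def
  proof (intro allI impI)
    fix c i assume c: "(\<Sum>i<card J. fls_const (c i) * \<phi> (\<beta> i)) = 0" and i: "i < card J"
    define c' where "c' = (\<lambda>j. c (inv_into {0..<card J} \<beta> j))"
    have c': "c' (\<beta> i) = c i" if "i < card J" for i
      using that bij_betw_inv_into_left[OF \<beta>] by (simp add: c'_def)
    have "(\<Sum>j\<in>J. fls_const (c' j) * \<phi> j) = (\<Sum>i\<in>{0..<card J}. fls_const (c' (\<beta> i)) * \<phi> (\<beta> i))"
      using sum.reindex_bij_betw[OF \<beta>, of "\<lambda>j. fls_const (c' j) * \<phi> j"] by simp
    also have "\<dots> = (\<Sum>i<card J. fls_const (c i) * \<phi> (\<beta> i))"
      by (intro sum.cong) (auto simp: c')
    finally have "c' (\<beta> i) = 0" using c img[OF i] by (intro ind) simp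
    thus "c i = 0" using c'[OF i] by simp
  qed
  thus ?thesis using kernel_dim_le_order[OF assms(2)] assms(3) img by blast
qed

text \<open>The order of quantifiers is the point: \<open>R\<close> and \<open>S\<close> serve all
  solutions Y at once. If they vanish, then \<open>T\<close> kills every solution of the
  equation.\<close>

definition jet_rep :: "complex \<Rightarrow> (complex fls \<Rightarrow> complex fls) \<Rightarrow> bool" where
  "jet_rep a T \<longleftrightarrow> (\<exists>R S. \<forall>Y. airy_ode a Y \<longrightarrow> T Y = ratfun_fls R * Y + ratfun_fls S * fls_deriv Y)"

lemma jet_rep_id: "jet_rep a (\<lambda>Y. Y)"
  unfolding jet_rep_def by (intro exI[of _ 1] exI[of _ 0]) simp

lemma jet_rep_0: "jet_rep a (\<lambda>Y. 0)"
  unfolding jet_rep_def by (intro exI[of _ 0]) simp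

lemma jet_rep_add: "jet_rep a T \<Longrightarrow> jet_rep a T' \<Longrightarrow> jet_rep a (\<lambda>Y. T Y + T' Y)"
  unfolding jet_rep_def
proof (elim exE)
  fix R S R' S'
  assume "\<forall>Y. airy_ode a Y \<longrightarrow> T Y = ratfun_fls R * Y + ratfun_fls S * fls_deriv Y"
    and "\<forall>Y. airy_ode a Y \<longrightarrow> T' Y = ratfun_fls R' * Y + ratfun_fls S' * fls_deriv Y"
  thus "\<exists>R S. \<forall>Y. airy_ode a Y \<longrightarrow> T Y + T' Y = ratfun_fls R * Y + ratfun_fls S * fls_deriv Y"
    by (intro exI[of _ "R + R'"] exI[of _ "S + S'"]) (simp add: ratfun_fls_add algebra_simps)
qed

lemma jet_rep_mult: "jet_rep a T \<Longrightarrow> jet_rep a (\<lambda>Y. ratfun_fls c * T Y)"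
  unfolding jet_rep_def
proof (elim exE)
  fix R S
  assume "\<forall>Y. airy_ode a Y \<longrightarrow> T Y = ratfun_fls R * Y + ratfun_fls S * fls_deriv Y"
  thus "\<exists>R S. \<forall>Y. airy_ode a Y \<longrightarrow> ratfun_fls c * T Y = ratfun_fls R * Y + ratfun_fls S * fls_deriv Y"
    by (intro exI[of _ "c * R"] exI[of _ "c * S"]) (simp add: ratfun_fls_mult ring_distribs mult.assoc)
qed

lemma jet_rep_deriv: "jet_rep a T \<Longrightarrow> jet_rep a (\<lambda>Y. fls_deriv (T Y))"
  unfolding jet_rep_def
proof (elim exE)
  fix R S
  assume "\<forall>Y. airy_ode a Y \<longrightarrow> T Y = ratfun_fls R * Y + ratfun_fls S * fls_deriv Y"
  thus "\<exists>R S. \<forall>Y. airy_ode a Y \<longrightarrow> fls_deriv (T Y) = ratfun_fls R * Y + ratfun_fls S * fls_deriv Y"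
    by (intro exI[of _ "ratfun_deriv R + S * to_fract [:a, 1:]"] exI[of _ "R + ratfun_deriv S"])
      (simp add: airy_ode_def ratfun_fls_add ratfun_fls_mult ratfun_fls_deriv algebra_simps)
qed

lemma jet_rep_sum: "(\<And>i. i \<in> I \<Longrightarrow> jet_rep a (T i)) \<Longrightarrow> jet_rep a (\<lambda>Y. \<Sum>i\<in>I. T i Y)"
  by (induction I rule: infinite_finite_induct) (simp_all add: jet_rep_0 jet_rep_add)

lemma jet_rep_deriv_pow: "jet_rep a T \<Longrightarrow> jet_rep a (\<lambda>Y. (fls_deriv ^^ n) (T Y))"
  by (induction n) (simp_all add: jet_rep_deriv)

lemma jet_rep_op_comb: "jet_rep a (\<lambda>Y. op_act P (airy_comb u N Y))"
proof -
  have "fls_const c = ratfun_fls (to_fract [:c:])" for c by (simp add: poly_fls_const)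
  thus ?thesis
    unfolding op_act_eq airy_comb_def
    by (simp only:) (intro jet_rep_sum jet_rep_mult jet_rep_deriv_pow jet_rep_id)
qed

text \<open>Applying (L - a)^N to a combination of length N + 1 leaves only N! u_N Y, so the
  coefficients vanish from the top down.\<close>

lemma airy_comb_eq_0_imp:
  assumes "airy_ode a Y" "Y \<noteq> 0" "airy_comb u N Y = 0" "m < N"
  shows "u m = 0"
  using assms(3,4)
proof (induction N arbitrary: m)
  case (Suc N)
  let ?A = "poly_at_diffop [:- a, 1:] Airy_op ^ N"
  have "op_act ?A (airy_comb u (Suc N) Y) = (\<Sum>m<Suc N. fls_const (u m) *
      (if N \<le> m then fls_const (fact m / fact (m - N)) * (fls_deriv ^^ (m - N)) Y else 0))"
    unfolding airy_comb_def op_act_fsum op_act_const op_act_Airy_linear_pow[OF assms(1)] ..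
  also have "\<dots> = fls_const (u N) * (fls_const (fact N) * Y)" by simp
  finally have "u N = 0" using Suc.prems(1) assms(2) by simp
  moreover have "airy_comb u N Y = 0" using Suc.prems(1) \<open>u N = 0\<close> by (simp add: airy_comb_def)
  ultimately show ?case using Suc.IH Suc.prems(2) by (cases "m = N") auto
qed simp

lemma airy_comb_linear:
  assumes "finite D"
  shows "airy_comb (coeff (\<Sum>p\<in>D. Polynomial.smult (c p) p)) N Y
    = (\<Sum>p\<in>D. fls_const (c p) * airy_comb (coeff p) N Y)"
  using assms
proof (induction D rule: finite_induct)
  case (insert p D)
  have lin: "airy_comb (coeff (Polynomial.smult e p + s)) N Y
      = fls_const e * airy_comb (coeff p) N Y + airy_comb (coeff s) N Y" for e s
    by (simp add: airy_comb_def sum_distrib_left ring_distribs sum.distrib mult.assoc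
        flip: fls_plus_const fls_const_mult_const)
  show ?case unfolding sum.insert[OF insert.hyps] lin insert.IH ..
qed (simp add: airy_comb_def)

lemma wr_independent:
  assumes "fls_const c * A + fls_const e * B = 0" "wr A B \<noteq> 0"
  shows "c = 0 \<and> e = 0"
proof -
  have z: "wr (fls_const c * A + fls_const e * B) X = fls_const c * wr A X + fls_const e * wr B X" for X
    by (simp add: wr_def algebra_simps)
  have [simp]: "wr X X = 0" "wr 0 X = 0" for X by (simp_all add: wr_def mult.commute)
  have "wr B A = - wr A B" by (simp add: wr_def algebra_simps)
  hence "wr B A \<noteq> 0" using assms(2) by simp
  thus ?thesis using z[of A, unfolded assms(1)] z[of B, unfolded assms(1)] assms(2) by simp
qed

text \<open>Coefficient vectors are encoded as polynomials, which makes spans, bases and basis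
  extension over C available for them.\<close>

interpretation poly_vs: vector_space "Polynomial.smult :: complex \<Rightarrow> complex poly \<Rightarrow> complex poly"
  by unfold_locales (simp_all add: smult_add_right smult_add_left)

definition poly_below :: "nat \<Rightarrow> complex poly set" where
  "poly_below N = {p. \<forall>i\<ge>N. coeff p i = 0}"

text \<open>The monomials below N are independent and spanning, so the exchange bound applies in
  both directions.\<close>

lemma poly_below_basis_card:
  assumes "poly_vs.independent C" "C \<subseteq> poly_below N" "poly_below N \<subseteq> poly_vs.span C"
  shows "finite C \<and> card C = N"
proof -
  define M where "M = Polynomial.monom (1::complex) ` {..<N}"
  have inj: "inj_on (Polynomial.monom (1::complex)) {..<N}"
    by (rule inj_onI) (metis degree_monom_eq zero_neq_one)
  have M: "finite M" "card M = N" using inj by (simp_all add: M_def card_image)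
  have "poly_below N \<subseteq> poly_vs.span M"
  proof
    fix p assume p: "p \<in> poly_below N"
    have "p = (\<Sum>i<N. Polynomial.smult (coeff p i) (Polynomial.monom 1 i))"
    proof (rule poly_eqI)
      fix j
      show "coeff p j = coeff (\<Sum>i<N. Polynomial.smult (coeff p i) (Polynomial.monom 1 i)) j"
        using p by (cases "j < N") (auto simp: coeff_sum poly_below_def if_distrib cong: if_cong)
    qed
    also have "\<dots> \<in> poly_vs.span M"
      by (intro poly_vs.span_sum poly_vs.span_scale poly_vs.span_base) (simp add: M_def)
    finally show "p \<in> poly_vs.span M" .
  qed
  hence 1: "finite C \<and> card C \<le> N"
    using poly_vs.independent_span_bound[OF M(1) assms(1)] assms(2) M(2) by auto
  have "poly_vs.independent M"
  proof (rule poly_vs.independent_if_scalars_zero[OF M(1)])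
    fix c x assume c: "(\<Sum>x\<in>M. Polynomial.smult (c x) x) = 0" and "x \<in> M"
    then obtain j where j: "j < N" "x = Polynomial.monom 1 j" by (auto simp: M_def)
    have "0 = coeff (\<Sum>i<N. Polynomial.smult (c (Polynomial.monom 1 i)) (Polynomial.monom 1 i)) j"
      using c unfolding M_def sum.reindex[OF inj] o_def by simp
    also have "\<dots> = c x" using j by (simp add: coeff_sum if_distrib cong: if_cong)
    finally show "c x = 0" by simp
  qed
  moreover have "M \<subseteq> poly_below N" by (auto simp: M_def poly_below_def)
  ultimately have "card M \<le> card C"
    using poly_vs.independent_span_bound[of C M] 1 assms(3) by blast
  thus ?thesis using 1 M(2) by simp
qed

section \<open>Splitting kernels along eigenvalues, uniformly in the Airy solution\<close>

context airy_eigenspaces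
begin

text \<open>A boolean index lets sums and families range over both solutions.\<close>

definition airy_fun :: "bool \<Rightarrow> complex \<Rightarrow> complex" where
  "airy_fun b = (if b then Bi else Ai)"

lemma airy_entire_airy_fun: "airy_entire (airy_fun b)"
  using Ai_Bi_properties by (simp add: airy_fun_def)

definition airy_sol_at :: "nat \<times> bool \<Rightarrow> complex fls" where
  "airy_sol_at = (\<lambda>(k, b). fexp (\<lambda>x. airy_fun b (x + a k)))"

lemma airy_sol_at_ode: "airy_ode (a k) (airy_sol_at (k, b))"
  unfolding airy_sol_at_def prod.case by (rule airy_ode_shift[OF airy_entire_airy_fun])

lemma wr_airy_sol_at: "wr (airy_sol_at (k, False)) (airy_sol_at (k, True)) \<noteq> 0"
proof -
  have A: "Ai holomorphic_on UNIV" and B: "Bi holomorphic_on UNIV"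
    using Ai_Bi_properties by (auto simp: airy_entire_def)
  obtain w where w: "w \<noteq> 0" "\<And>z. Ai z * deriv Bi z - Bi z * deriv Ai z = w"
    using Ai_Bi_properties(3) by blast
  let ?A = "\<lambda>x. Ai (x + a k)" and ?B = "\<lambda>x. Bi (x + a k)"
  have hol: "?A holomorphic_on UNIV" "?B holomorphic_on UNIV" using shift_entire A B by blast+
  have d: "deriv ?A = (\<lambda>x. deriv Ai (x + a k))" "deriv ?B = (\<lambda>x. deriv Bi (x + a k))"
    using deriv_pow_shift[OF A, of 1 "a k"] deriv_pow_shift[OF B, of 1 "a k"] by simp_all
  have hold: "deriv ?A holomorphic_on UNIV" "deriv ?B holomorphic_on UNIV"
    using entire_deriv_pow[OF hol(1), of 1] entire_deriv_pow[OF hol(2), of 1] by simp_all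
  have "wr (fexp ?A) (fexp ?B) + fls_const w = wr (fexp ?A) (fexp ?B) +
      fexp (\<lambda>x. ?A x * deriv ?B x + (- 1) * (?B x * deriv ?A x))"
    using w(2) by (simp add: d fexp_const)
  also have "fexp (\<lambda>x. ?A x * deriv ?B x + (- 1) * (?B x * deriv ?A x))
      = fexp ?A * fexp (deriv ?B) + fls_const (- 1) * (fexp ?B * fexp (deriv ?A))"
  proof -
    have h1: "(\<lambda>x. ?A x * deriv ?B x) holomorphic_on UNIV" by (intro holomorphic_on_mult hol hold)
    have h2: "(\<lambda>x. ?B x * deriv ?A x) holomorphic_on UNIV" by (intro holomorphic_on_mult hol hold)
    have h3: "(\<lambda>x. (- 1) * (?B x * deriv ?A x)) holomorphic_on UNIV"
      by (intro holomorphic_on_mult holomorphic_on_const hol hold)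
    show ?thesis
      unfolding fexp_add[OF h1 h3] fexp_mult[OF hol(1) hold(2)] fexp_mult[OF holomorphic_on_const h2]
        fexp_mult[OF hol(2) hold(1)] fexp_const ..
  qed
  also have "wr (fexp ?A) (fexp ?B) + \<dots> = 0"
    using hol by (simp add: wr_def fexp_deriv mult_ac)
  finally have "wr (fexp ?A) (fexp ?B) = - fls_const w" by (simp add: eq_neg_iff_add_eq_0)
  thus ?thesis using w(1) by (simp add: airy_sol_at_def airy_fun_def)
qed

lemma airy_sol_at_nonzero: "airy_sol_at (k, b) \<noteq> 0"
  using wr_airy_sol_at[of k] by (cases b) (auto simp: wr_def)

text \<open>Since \<open>a\<close> is injective, each eigenvalue contributes just the two solutions
  of one index k, and their nonzero Wronskian gives independence over the constants.\<close>

lemma airy_sol_at_jets: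
  assumes "jet_comb airy_sol_at ({1..r} \<times> UNIV) R S = 0" "k \<in> {1..r}"
  shows "R (k, b) = 0 \<and> S (k, b) = 0"
proof -
  have "\<forall>i\<in>{1..r} \<times> UNIV. R i = 0 \<and> S i = 0"
  proof (rule airy_jets_independent[where a = "\<lambda>i. a (fst i)", OF _ _ _ assms(1)])
    show "\<forall>i\<in>{1..r} \<times> UNIV. fls_deriv (fls_deriv (airy_sol_at i)) = poly_fls [:a (fst i), 1:] * airy_sol_at i"
      using airy_sol_at_ode by (auto simp: airy_ode_def)
    fix b :: complex and c
    assume c: "(\<Sum>i\<in>{i \<in> {1..r} \<times> UNIV. a (fst i) = b}. fls_const (c i) * airy_sol_at i) = 0"
    show "\<forall>i\<in>{1..r} \<times> UNIV. a (fst i) = b \<longrightarrow> c i = 0"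
    proof (intro ballI impI)
      fix i :: "nat \<times> bool" assume i: "i \<in> {1..r} \<times> UNIV" "a (fst i) = b"
      define k where "k = fst i"
      have k: "k \<in> {1..r}" "a k = b" using i by (auto simp: k_def)
      have "{i \<in> {1..r} \<times> UNIV. a (fst i) = b} = {(k, False), (k, True)}"
      proof (rule Set.set_eqI)
        fix j :: "nat \<times> bool"
        obtain k' b' where j: "j = (k', b')" by fastforce
        have "k' \<in> {1..r} \<and> a k' = b \<longleftrightarrow> k' = k" using inj_onD[OF inj, of k' k] k by metis
        thus "j \<in> {i \<in> {1..r} \<times> UNIV. a (fst i) = b} \<longleftrightarrow> j \<in> {(k, False), (k, True)}"
          using j by (cases b') auto
      qed
      hence "fls_const (c (k, False)) * airy_sol_at (k, False) + fls_const (c (k, True)) * airy_sol_at (k, True) = 0"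
        using c by simp
      hence "c (k, False) = 0 \<and> c (k, True) = 0" using wr_independent wr_airy_sol_at by blast
      thus "c i = 0" by (cases i; cases "snd i") (auto simp: k_def)
    qed
  qed simp
  thus ?thesis using assms(2) by blast
qed

text \<open>The jets of the images have rational coefficients that vanish by independence over C(x).
  These do not depend on the solution chosen, so the conclusion holds for every \<open>Y\<close>,
  although only the Ai and Bi combinations enter the hypothesis.\<close>

lemma kills_components:
  assumes "(\<Sum>(k, b)\<in>{1..r} \<times> UNIV. op_act P (eigen (airy_fun b) k (U k b))) = 0"
    and "k \<in> {1..r}" "airy_ode (a k) Y"
  shows "op_act P (airy_comb (U k b) (2 * ds k) Y) = 0"
proof -
  have "\<forall>k b. \<exists>R S. \<forall>Y. airy_ode (a k) Y \<longrightarrow>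
      op_act P (airy_comb (U k b) (2 * ds k) Y) = ratfun_fls R * Y + ratfun_fls S * fls_deriv Y"
    using jet_rep_op_comb unfolding jet_rep_def by blast
  then obtain R S where RS: "\<And>k b Y. airy_ode (a k) Y \<Longrightarrow>
      op_act P (airy_comb (U k b) (2 * ds k) Y) = ratfun_fls (R k b) * Y + ratfun_fls (S k b) * fls_deriv Y"
    by metis
  have "op_act P (eigen (airy_fun b) k (U k b))
      = ratfun_fls (R k b) * airy_sol_at (k, b) + ratfun_fls (S k b) * fls_deriv (airy_sol_at (k, b))" for k b
    using RS[OF airy_sol_at_ode, of k b b] by (simp add: eigen_def airy_sol_at_def)
  hence "jet_comb airy_sol_at ({1..r} \<times> UNIV) (\<lambda>(k, b). R k b) (\<lambda>(k, b). S k b) = 0"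
    using assms(1) by (simp add: jet_comb_def case_prod_unfold)
  hence "R k b = 0 \<and> S k b = 0" using airy_sol_at_jets[OF _ assms(2), where b = b] by fastforce
  thus ?thesis using RS[OF assms(3)] by simp
qed

lemma family_sum:
  assumes "\<And>k. k \<in> {1..r} \<Longrightarrow> finite (D k)"
  shows "(\<Sum>((k, p), b)\<in>(SIGMA k:{1..r}. D k) \<times> UNIV.
      fls_const (c ((k, p), b)) * op_act P (eigen (airy_fun b) k (coeff p)))
    = (\<Sum>(k, b)\<in>{1..r} \<times> UNIV. op_act P (eigen (airy_fun b) k
        (coeff (\<Sum>p\<in>D k. Polynomial.smult (c ((k, p), b)) p))))"
proof -
  have "op_act P (eigen (airy_fun b) k (coeff (\<Sum>p\<in>D k. Polynomial.smult (c ((k, p), b)) p)))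
      = (\<Sum>p\<in>D k. fls_const (c ((k, p), b)) * op_act P (eigen (airy_fun b) k (coeff p)))"
    if "k \<in> {1..r}" for k b
    unfolding eigen_def airy_comb_linear[OF assms[OF that]] op_act_fsum op_act_const ..
  hence "(\<Sum>(k, b)\<in>{1..r} \<times> UNIV. op_act P (eigen (airy_fun b) k
        (coeff (\<Sum>p\<in>D k. Polynomial.smult (c ((k, p), b)) p))))
      = (\<Sum>k\<in>{1..r}. \<Sum>b\<in>UNIV. \<Sum>p\<in>D k. fls_const (c ((k, p), b)) * op_act P (eigen (airy_fun b) k (coeff p)))"
    unfolding sum.cartesian_product[symmetric] by (intro sum.cong refl) auto
  also have "\<dots> = (\<Sum>k\<in>{1..r}. \<Sum>p\<in>D k. \<Sum>b\<in>UNIV.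
      fls_const (c ((k, p), b)) * op_act P (eigen (airy_fun b) k (coeff p)))"
    by (intro sum.cong refl sum.swap)
  also have "\<dots> = (\<Sum>(k, p)\<in>(SIGMA k:{1..r}. D k). \<Sum>b\<in>UNIV.
      fls_const (c ((k, p), b)) * op_act P (eigen (airy_fun b) k (coeff p)))"
    using assms by (intro sum.Sigma) auto
  also have "\<dots> = (\<Sum>((k, p), b)\<in>(SIGMA k:{1..r}. D k) \<times> UNIV.
      fls_const (c ((k, p), b)) * op_act P (eigen (airy_fun b) k (coeff p)))"
    by (simp add: sum.cartesian_product case_prod_unfold)
  finally show ?thesis by simp
qed

text \<open>Asking for all solutions Y makes each element yield a pair f_i, g_i with common
  coefficients.\<close>

definition poly_kernel :: "diffop \<Rightarrow> nat \<Rightarrow> complex poly set" where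
  "poly_kernel P k = {p \<in> poly_below (2 * ds k).
     \<forall>Y. airy_ode (a k) Y \<longrightarrow> op_act P (airy_comb (coeff p) (2 * ds k) Y) = 0}"

lemma poly_below_subspace: "finite D \<Longrightarrow> D \<subseteq> poly_below N \<Longrightarrow> (\<Sum>p\<in>D. Polynomial.smult (c p) p) \<in> poly_below N"
  by (auto simp: poly_below_def coeff_sum subset_iff)

text \<open>The splitting of kernels applied to the identity operator separates the components;
  within one of them independence is that of the coefficient polynomials.\<close>

lemma eigen_family_independent:
  assumes D: "\<And>k. k \<in> {1..r} \<Longrightarrow> finite (D k)" "\<And>k. k \<in> {1..r} \<Longrightarrow> poly_vs.independent (D k)"
      "\<And>k. k \<in> {1..r} \<Longrightarrow> D k \<subseteq> poly_below (2 * ds k)"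
    and c: "(\<Sum>((k, p), b)\<in>(SIGMA k:{1..r}. D k) \<times> UNIV.
      fls_const (c ((k, p), b)) * eigen (airy_fun b) k (coeff p)) = 0"
    and kp: "k \<in> {1..r}" "p \<in> D k"
  shows "c ((k, p), b) = 0"
proof -
  define T where "T = (\<lambda>k b. \<Sum>p\<in>D k. Polynomial.smult (c ((k, p), b)) p)"
  have "(\<Sum>(k, b)\<in>{1..r} \<times> UNIV. op_act 1 (eigen (airy_fun b) k (coeff (T k b)))) = 0"
    unfolding T_def using c by (subst family_sum[symmetric, OF D(1)]) simp_all
  hence "op_act 1 (airy_comb (coeff (T k b)) (2 * ds k) (airy_sol_at (k, b))) = 0"
    by (rule kills_components[OF _ kp(1) airy_sol_at_ode])
  hence "coeff (T k b) i = 0" if "i < 2 * ds k" for i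
    using airy_comb_eq_0_imp[OF airy_sol_at_ode airy_sol_at_nonzero _ that] by simp
  moreover have "T k b \<in> poly_below (2 * ds k)"
    unfolding T_def by (rule poly_below_subspace[OF D(1)[OF kp(1)] D(3)[OF kp(1)]])
  ultimately have "T k b = 0" unfolding poly_below_def by (intro poly_eqI) (auto simp: not_less[symmetric])
  thus ?thesis
    using poly_vs.independentD[OF D(2)[OF kp(1)] D(1)[OF kp(1)] subset_refl, of "\<lambda>p. c ((k, p), b)" p] kp(2)
    by (simp add: T_def)
qed

lemma card_family: "(\<And>k. k \<in> {1..r} \<Longrightarrow> finite (D k)) \<Longrightarrow>
    card ((SIGMA k:{1..r}. D k) \<times> (UNIV :: bool set)) = 2 * (\<Sum>k = 1..r. card (D k))"
  by (subst card_cartesian_product, subst card_SigmaI) auto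

text \<open>Both \<open>P\<close> on its kernel and \<open>P\<^sup>* p\<^sup>-\<^sup>2\<close> on the image of \<open>P\<close> have at most as many independent
  solutions as their order \<open>2 d\<close>, and together these solutions make up the \<open>4 d\<close>-dimensional
  kernel of \<open>Q\<close>.\<close>

lemma poly_kernel_bases:
  assumes "self_adjoint_factorization Q P p"
  shows "\<exists>B. (\<forall>k\<in>{1..r}. finite (B k) \<and> poly_vs.independent (B k) \<and> B k \<subseteq> poly_kernel P k) \<and>
    (\<Sum>k = 1..r. card (B k)) = d \<and> diffop_order P = d + d \<and> P \<noteq> 0"
proof -
  define A where "A = formal_adjoint P * mult_op (1 / p ^ 2)"
  have QAP: "Q = A * P" and p: "p \<noteq> 0"
    using assms by (auto simp: self_adjoint_factorization_def A_def)
  have "Q \<noteq> 0" using Q_monic(1) op_lead_eq_0_iff[of Q] by auto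
  hence nz: "A \<noteq> 0" "P \<noteq> 0" using QAP by auto
  hence "formal_adjoint P \<noteq> 0" by (auto simp: A_def)
  hence oA: "diffop_order A = diffop_order P" using p by (simp add: A_def order_mult)
  hence oP: "diffop_order P = d + d" using Q_monic(2) QAP nz by (simp add: order_mult)
  define W where "W = (\<lambda>k. poly_below (2 * ds k))"
  \<comment> \<open>\<open>B\<close> is a basis of the kernel polynomials and \<open>C\<close>
    extends it to a basis of all coefficient vectors; the difference spans a complement on which
    \<open>P\<close> is injective.\<close>
  have "\<forall>k. \<exists>B C. B \<subseteq> poly_kernel P k \<and> poly_vs.independent B \<and> poly_kernel P k \<subseteq> poly_vs.span B \<and>
      B \<subseteq> C \<and> C \<subseteq> W k \<and> poly_vs.independent C \<and> W k \<subseteq> poly_vs.span C"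
    (is "\<forall>k. ?E k")
  proof
    fix k
    obtain B where B: "B \<subseteq> poly_kernel P k" "poly_vs.independent B" "poly_kernel P k \<subseteq> poly_vs.span B"
      using poly_vs.maximal_independent_subset by blast
    have "B \<subseteq> W k" using B(1) by (auto simp: W_def poly_kernel_def)
    then obtain C where "B \<subseteq> C" "C \<subseteq> W k" "poly_vs.independent C" "W k \<subseteq> poly_vs.span C"
      using poly_vs.maximal_independent_subset_extend B(2) by blast
    thus "?E k" using B by blast
  qed
  then obtain B C where B: "\<And>k. B k \<subseteq> poly_kernel P k" "\<And>k. poly_vs.independent (B k)"
      "\<And>k. poly_kernel P k \<subseteq> poly_vs.span (B k)"
    and C: "\<And>k. B k \<subseteq> C k" "\<And>k. C k \<subseteq> W k" "\<And>k. poly_vs.independent (C k)" "\<And>k. W k \<subseteq> poly_vs.span (C k)"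
    by metis
  have finC: "finite (C k)" and cardC: "card (C k) = 2 * ds k" for k
    using poly_below_basis_card[OF C(3), of k "2 * ds k"] C(2,4) by (auto simp: W_def)
  have finB: "finite (B k)" for k using finC C(1) finite_subset by blast
  define E where "E = (\<lambda>k. C k - B k)"
  have finE: "finite (E k)" for k using finC by (simp add: E_def)
  have cardE: "card (E k) + card (B k) = 2 * ds k" for k
    using card_Diff_subset[OF finB C(1), of k] card_mono[OF finC C(1), of k] cardC[of k] by (simp add: E_def)
  let ?JB = "(SIGMA k:{1..r}. B k) \<times> (UNIV :: bool set)"
  let ?JE = "(SIGMA k:{1..r}. E k) \<times> (UNIV :: bool set)"
  define \<phi> where "\<phi> = (\<lambda>j :: (nat \<times> complex poly) \<times> bool.
      eigen (airy_fun (snd j)) (fst (fst j)) (coeff (snd (fst j))))"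
  have "card ?JB \<le> diffop_order P"
  proof (rule kernel_card_le_order[where \<phi> = \<phi>])
    show "op_act P (\<phi> j) = 0" if j: "j \<in> ?JB" for j
    proof -
      obtain k p b where kp: "j = ((k, p), b)" "p \<in> B k" using j by auto
      hence "op_act P (airy_comb (coeff p) (2 * ds k) (airy_sol_at (k, b))) = 0"
        using B(1) airy_sol_at_ode unfolding poly_kernel_def by blast
      thus ?thesis by (simp add: \<phi>_def kp(1) eigen_def airy_sol_at_def)
    qed
  next
    fix c j
    assume c: "(\<Sum>j\<in>?JB. fls_const (c j) * \<phi> j) = 0"
      and j: "j \<in> ?JB"
    obtain k p b where kp: "j = ((k, p), b)" "k \<in> {1..r}" "p \<in> B k" using j by auto
    have "(\<Sum>((k, p), b)\<in>?JB. fls_const (c ((k, p), b)) * eigen (airy_fun b) k (coeff p)) = 0"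
      using c by (simp add: \<phi>_def case_prod_unfold)
    thus "c j = 0" unfolding kp(1)
      by (rule eigen_family_independent[rotated 3]) (use kp finB B(1,2) in \<open>auto simp: poly_kernel_def\<close>)
  qed (use nz finB in auto)
  moreover have "card ?JE \<le> diffop_order A"
  proof (rule kernel_card_le_order[where \<phi> = "\<lambda>j. op_act P (\<phi> j)"])
    have "op_act A (op_act P (eigen (airy_fun b) k u)) = 0" if "k \<in> {1..r}" for b k u
      using Q_kills_eigen[OF airy_entire_airy_fun that, of b u] by (simp add: QAP)
    thus "op_act A (op_act P (\<phi> j)) = 0" if "j \<in> ?JE" for j
      using that by (auto simp: \<phi>_def)
  next
    fix c j
    assume c: "(\<Sum>j\<in>?JE. fls_const (c j) * op_act P (\<phi> j)) = 0"
      and j: "j \<in> ?JE"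
    obtain k p b where kp: "j = ((k, p), b)" "k \<in> {1..r}" "p \<in> E k" using j by auto
    define T where "T = (\<lambda>k b. \<Sum>p\<in>E k. Polynomial.smult (c ((k, p), b)) p)"
    have "(\<Sum>((k, p), b)\<in>?JE. fls_const (c ((k, p), b)) * op_act P (eigen (airy_fun b) k (coeff p))) = 0"
      using c by (simp add: \<phi>_def case_prod_unfold)
    hence "(\<Sum>(k, b)\<in>{1..r} \<times> UNIV. op_act P (eigen (airy_fun b) k (coeff (T k b)))) = 0"
      unfolding T_def by (subst family_sum[symmetric, OF finE])
    \<comment> \<open>A relation among the images puts the combination \<open>T k b\<close> of
      \<open>E k\<close> into the kernel, hence into the span of \<open>B k\<close>; independence of
      \<open>C k\<close> then makes it trivial.\<close>
    from kills_components[OF this kp(2)]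
    have "\<forall>Y. airy_ode (a k) Y \<longrightarrow> op_act P (airy_comb (coeff (T k b)) (2 * ds k) Y) = 0" by blast
    moreover have "T k b \<in> poly_below (2 * ds k)"
      unfolding T_def by (rule poly_below_subspace[OF finE]) (use C(2) in \<open>auto simp: E_def W_def\<close>)
    ultimately have "T k b \<in> poly_kernel P k" by (simp add: poly_kernel_def)
    hence "T k b \<in> poly_vs.span (B k)" using B(3) by blast
    then obtain e where e: "T k b = (\<Sum>p\<in>B k. Polynomial.smult (e p) p)"
      unfolding poly_vs.span_finite[OF finB] by blast
    define s where "s = (\<lambda>p. if p \<in> B k then - e p else c ((k, p), b))"
    have "C k = B k \<union> E k" "B k \<inter> E k = {}" using C(1)[of k] by (auto simp: E_def)
    hence "(\<Sum>p\<in>C k. Polynomial.smult (s p) p)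
        = (\<Sum>p\<in>B k. Polynomial.smult (s p) p) + (\<Sum>p\<in>E k. Polynomial.smult (s p) p)"
      using finB finE by (simp add: sum.union_disjoint)
    also have "(\<Sum>p\<in>B k. Polynomial.smult (s p) p) = - T k b"
      unfolding e sum_negf[symmetric] by (intro sum.cong) (auto simp: s_def)
    also have "(\<Sum>p\<in>E k. Polynomial.smult (s p) p) = T k b"
      unfolding T_def by (intro sum.cong) (auto simp: s_def E_def)
    finally have "(\<Sum>p\<in>C k. Polynomial.smult (s p) p) = 0" by simp
    hence "s p = 0"
      by (rule poly_vs.independentD[OF C(3) finC subset_refl]) (use kp(3) in \<open>auto simp: E_def\<close>)
    thus "c j = 0" using kp by (simp add: s_def E_def)
  qed (use nz finE in auto)
  moreover have "(\<Sum>k = 1..r. card (E k)) + (\<Sum>k = 1..r. card (B k)) = 2 * d"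
    unfolding sum.distrib[symmetric] cardE d by (simp add: sum_distrib_left)
  \<comment> \<open>With the two solutions per polynomial, each of the totals for \<open>B\<close>
    and \<open>E\<close> is at most d; they add up to 2d, so both equal d.\<close>
  ultimately have "(\<Sum>k = 1..r. card (B k)) = d"
    using card_family[of B] card_family[of E] finB finE oA oP by simp
  thus ?thesis using B finB oP nz by blast
qed

end

section \<open>Every factorization arises from Airy data\<close>

context airy_eigenspaces
begin

text \<open>In the composition rule the first term vanishes because P f = 0. The second does because
  the adjoint of P^* p^(-2) is p^(-2) P, which kills g.\<close>

lemma factor_kernel_isotropic:
  assumes "self_adjoint_factorization Q P p" "op_act P f = 0" "op_act P g = 0"
  shows "concomitant Q f g = 0"
proof -
  let ?A = "formal_adjoint P * mult_op (1 / p ^ 2)"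
  have "Q = ?A * P" using assms(1) by (simp add: self_adjoint_factorization_def)
  hence "concomitant Q f g = concomitant P f (op_act (formal_adjoint ?A) g)"
    using assms(2) by (simp add: concomitant_mult)
  also have "op_act (formal_adjoint ?A) g = 0"
    using assms(3) by (simp add: formal_adjoint_mult)
  finally show ?thesis by simp
qed

text \<open>The bases of kernel polynomials have d elements in total. Enumerating them gives
  \<open>l\<close> as the eigenvalue index and \<open>\<alpha>\<close> as the coefficients.\<close>

lemma factorization_airy_data:
  assumes fac: "self_adjoint_factorization Q P p"
  shows "\<exists>l \<alpha> f g. airy_data r a ds d q l \<alpha> f g \<and>
    (\<forall>c<d + d. op_act P (fexp (fun_list d f g ! c)) = 0)"
proof -
  obtain B where B: "\<And>k. k \<in> {1..r} \<Longrightarrow> finite (B k)" "\<And>k. k \<in> {1..r} \<Longrightarrow> poly_vs.independent (B k)"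
    "\<And>k. k \<in> {1..r} \<Longrightarrow> B k \<subseteq> poly_kernel P k" "(\<Sum>k = 1..r. card (B k)) = d"
    using poly_kernel_bases[OF fac] by blast
  define J where "J = (SIGMA k:{1..r}. B k)"
  have J: "finite J" "card J = card {1..d}" using B(1,4) by (auto simp: J_def card_SigmaI)
  obtain \<beta> where \<beta>: "bij_betw \<beta> {1..d} J" using finite_same_card_bij[OF _ J(1) J(2)[symmetric]] by auto
  have \<beta>J: "fst (\<beta> i) \<in> {1..r}" "snd (\<beta> i) \<in> B (fst (\<beta> i))" if "i \<in> {1..d}" for i
  proof -
    have "\<beta> i \<in> J" using bij_betwE[OF \<beta>] that by blast
    thus "fst (\<beta> i) \<in> {1..r}" "snd (\<beta> i) \<in> B (fst (\<beta> i))" unfolding J_def by auto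
  qed
  define l where "l = (\<lambda>i. fst (\<beta> i))"
  define \<alpha> where "\<alpha> = (\<lambda>i. coeff (snd (\<beta> i)))"
  define F where "F = (\<lambda>b i. comb_fun (\<alpha> i) (2 * ds (l i)) (airy_fun b) (a (l i)))"
  define f where "f = F False"
  define g where "g = F True"
  let ?hs = "fun_list d f g"
  have ent: "airy_fun b holomorphic_on UNIV" for b using airy_entire_airy_fun by (simp add: airy_entire_def)
  have Fent: "F b i holomorphic_on UNIV" for b i unfolding F_def by (rule comb_fun_entire[OF ent])
  have fexpF: "fexp (F b i) = eigen (airy_fun b) (l i) (\<alpha> i)" if "i \<in> {1..d}" for b i
    unfolding F_def using \<beta>J[OF that] by (simp add: fexp_comb_fun_eigen airy_entire_airy_fun l_def)
  have PF: "op_act P (fexp (F b i)) = 0" if "i \<in> {1..d}" for b i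
  proof -
    have "snd (\<beta> i) \<in> poly_kernel P (l i)" using B(3) \<beta>J[OF that] by (auto simp: l_def)
    hence "op_act P (airy_comb (\<alpha> i) (2 * ds (l i)) (airy_sol_at (l i, b))) = 0"
      using airy_sol_at_ode unfolding poly_kernel_def \<alpha>_def by blast
    thus ?thesis using fexpF[OF that] by (simp add: eigen_def airy_sol_at_def)
  qed
  have hs: "?hs ! c = (if c < d then F False (Suc c) else F True (Suc (c - d)))" if "c < d + d" for c
    using that fun_list_nth(2)[of c d f g] fun_list_nth(3)[of "c - d" d f g] by (auto simp: f_def g_def)
  have "fls_indep (d + d) (\<lambda>c. fexp (?hs ! c))"
    unfolding fls_indep_def
  proof (intro allI impI)
    fix \<gamma> c
    assume \<gamma>: "(\<Sum>c<d + d. fls_const (\<gamma> c) * fexp (?hs ! c)) = 0" and c: "c < d + d"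
    define \<sigma> where "\<sigma> = inv_into {1..d} \<beta>"
    \<comment> \<open>Translates between positions in the list and pairs of basis element and
      solution: positions count from 0 while \<sigma> counts from 1, and the Bi half is shifted by
      d.\<close>
    define e where "e = (\<lambda>(j, b). \<gamma> (\<sigma> j - 1 + (if b then d else 0)))"
    have \<sigma>: "\<sigma> (\<beta> i) = i" if "i \<in> {1..d}" for i
      using bij_betw_inv_into_left[OF \<beta> that] by (simp add: \<sigma>_def)
    let ?t = "\<lambda>b i. fls_const (e (\<beta> i, b)) * fexp (F b i)"
    have shift: "(\<Sum>i = 1..d. h i) = (\<Sum>c<d. h (Suc c))" for h :: "nat \<Rightarrow> complex fls"
      by (rule sum.reindex_bij_witness[of _ Suc "\<lambda>i. i - 1"]) auto
    have "(\<Sum>(j, b)\<in>J \<times> UNIV. fls_const (e (j, b)) * eigen (airy_fun b) (fst j) (coeff (snd j)))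
        = (\<Sum>j\<in>J. \<Sum>b\<in>UNIV. fls_const (e (j, b)) * eigen (airy_fun b) (fst j) (coeff (snd j)))"
      by (rule sum.cartesian_product[symmetric])
    also have "\<dots> = (\<Sum>i = 1..d. \<Sum>b\<in>UNIV. fls_const (e (\<beta> i, b)) * eigen (airy_fun b) (fst (\<beta> i)) (coeff (snd (\<beta> i))))"
      by (rule sum.reindex_bij_betw[OF \<beta>, symmetric])
    also have "\<dots> = (\<Sum>i = 1..d. ?t False i + ?t True i)"
      by (intro sum.cong refl) (simp add: UNIV_bool fexpF l_def \<alpha>_def add.commute)
    also have "\<dots> = (\<Sum>c<d. ?t False (Suc c)) + (\<Sum>c<d. ?t True (Suc c))"
      unfolding sum.distrib shift ..
    also have "(\<Sum>c<d. ?t False (Suc c)) = (\<Sum>c = 0..<d. fls_const (\<gamma> c) * fexp (?hs ! c))"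
      by (intro sum.cong) (auto simp: hs e_def \<sigma>)
    also have "(\<Sum>c<d. ?t True (Suc c)) = (\<Sum>c = 0..<d. fls_const (\<gamma> (c + d)) * fexp (?hs ! (c + d)))"
      by (intro sum.cong) (auto simp: hs e_def \<sigma>)
    also have "\<dots> = (\<Sum>c = d..<d + d. fls_const (\<gamma> c) * fexp (?hs ! c))"
      using sum.shift_bounds_nat_ivl[of "\<lambda>c. fls_const (\<gamma> c) * fexp (?hs ! c)" 0 d d] by simp
    also have "(\<Sum>c = 0..<d. fls_const (\<gamma> c) * fexp (?hs ! c)) + \<dots> = (\<Sum>c = 0..<d + d. fls_const (\<gamma> c) * fexp (?hs ! c))"
      by (rule sum.atLeastLessThan_concat) auto
    also have "\<dots> = 0" using \<gamma> by (simp only: atLeast0LessThan)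
    finally have z: "(\<Sum>((k, p), b)\<in>(SIGMA k:{1..r}. B k) \<times> UNIV.
        fls_const (e ((k, p), b)) * eigen (airy_fun b) k (coeff p)) = 0"
      by (simp add: J_def case_prod_unfold)
    have "e (\<beta> i, b) = 0" if "i \<in> {1..d}" for i b
    proof -
      obtain k p where kp: "\<beta> i = (k, p)" by fastforce
      have "e ((k, p), b) = 0"
        by (rule eigen_family_independent[OF B(1,2) _ z])
          (use B(3) \<beta>J[OF that] kp in \<open>auto simp: poly_kernel_def\<close>)
      thus ?thesis by (simp add: kp)
    qed
    note e0 = this
    show "\<gamma> c = 0"
    proof (cases "c < d")
      case True
      thus ?thesis using e0[of "Suc c" False] by (simp add: e_def \<sigma>)
    next
      case False
      thus ?thesis using e0[of "Suc (c - d)" True] c by (simp add: e_def \<sigma>)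
    qed
  qed
  hence ind: "lin_indep_funs ?hs"
    using lin_indep_funs_iff[of ?hs] hs Fent by (simp add: fun_list_nth)
  have pop: "poly_op Q" by (simp add: Q_eq poly_op_Airy_poly)
  have ker: "F b i \<in> diffop_ker Q" if "i \<in> {1..d}" for b i
    unfolding diffop_ker_iff[OF pop Fent] fexpF[OF that]
    using \<beta>J[OF that] by (simp add: Q_kills_eigen airy_entire_airy_fun l_def)
  have bil: "bilinear_form q (a k) (ds k) (\<alpha> i) (\<alpha> j) = 0"
    if "i \<in> {1..d}" "j \<in> {1..d}" "l i = k" "l j = k" for i j k
  proof -
    have k: "k \<in> {1..r}" using \<beta>J(1)[OF that(1)] that(3) by (simp add: l_def)
    \<comment> \<open>The mixed pair is essential: for two Ai combinations the Wronskian factor is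
      zero and says nothing about the bilinear form.\<close>
    have "concomitant Q (fexp (F False i)) (fexp (F True j)) = 0"
      by (rule factor_kernel_isotropic[OF fac PF[OF that(1)] PF[OF that(2)]])
    hence "concomitant Q (eigen (airy_fun False) k (\<alpha> i)) (eigen (airy_fun True) k (\<alpha> j)) = 0"
      unfolding fexpF[OF that(1)] fexpF[OF that(2)] that(3,4) .
    hence "fls_const (bilinear_form q (a k) (ds k) (\<alpha> i) (\<alpha> j))
        * wr (airy_sol_at (k, False)) (airy_sol_at (k, True)) = 0"
      using concomitant_eigen[OF airy_entire_airy_fun airy_entire_airy_fun k, of False "\<alpha> i" True "\<alpha> j"]
      by (simp add: airy_sol_at_def)
    thus ?thesis using wr_airy_sol_at[of k] by simp
  qed
  have "airy_data r a ds d q l \<alpha> f g"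
    unfolding airy_data_def
  proof (intro conjI ballI allI impI)
    show "lin_indep_funs (fun_list d f g)" by (rule ind)
    show "l i \<in> {1..r}" if "i \<in> {1..d}" for i using \<beta>J(1)[OF that] by (simp add: l_def)
    show "f i \<in> diffop_ker Q" "g i \<in> diffop_ker Q" if "i \<in> {1..d}" for i
      unfolding f_def g_def by (rule ker[OF that])+
    show "f i x = (\<Sum>m = 0..2 * ds (l i) - 1. \<alpha> i m * (deriv ^^ m) Ai (x + a (l i)))" for i x
      by (simp add: f_def F_def comb_fun_def airy_fun_def)
    show "g i x = (\<Sum>n = 0..2 * ds (l i) - 1. \<alpha> i n * (deriv ^^ n) Bi (x + a (l i)))" for i x
      by (simp add: g_def F_def comb_fun_def airy_fun_def)
    show "bilinear_form q (a k) (ds k) (\<alpha> i) (\<alpha> j) = 0"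
      if "i \<in> {1..d}" "j \<in> {1..d}" "l i = k \<and> l j = k" for i j k
      using bil that by blast
  qed
  moreover have "\<forall>c<d + d. op_act P (fexp (?hs ! c)) = 0"
    using hs PF by auto
  ultimately show ?thesis by blast
qed

text \<open>Both operators have order 2d and kill the same 2d independent functions. Once the
  leading coefficients are matched, their difference has smaller order and must vanish.\<close>

lemma factorization_is_wronskian:
  assumes fac: "self_adjoint_factorization Q P p"
  shows "\<exists>l \<alpha> f g P0 p0 h. airy_data r a ds d q l \<alpha> f g \<and> is_wronskian_op (fun_list d f g) P0 \<and>
    self_adjoint_factorization Q P0 p0 \<and> h \<noteq> 0 \<and> P = mult_op h * P0 \<and> p = h * p0"
proof -
  obtain l \<alpha> f g where data: "airy_data r a ds d q l \<alpha> f g"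
    and kill: "\<forall>c<d + d. op_act P (fexp (fun_list d f g ! c)) = 0"
    using factorization_airy_data[OF fac] by blast
  obtain P0 where P0: "is_wronskian_op (fun_list d f g) P0" "diffop_order P0 = d + d"
    "fls_indep (d + d) (\<lambda>c. fexp (fun_list d f g ! c))"
    "\<forall>c<d + d. op_act P0 (fexp (fun_list d f g ! c)) = 0"
    using airy_data_factorization[OF data] by blast
  have P: "diffop_order P = d + d" "P \<noteq> 0" using poly_kernel_bases[OF fac] by blast+
  have P0nz: "P0 \<noteq> 0" using P0(2) d_pos by (auto simp: diffop_order_def zero_diffop.rep_eq)
  define h where "h = op_lead P / op_lead P0"
  have h: "h \<noteq> 0" using P P0nz by (simp add: h_def)
  have "op_lead (mult_op h * P0) = op_lead P" using P0nz by (simp add: op_lead_mult h_def)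
  moreover have o: "diffop_order (mult_op h * P0) = d + d" using h P0nz P0(2) by (simp add: order_mult)
  ultimately have "diffop_coeff P (d + d) = diffop_coeff (mult_op h * P0) (d + d)"
    using P(1) by (simp add: op_lead_def)
  hence "P = mult_op h * P0 \<or> diffop_order (P - mult_op h * P0) < d + d"
    using order_less_by_lead[of P "mult_op h * P0" "d + d"] P(1) o by auto
  moreover have "\<forall>c<d + d. op_act (P - mult_op h * P0) (fexp (fun_list d f g ! c)) = 0"
    using kill P0(4) by simp
  ultimately have PP: "P = mult_op h * P0" using op_eq_0_if_kills[OF P0(3)] by force
  have p: "p \<noteq> 0" using fac by (simp add: self_adjoint_factorization_def)
  \<comment> \<open>\<open>p0\<close> is p / h, not \<open>op_lead P0\<close>: the two agree only up
    to sign, and p = h p0 must hold exactly.\<close>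
  have "1 / (p / h) ^ 2 = h * (1 / p ^ 2) * h" using h p by (simp add: power2_eq_square field_simps)
  hence "mult_op (1 / (p / h) ^ 2) = mult_op h * mult_op (1 / p ^ 2) * mult_op h"
    by (simp only: mult_op_mult)
  moreover have "Q = formal_adjoint P0 * (mult_op h * mult_op (1 / p ^ 2) * mult_op h) * P0"
    using fac unfolding self_adjoint_factorization_def PP
    by (simp add: formal_adjoint_mult mult.assoc)
  ultimately have "self_adjoint_factorization Q P0 (p / h)"
    using h p by (simp add: self_adjoint_factorization_def)
  thus ?thesis using data P0(1) h PP
    by (intro exI[of _ l] exI[of _ \<alpha>] exI[of _ f] exI[of _ g] exI[of _ P0] exI[of _ "p / h"] exI[of _ h]) simp
qed

end

theorem theorem3p14:
  fixes r d :: nat and a :: "nat \<Rightarrow> complex" and ds :: "nat \<Rightarrow> nat" and q :: "complex poly"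
  assumes "1 \<le> r"
    and "inj_on a {1..r}"
    and "\<forall>k\<in>{1..r}. 0 < ds k"
    and "q = (\<Prod>k = 1..r. [:- a k, 1:] ^ ds k)"
    and "d = (\<Sum>k = 1..r. ds k)"
  shows
    "(\<forall>l \<alpha> f g. airy_data r a ds d q l \<alpha> f g \<longrightarrow>
        (\<exists>P. is_wronskian_op (fun_list d f g) P \<and> diffop_order P = 2 * d \<and>
             (\<exists>p. self_adjoint_factorization (poly_at_diffop q Airy_op ^ 2) P p))) \<and>
     (\<forall>P p. self_adjoint_factorization (poly_at_diffop q Airy_op ^ 2) P p \<longrightarrow>
        (\<exists>l \<alpha> f g P0 p0 h. airy_data r a ds d q l \<alpha> f g \<and>
             is_wronskian_op (fun_list d f g) P0 \<and>
             self_adjoint_factorization (poly_at_diffop q Airy_op ^ 2) P0 p0 \<and>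
             h \<noteq> 0 \<and> P = mult_op h * P0 \<and> p = h * p0))"
proof -
  interpret airy_eigenspaces r d a ds q by unfold_locales (use assms in auto)
  show ?thesis
  proof (intro conjI allI impI)
    fix l \<alpha> f g
    assume "airy_data r a ds d q l \<alpha> f g"
    from airy_data_factorization[OF this]
    show "\<exists>P. is_wronskian_op (fun_list d f g) P \<and> diffop_order P = 2 * d \<and>
        (\<exists>p. self_adjoint_factorization (poly_at_diffop q Airy_op ^ 2) P p)"
      unfolding mult_2 by blast
  next
    fix P p
    assume "self_adjoint_factorization (poly_at_diffop q Airy_op ^ 2) P p"
    thus "\<exists>l \<alpha> f g P0 p0 h. airy_data r a ds d q l \<alpha> f g \<and>
        is_wronskian_op (fun_list d f g) P0 \<and>
        self_adjoint_factorization (poly_at_diffop q Airy_op ^ 2) P0 p0 \<and>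
        h \<noteq> 0 \<and> P = mult_op h * P0 \<and> p = h * p0"
      by (rule factorization_is_wronskian)
  qed
qed

end
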